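(* Let $m$ be a quasi-Bernoulli measure in $[0,1)^D$, let $\delta=\dim(\mathrm{supp}\,(m))$ be the Hausdorff dimension of its closed support and $d=\dim(m)$ its dimension. Suppose that the $L^q$-spectrum $\tau$ is analytic. Then there are only two possible cases: (i) $d=\delta$ and the measure $m$ is strongly equivalent to the Hausdorff measure $\mathcal H^\delta$ on $\mathrm{supp}\,(m)$; or (ii) $d<\delta$ and the measure $m$ is singular with respect to $\mathcal H^d$ but absolutely continuous with respect to $\widehat{\mathcal P}^d$.
   Context: Fix integers $D\ge1$, $\ell\ge2$. $\mathcal F_n$ is the family of $\ell$-adic cubes $\prod_{i=1}^D[k_i/\ell^n,(k_i+1)/\ell^n)$, $0\le k_i<\ell^n$. For each $n$ the cubes of $\mathcal F_n$ are coded bijectively as $I_{\varepsilon_1\cdots\varepsilon_n}$, $\varepsilon_i\in\{0,\dots,\ell^D-1\}$, with $I_{\varepsilon_1\cdots\varepsilon_{n+1}}\subset I_{\varepsilon_1\cdots\varepsilon_n}$. For $I=I_{\varepsilon_1\cdots\varepsilon_n}\in\mathcal F_n$ and $J=I_{\varepsilon_{n+1}\cdots\varepsilon_{n+p}}\in\mathcal F_p$, let $IJ=I_{\varepsilon_1\cdots\varepsilon_{n+p}}\in\mathcal F_{n+p}$. A Borel probability measure $m$ on $[0,1)^D$ is quasi-Bernoulli if there is a constant $C\ge1$ with $\frac1Cm(I)m(J)\le m(IJ)\le C\,m(I)m(J)$ for all $I,J\in\bigcup_n\mathcal F_n$. The $L^q$-spectrum is $\tau(q)=\limsup_{n\to\infty}\frac{1}{n\log\ell}\log\left(\sum_{I\in\mathcal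 F_n}m(I)^q\right)$, $q\in\mathbb R$ (sum over cubes with $m(I)>0$). For quasi-Bernoulli $m$ it is known that $\tau$ is $C^1$ on $\mathbb R$ and that $m$ is unidimensional, i.e. $\inf\{\dim E:m(E)>0\}=\inf\{\dim E:m(E)=1\}$ ($E$ Borel, $\dim$ Hausdorff dimension); the common value is denoted $\dim(m)$ and equals $-\tau'(1)$. $m$ is strongly equivalent to $\mathcal H^\delta$ on $\mathrm{supp}\,(m)$ means: there is $C\ge1$ with $\frac1C\mathcal H^\delta(A\cap\mathrm{supp}\,(m))\le m(A)\le C\,\mathcal H^\delta(A\cap\mathrm{supp}\,(m))$ for every Borel set $A$. $\mathcal H^s$ is the $s$-dimensional Hausdorff measure. The packing measure is $\widehat{\mathcal P}^s(E)=\inf\{\sum_i\mathcal P^s(E_i):E\subset\bigcup_iE_i\}$ (countable covers), where $\mathcal P^s(E)=\lim_{\eta\to0}\sup\{\sum_i|B_i|^s\}$, the supremum being over countable families of pairwise disjoint balls $B_i$ centered in $E$ with diameter $0<|B_i|\le\eta$. Singular with respect to $\mathcal H^d$: there is a Borel set $E$ with $m(E)=1$ and $\mathcal H^d(E)=0$. Absolutely continuous with respect to $\widehat{\mathcal P}^d$: $\widehat{\mathcal P}^d(E)=0$ implies $m(E)=0$ for every Borel set $E$. *)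

theory Defs
  imports "HOL-Probability.Probability_Measure"
begin

section \<open>Cubes, codings and quasi-Bernoulli measures\<close>

text \<open>The ambient space is \<^typ>\<open>real^'n\<close>, with \<open>D = CARD('n)\<close>.\<close>

definition unit_cube :: "(real^'n) set" where
  "unit_cube = {x. \<forall>i. 0 \<le> x $ i \<and> x $ i < 1}"

definition adic_cube :: "nat \<Rightarrow> nat \<Rightarrow> ('n \<Rightarrow> nat) \<Rightarrow> (real^'n) set" where
  "adic_cube l n k =
     {x. \<forall>i. real (k i) / real l ^ n \<le> x $ i \<and> x $ i < (real (k i) + 1) / real l ^ n}"

definition adic_cubes :: "nat \<Rightarrow> nat \<Rightarrow> (real^'n) set set" where
  "adic_cubes l n = {adic_cube l n k | k. \<forall>i. k i < l ^ n}"

text \<open>A coding assigns to each word over the alphabet \<open>{0, \<dots>, l ^ D - 1}\<close> of length \<open>n\<close> a cube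
  of generation \<open>n\<close>. Besides bijectivity and nesting nothing is required: the position of the
  subcube with last digit \<open>e\<close> may depend on the parent cube.\<close>

definition cube_coding :: "nat \<Rightarrow> (nat list \<Rightarrow> (real^'n) set) \<Rightarrow> bool" where
  "cube_coding l I \<longleftrightarrow>
     (\<forall>n. bij_betw I {w \<in> lists {..<l ^ CARD('n)}. length w = n} (adic_cubes l n)) \<and>
     (\<forall>w \<in> lists {..<l ^ CARD('n)}. \<forall>e < l ^ CARD('n). I (w @ [e]) \<subseteq> I w)"

text \<open>If \<open>u\<close> and \<open>v\<close> are the words coding the cubes \<open>I u\<close> and \<open>I v\<close>, then the product of these two
  cubes is \<open>I (u @ v)\<close>.\<close>

definition quasi_bernoulli ::
  "nat \<Rightarrow> (nat list \<Rightarrow> (real^'n) set) \<Rightarrow> (real^'n) measure \<Rightarrow> bool" where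
  "quasi_bernoulli l I m \<longleftrightarrow>
     (\<exists>C\<ge>1. \<forall>u \<in> lists {..<l ^ CARD('n)}. \<forall>v \<in> lists {..<l ^ CARD('n)}.
        1 / C * (measure m (I u) * measure m (I v)) \<le> measure m (I (u @ v)) \<and>
        measure m (I (u @ v)) \<le> C * (measure m (I u) * measure m (I v)))"

section \<open>The \<open>L\<^sup>q\<close>-spectrum\<close>

text \<open>The upper limit is taken in the extended reals; for quasi-Bernoulli measures it is finite for
  every real \<open>q\<close>.\<close>

definition Lq_spectrum :: "nat \<Rightarrow> (real^'n) measure \<Rightarrow> real \<Rightarrow> real" where
  "Lq_spectrum l m q =
     real_of_ereal (limsup (\<lambda>n. ereal (1 / (real n * ln (real l)) *
       ln (\<Sum>I \<in> {I \<in> adic_cubes l n. measure m I > 0}. measure m I powr q))))"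

definition real_analytic :: "(real \<Rightarrow> real) \<Rightarrow> bool" where
  "real_analytic f \<longleftrightarrow>
     (\<forall>x. \<exists>r>0. \<exists>a :: nat \<Rightarrow> real. \<forall>y. \<bar>y - x\<bar> < r \<longrightarrow> (\<lambda>n. a n * (y - x) ^ n) sums f y)"

section \<open>Hausdorff measure and dimension\<close>

text \<open>\<open>diam_pow s U\<close> is the \<open>s\<close>-th power of the diameter of \<open>U\<close>. The case \<open>s = 0\<close> is separate since
  \<open>0 powr 0 = 0\<close>, whereas the 0-dimensional Hausdorff measure counts points. Unbounded sets, for
  which \<^const>\<open>diameter\<close> is meaningless, are excluded from the coverings below.\<close>

definition diam_pow :: "real \<Rightarrow> 'a::metric_space set \<Rightarrow> ennreal" where
  "diam_pow s U = (if U = {} then 0 else if s = 0 then 1 else ennreal (diameter U powr s))"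

definition hausdorff_pre :: "real \<Rightarrow> real \<Rightarrow> 'a::metric_space set \<Rightarrow> ennreal" where
  "hausdorff_pre s \<eta> E =
     (INF U \<in> {U :: nat \<Rightarrow> 'a set. E \<subseteq> (\<Union>i. U i) \<and> (\<forall>i. bounded (U i) \<and> diameter (U i) \<le> \<eta>)}.
        \<Sum>i. diam_pow s (U i))"

definition hausdorff_measure :: "real \<Rightarrow> 'a::metric_space set \<Rightarrow> ennreal" where
  "hausdorff_measure s E = (SUP \<eta> \<in> {0<..}. hausdorff_pre s \<eta> E)"

text \<open>In \<^typ>\<open>real^'n\<close> the set whose infimum is taken is nonempty.\<close>

definition hausdorff_dim :: "(real^'n) set \<Rightarrow> real" where
  "hausdorff_dim E = Inf {s. 0 \<le> s \<and> hausdorff_measure s E = 0}"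

section \<open>Packing measure\<close>

text \<open>Balls are closed; open balls give the same value. The limit as \<open>\<eta>\<close> tends to \<open>0\<close> is an
  infimum by monotonicity.\<close>

definition packings :: "real \<Rightarrow> 'a::metric_space set \<Rightarrow> 'a set set set" where
  "packings \<eta> E =
     {\<B>. countable \<B> \<and> disjoint \<B> \<and>
          (\<forall>B \<in> \<B>. (\<exists>x \<in> E. \<exists>r. B = cball x r) \<and> 0 < diameter B \<and> diameter B \<le> \<eta>)}"

definition packing_pre :: "real \<Rightarrow> 'a::metric_space set \<Rightarrow> ennreal" where
  "packing_pre s E =
     (INF \<eta> \<in> {0<..}. SUP \<B> \<in> packings \<eta> E. \<Sum>\<^sub>\<infinity>B\<in>\<B>. ennreal (diameter B powr s))"

definition packing_measure :: "real \<Rightarrow> 'a::metric_space set \<Rightarrow> ennreal" where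
  "packing_measure s E =
     (INF F \<in> {F :: nat \<Rightarrow> 'a set. E \<subseteq> (\<Union>i. F i)}. \<Sum>i. packing_pre s (F i))"

section \<open>Support and dimension of a measure\<close>

definition closed_support :: "'a::topological_space measure \<Rightarrow> 'a set" where
  "closed_support m = {x. \<forall>U. open U \<and> x \<in> U \<longrightarrow> emeasure m U > 0}"

definition lower_dim :: "(real^'n) measure \<Rightarrow> real" where
  "lower_dim m = Inf (hausdorff_dim ` {E \<in> sets borel. emeasure m E > 0})"

definition upper_dim :: "(real^'n) measure \<Rightarrow> real" where
  "upper_dim m = Inf (hausdorff_dim ` {E \<in> sets borel. emeasure m E = 1})"

text \<open>The common value of the two dimensions; meaningful only for unidimensional measures, in
  particular for quasi-Bernoulli ones.\<close>

definition measure_dim :: "(real^'n) measure \<Rightarrow> real" where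
  "measure_dim m = (THE d. lower_dim m = d \<and> upper_dim m = d)"

section \<open>Comparison of measures\<close>

definition strongly_equiv_hausdorff :: "real \<Rightarrow> 'a::metric_space measure \<Rightarrow> bool" where
  "strongly_equiv_hausdorff s m \<longleftrightarrow>
     (\<exists>C::real. C \<ge> 1 \<and> (\<forall>A \<in> sets borel.
        ennreal (1 / C) * hausdorff_measure s (A \<inter> closed_support m) \<le> emeasure m A \<and>
        emeasure m A \<le> ennreal C * hausdorff_measure s (A \<inter> closed_support m)))"

definition singular_hausdorff :: "real \<Rightarrow> 'a::metric_space measure \<Rightarrow> bool" where
  "singular_hausdorff s m \<longleftrightarrow>
     (\<exists>E \<in> sets borel. emeasure m E = 1 \<and> hausdorff_measure s E = 0)"

definition abs_continuous_packing :: "real \<Rightarrow> 'a::metric_space measure \<Rightarrow> bool" where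
  "abs_continuous_packing s m \<longleftrightarrow>
     (\<forall>E \<in> sets borel. packing_measure s E = 0 \<longrightarrow> emeasure m E = 0)"

end

theory Submission
  imports Defs "HOL-Analysis.Analysis"
begin

text \<open>
  Write \<open>p w\<close> for the measure of the cube coded by a word \<open>w\<close>, put \<open>d = - \<tau>' 1\<close>, and let
  \<open>R w = p w * l powr (n * d)\<close> be the density ratio of a cube of generation \<open>n\<close>. Along the code of a
  random point, \<open>ln (R w)\<close> behaves like a random walk without drift, and the two cases of the
  theorem say that this walk is either bounded or oscillates between \<open>- \<infinity>\<close> and \<open>\<infinity>\<close>. The
  quasi-Bernoulli property is used in two ways. First, the sums of \<open>p w powr q\<close> are
  quasi-multiplicative in \<open>n\<close>, so they agree with \<open>l powr (n * \<tau> q)\<close> up to a factor that is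
  bounded in \<open>n\<close> (\<open>spectrum_error\<close>). Consequently the exponential moment of order \<open>t\<close> of
  \<open>ln (R w)\<close> is \<open>l powr (n * \<psi> t)\<close> up to a bounded factor, where \<open>\<psi> t = \<tau> (1 + t) + d * t\<close> is
  nonnegative and \<open>\<psi> t = o(t)\<close> at \<open>0\<close>. Secondly, inside a given cube the later letters of
  the code have the same law as at the start, up to the factor \<open>C\<close> (\<open>conditional_mass\<close>). Therefore
  an event that recurs in every cube with a fixed proportion of its mass has full measure
  (\<open>full_measure\<close>); this replaces ergodic theory.

  Analyticity yields a dichotomy: either \<open>\<psi>\<close> vanishes identically, or \<open>\<psi> t\<close> is asymptotic to
  \<open>b * t ^ j\<close> at \<open>0\<close> for some \<open>b \<noteq> 0\<close>.

  If \<open>\<psi> = 0\<close>, letting \<open>t\<close> tend to \<open>\<plusminus> \<infinity>\<close> in the moments shows that \<open>R\<close> is bounded above and below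
  (\<open>ratio_bounded\<close>). All cubes of positive measure then have measure comparable with the \<open>d\<close>-th
  power of their side, and the comparison with \<open>\<H>\<^sup>d\<close> follows from the mass distribution
  principle in one direction and from coverings by cubes in the other (\<open>strongly_equivalent\<close>).

  Otherwise the moments of order \<open>t\<close> proportional to \<open>n powr (- 1 / j)\<close> stay bounded, and they
  exceed any given constant if the factor of proportionality is large. The second moment method turns
  this into a positive lower bound, for all large \<open>n\<close>, for the probability that \<open>R\<close> exceeds a given
  constant, and likewise for the probability that \<open>R\<close> is below a given positive constant
  (\<open>fluctuation\<close>). By the zero-one law \<open>R\<close> is unbounded above and comes close to \<open>0\<close> along the code
  of almost every point. Large values of \<open>R\<close> give good coverings of a set of full measure, hence
  singularity. For the packing measure small values of \<open>R\<close> have to be converted into balls of small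
  measure. A ball meets neighbouring cubes too, which may be much heavier; but at each
  generation the cubes with neighbours \<open>\<kappa>\<close> times heavier have total mass \<open>O(1 / \<kappa>)\<close>
  (\<open>crowded_mass\<close>), so that small \<open>R\<close> and comparable neighbours occur together with positive
  probability. The covering lemma of Vitali then produces packings.

  It remains to compare dimensions. That \<open>d\<close> is the dimension of \<open>m\<close> follows from a Chernoff bound
  for the lower estimate (\<open>hausdorff_measure_pos\<close>), and in either case from the sets just described
  for the upper one. The positive words of length \<open>n\<close> are exactly \<open>l powr (n * \<tau> 0)\<close> in
  number and closed under concatenation and taking factors; counting them shows that the support has
  dimension at least \<open>\<tau> 0\<close> (\<open>hausdorff_measure_supp_pos\<close>), which is \<open>d + \<psi> (- 1)\<close>, and
  \<open>\<psi> (- 1) > 0\<close> unless \<open>\<psi> = 0\<close>.\<close>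

section \<open>Hausdorff measures\<close>

lemma diam_pow_empty [simp]: "diam_pow s {} = 0"
  by (simp add: diam_pow_def)

lemma diam_pow_le:
  assumes "0 \<le> s" "diameter U \<le> r" "bounded U" "0 < r"
  shows "diam_pow s U \<le> ennreal (r powr s)"
proof -
  have "diameter U \<ge> 0" using diameter_ge_0[OF assms(3)] .
  then show ?thesis using assms by (auto simp: diam_pow_def intro!: ennreal_leI powr_mono2)
qed

text \<open>The places of a sequence that do not enumerate the index set are filled with the empty set,
  which contributes nothing, even for \<open>s = 0\<close>.\<close>

lemma hausdorff_pre_le:
  fixes U :: "'i \<Rightarrow> 'a::metric_space set"
  assumes "countable W" "E \<subseteq> (\<Union>w\<in>W. U w)" "\<And>w. w \<in> W \<Longrightarrow> bounded (U w)"
    "\<And>w. w \<in> W \<Longrightarrow> diameter (U w) \<le> \<eta>" "0 \<le> \<eta>"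
    and B: "\<And>F. finite F \<Longrightarrow> F \<subseteq> W \<Longrightarrow> (\<Sum>w\<in>F. diam_pow s (U w)) \<le> B"
  shows "hausdorff_pre s \<eta> E \<le> B"
proof -
  define g where "g = to_nat_on W"
  have inj: "inj_on g W" unfolding g_def using assms(1) by (rule inj_on_to_nat_on)
  define V where "V i = (if i \<in> g ` W then U (the_inv_into W g i) else {})" for i
  have Vg: "V (g w) = U w" if "w \<in> W" for w
    using that by (simp add: V_def the_inv_into_f_f[OF inj])
  have V: "V i = {} \<or> (\<exists>w\<in>W. V i = U w)" for i
    using Vg by (force simp: V_def)
  have cov: "E \<subseteq> (\<Union>i. V i)" using assms(2) Vg by blast
  have bd: "bounded (V i) \<and> diameter (V i) \<le> \<eta>" for i
    using V[of i] assms(3-5) by auto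
  have "hausdorff_pre s \<eta> E \<le> (\<Sum>i. diam_pow s (V i))"
    unfolding hausdorff_pre_def by (rule INF_lower) (use cov bd in blast)
  also have "\<dots> \<le> B"
  proof (rule suminf_le_const)
    show "summable (\<lambda>i. diam_pow s (V i))" by simp
    fix n
    let ?F = "{w\<in>W. g w < n}"
    have fin: "finite ?F"
      by (rule finite_imageD[of g]) (auto intro: finite_subset[of _ "{..<n}"] inj_on_subset[OF inj])
    have "(\<Sum>i<n. diam_pow s (V i)) = (\<Sum>i\<in>g ` ?F. diam_pow s (V i))"
      by (rule sum.mono_neutral_right) (auto simp: V_def)
    also have "\<dots> = (\<Sum>w\<in>?F. diam_pow s (V (g w)))"
      using inj_on_subset[OF inj, of ?F] by (simp add: sum.reindex)
    also have "\<dots> = (\<Sum>w\<in>?F. diam_pow s (U w))"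
      by (intro sum.cong) (auto simp: Vg)
    also have "\<dots> \<le> B" by (rule B[OF fin]) auto
    finally show "(\<Sum>i<n. diam_pow s (V i)) \<le> B" .
  qed
  finally show ?thesis .
qed

lemma hausdorff_pre_le_measure:
  "0 < \<eta> \<Longrightarrow> hausdorff_pre s \<eta> E \<le> hausdorff_measure s E"
  unfolding hausdorff_measure_def by (rule SUP_upper) simp

lemma hausdorff_measure_le:
  "(\<And>\<eta>. 0 < \<eta> \<Longrightarrow> hausdorff_pre s \<eta> E \<le> B) \<Longrightarrow> hausdorff_measure s E \<le> B"
  unfolding hausdorff_measure_def by (rule SUP_least) simp

lemma hausdorff_pre_mono: "A \<subseteq> B \<Longrightarrow> hausdorff_pre s \<eta> A \<le> hausdorff_pre s \<eta> B"
  unfolding hausdorff_pre_def by (rule INF_superset_mono) auto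

lemma hausdorff_measure_mono: "A \<subseteq> B \<Longrightarrow> hausdorff_measure s A \<le> hausdorff_measure s B"
  unfolding hausdorff_measure_def by (rule SUP_mono) (blast intro: hausdorff_pre_mono)

lemma hausdorff_covering:
  assumes "0 < \<eta>" "hausdorff_measure s E < B"
  obtains U where "E \<subseteq> (\<Union>i. U i)" "\<And>i. bounded (U i)" "\<And>i. diameter (U i) \<le> \<eta>"
    "(\<Sum>i::nat. diam_pow s (U i)) < B"
proof -
  have "hausdorff_pre s \<eta> E < B"
    using hausdorff_pre_le_measure[OF assms(1)] assms(2) by (rule le_less_trans)
  then show ?thesis
    unfolding hausdorff_pre_def INF_less_iff using that by blast
qed

lemma suminf_geometric_ennreal:
  assumes "0 \<le> e"
  shows "(\<Sum>i. ennreal (e * (1/2) ^ Suc i)) = ennreal e"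
proof (rule suminf_ennreal_eq)
  show "(\<lambda>i. e * (1/2) ^ Suc i) sums e"
    using sums_mult[OF power_half_series, of e] by simp
qed (use assms in simp)

lemma hausdorff_null_UN:
  assumes "\<And>k::nat. hausdorff_measure s (A k) = 0"
  shows "hausdorff_measure s (\<Union>k. A k) = 0"
proof -
  have "hausdorff_pre s \<eta> (\<Union>k. A k) \<le> ennreal e" if "0 < \<eta>" "0 < e" for \<eta> e
  proof -
    have "\<exists>U. A k \<subseteq> (\<Union>i. U i) \<and> (\<forall>i. bounded (U i) \<and> diameter (U i) \<le> \<eta>) \<and>
        (\<Sum>i::nat. diam_pow s (U i)) < ennreal (e * (1/2) ^ Suc k)" for k
    proof -
      have "hausdorff_measure s (A k) < ennreal (e * (1/2) ^ Suc k)" using assms that(2) by simp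
      from hausdorff_covering[OF that(1) this] show ?thesis by metis
    qed
    then obtain U where U: "\<And>k. A k \<subseteq> (\<Union>i. U k i)" "\<And>k i. bounded (U k i)"
      "\<And>k i. diameter (U k i) \<le> \<eta>"
      "\<And>k. (\<Sum>i::nat. diam_pow s (U k i)) < ennreal (e * (1/2) ^ Suc k)" by metis
    show ?thesis
    proof (rule hausdorff_pre_le[of UNIV _ "\<lambda>(k, i). U k i"])
      show "(\<Union>k. A k) \<subseteq> (\<Union>w\<in>UNIV. case w of (k, i) \<Rightarrow> U k i)" using U(1) by fastforce
      fix F :: "(nat \<times> nat) set" assume F: "finite F"
      define N where "N = Suc (Max (insert 0 (fst ` F \<union> snd ` F)))"
      have "F \<subseteq> {..<N} \<times> {..<N}"
      proof
        fix x assume "x \<in> F"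
        then have "fst x \<in> insert 0 (fst ` F \<union> snd ` F)" "snd x \<in> insert 0 (fst ` F \<union> snd ` F)" by auto
        then have "fst x < N" "snd x < N"
          unfolding N_def less_Suc_eq_le using F by (auto intro!: Max_ge)
        then show "x \<in> {..<N} \<times> {..<N}" by (cases x) auto
      qed
      then have "(\<Sum>w\<in>F. diam_pow s (case w of (k, i) \<Rightarrow> U k i))
          \<le> (\<Sum>w\<in>{..<N} \<times> {..<N}. diam_pow s (case w of (k, i) \<Rightarrow> U k i))"
        by (intro sum_mono2) auto
      also have "\<dots> = (\<Sum>k<N. \<Sum>i<N. diam_pow s (U k i))"
        by (simp add: sum.cartesian_product case_prod_unfold)
      also have "\<dots> \<le> (\<Sum>k<N. ennreal (e * (1/2) ^ Suc k))"
        by (intro sum_mono order.trans[OF sum_le_suminf less_imp_le[OF U(4)]]) auto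
      also have "\<dots> \<le> (\<Sum>k. ennreal (e * (1/2) ^ Suc k))"
        by (rule sum_le_suminf) auto
      also have "\<dots> = ennreal e" using that by (intro suminf_geometric_ennreal) simp
      finally show "(\<Sum>w\<in>F. diam_pow s (case w of (k, i) \<Rightarrow> U k i)) \<le> ennreal e" .
    qed (use U that in auto)
  qed
  then have "hausdorff_measure s (\<Union>k. A k) \<le> ennreal e" if "0 < e" for e
    using that by (intro hausdorff_measure_le)
  then show ?thesis
    by (metis ennreal_le_epsilon add_0 zero_le le_zero_eq)
qed

text \<open>A bounded box splits into \<open>O(N ^ D)\<close> cubes of side \<open>1 / N\<close>, whose diameters to the power
  \<open>D + 1\<close> sum to \<open>O(1 / N)\<close>. This makes the infimum in the definition of the dimension range over a
  nonempty set.\<close>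

lemma hausdorff_measure_space:
  "hausdorff_measure (real CARD('n) + 1) (UNIV :: (real^'n) set) = 0"
proof -
  define D where "D = real CARD('n)"
  have D: "D > 0" unfolding D_def by simp
  define A where "A k = {x::real^'n. \<forall>i. \<bar>x $ i\<bar> \<le> real k}" for k :: nat
  define cell where "cell N z = {x::real^'n. \<forall>i. of_int (z i) \<le> real N * x $ i \<and> real N * x $ i < of_int (z i) + 1}"
    for N :: nat and z :: "'n \<Rightarrow> int"
  have cell_dist: "dist x y \<le> D / real N" if "0 < N" "x \<in> cell N z" "y \<in> cell N z" for N z x y
  proof -
    have "\<bar>(x - y) $ i\<bar> \<le> 1 / real N" for i
    proof -
      have "of_int (z i) \<le> real N * x $ i" "real N * x $ i < of_int (z i) + 1"
        "of_int (z i) \<le> real N * y $ i" "real N * y $ i < of_int (z i) + 1"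
        using that(2,3) by (auto simp: cell_def)
      then have "\<bar>real N * x $ i - real N * y $ i\<bar> \<le> 1" by linarith
      then have "real N * \<bar>(x - y) $ i\<bar> \<le> 1"
        by (simp add: abs_mult right_diff_distrib[symmetric])
      then show ?thesis using that(1) by (simp add: le_divide_eq mult.commute)
    qed
    then have "(\<Sum>i\<in>UNIV. \<bar>(x - y) $ i\<bar>) \<le> (\<Sum>i\<in>(UNIV::'n set). 1 / real N)"
      by (intro sum_mono) simp
    then show ?thesis
      using norm_le_l1_cart[of "x - y"] by (simp add: dist_norm D_def)
  qed
  have "hausdorff_measure (D + 1) (A k) = 0" for k
  proof -
    define K where "K = real ((3 * Suc k) ^ CARD('n)) * D powr (D + 1)"
    have pre: "hausdorff_pre (D + 1) \<eta> (A k) \<le> ennreal (K / real N)"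
      if N: "0 < N" "D / real N \<le> \<eta>" for N \<eta>
    proof (rule hausdorff_pre_le[of "PiE UNIV (\<lambda>_. {- int (k * N) .. int (k * N)})" _ "cell N"])
      let ?W = "PiE (UNIV::'n set) (\<lambda>_. {- int (k * N) .. int (k * N)})"
      have finW: "finite ?W" by (simp add: finite_PiE)
      then show "countable ?W" by (rule countable_finite)
      have bd: "bounded (cell N z)" for z
        unfolding bounded_def using cell_dist[OF N(1)] by blast
      then show "bounded (cell N z)" for z .
      have diam: "diameter (cell N z) \<le> D / real N" for z
        using D by (intro diameter_le) (auto simp: dist_norm[symmetric] intro: cell_dist[OF N(1)])
      then show "diameter (cell N z) \<le> \<eta>" for z using N(2) order.trans by blast
      have "0 \<le> D / real N" using D by simp
      then show "0 \<le> \<eta>" using N(2) by linarith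
      show "A k \<subseteq> (\<Union>z\<in>?W. cell N z)"
      proof
        fix x assume x: "x \<in> A k"
        define z where "z i = \<lfloor>real N * x $ i\<rfloor>" for i
        have "x \<in> cell N z" by (simp add: cell_def z_def)
        moreover have "z i \<in> {- int (k * N) .. int (k * N)}" for i
        proof -
          have "\<bar>real N * x $ i\<bar> \<le> real N * real k"
            unfolding abs_mult using x by (auto simp: A_def intro!: mult_left_mono)
          then have "- real_of_int (int (k * N)) \<le> real N * x $ i"
            "real N * x $ i \<le> real_of_int (int (k * N))" by (auto simp: mult.commute)
          then show ?thesis unfolding z_def by (simp add: le_floor_iff floor_le_iff)
        qed
        ultimately show "x \<in> (\<Union>z\<in>?W. cell N z)" by (auto simp: PiE_UNIV_domain)
      qed
      fix F assume F: "finite F" "F \<subseteq> ?W"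
      have "card F \<le> card ?W" using F finW by (intro card_mono)
      also have "\<dots> = (2 * (k * N) + 1) ^ CARD('n)"
      proof -
        have "card {- int a .. int a} = 2 * a + 1" for a :: nat by simp
        then show ?thesis by (simp only: card_PiE[OF finite_class.finite_UNIV] prod_constant)
      qed
      also have "\<dots> \<le> (3 * Suc k * N) ^ CARD('n)"
        using N(1) by (intro power_mono) (auto simp: algebra_simps)
      finally have cF: "real (card F) \<le> real ((3 * Suc k) ^ CARD('n)) * real N powr D"
        using N(1) by (simp add: D_def powr_realpow power_mult_distrib flip: of_nat_power of_nat_mult)
      have "(\<Sum>z\<in>F. diam_pow (D + 1) (cell N z)) \<le> (\<Sum>z\<in>F. ennreal ((D / real N) powr (D + 1)))"
        using D N(1) by (intro sum_mono diam_pow_le diam bd) auto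
      also have "\<dots> = ennreal (real (card F) * (D / real N) powr (D + 1))"
        by (simp add: ennreal_mult ennreal_of_nat_eq_real_of_nat)
      also have "\<dots> \<le> ennreal (real ((3 * Suc k) ^ CARD('n)) * real N powr D * (D / real N) powr (D + 1))"
        by (intro ennreal_leI mult_right_mono cF) simp
      also have "real ((3 * Suc k) ^ CARD('n)) * real N powr D * (D / real N) powr (D + 1) = K / real N"
        using D N(1) by (simp add: K_def powr_divide powr_add)
      finally show "(\<Sum>z\<in>F. diam_pow (D + 1) (cell N z)) \<le> ennreal (K / real N)" .
    qed
    have "hausdorff_pre (D + 1) \<eta> (A k) \<le> ennreal e" if "0 < \<eta>" "0 < e" for \<eta> e
    proof -
      obtain N :: nat where N: "real N > max (D / \<eta>) (K / e)" using reals_Archimedean2 by blast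
      then have 1: "D / \<eta> < real N" "K / e < real N" by auto
      moreover have "0 < D / \<eta>" using D that by simp
      ultimately have N0: "0 < real N" by linarith
      have "D / real N \<le> \<eta>" "K / real N \<le> e"
        using 1 that N0 by (auto simp: field_simps)
      then show ?thesis using pre[of N \<eta>] N0 by (auto intro: order.trans ennreal_leI)
    qed
    then have "hausdorff_measure (D + 1) (A k) \<le> ennreal e" if "0 < e" for e
      using that by (intro hausdorff_measure_le)
    then show ?thesis by (metis ennreal_le_epsilon add_0 zero_le le_zero_eq)
  qed
  then have "hausdorff_measure (D + 1) (\<Union>k. A k) = 0" by (rule hausdorff_null_UN)
  moreover have "(\<Union>k. A k) = UNIV"
  proof (intro equalityI subsetI UNIV_I)
    fix x :: "real^'n"
    obtain k where "norm x \<le> real k" using real_arch_simple by blast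
    then have "x \<in> A k" unfolding A_def using component_le_norm_cart[of x] order.trans by auto
    then show "x \<in> (\<Union>k. A k)" by blast
  qed
  ultimately show ?thesis by (simp add: D_def)
qed

lemma hausdorff_dim_ge:
  fixes E :: "(real^'n) set"
  assumes "\<And>s. 0 \<le> s \<Longrightarrow> s < d \<Longrightarrow> hausdorff_measure s E \<noteq> 0"
  shows "d \<le> hausdorff_dim E"
  unfolding hausdorff_dim_def
proof (rule cInf_greatest)
  have "hausdorff_measure (real CARD('n) + 1) E = 0"
    using hausdorff_measure_mono[of E UNIV "real CARD('n) + 1"] hausdorff_measure_space[where ?'n = 'n] by simp
  then show "{s. 0 \<le> s \<and> hausdorff_measure s E = 0} \<noteq> {}"
    by (intro ex_in_conv[THEN iffD1] exI[of _ "real CARD('n) + 1"]) simp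
qed (use assms not_le in blast)

lemma hausdorff_dim_le:
  assumes "hausdorff_measure s E = 0" "0 \<le> s"
  shows "hausdorff_dim E \<le> s"
  unfolding hausdorff_dim_def
  by (rule cInf_lower) (use assms in \<open>auto intro!: bdd_belowI[of _ 0]\<close>)

section \<open>Real analytic functions\<close>

lemma power_series_leading_term:
  fixes f :: "real \<Rightarrow> real"
  assumes r: "r > 0" and f: "\<And>y. \<bar>y - x\<bar> < r \<Longrightarrow> (\<lambda>n. a n * (y - x) ^ n) sums f y"
  shows "(\<forall>n. a n = 0) \<or>
    (\<exists>j. a j \<noteq> 0 \<and> (\<forall>i<j. a i = 0) \<and> ((\<lambda>t. f (x + t) / t ^ j) \<longlongrightarrow> a j) (at 0))"
proof (cases "\<forall>n. a n = 0")
  case False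
  then obtain n where n: "a n \<noteq> 0" by blast
  define j where "j = (LEAST n. a n \<noteq> 0)"
  have j: "a j \<noteq> 0" unfolding j_def using n by (rule LeastI)
  have z: "a i = 0" if "i < j" for i using not_less_Least[of i "\<lambda>n. a n \<noteq> 0"] that by (auto simp: j_def)
  have "((\<lambda>t. f (x + t) / t ^ j) \<longlongrightarrow> a (0 + j)) (at 0)"
  proof (rule powser_limit_0_strong[OF r])
    fix t :: real assume t: "t \<noteq> 0" "norm t < r"
    have "(\<lambda>n. a n * t ^ n) sums f (x + t)" using f[of "x + t"] t by simp
    then have "(\<lambda>n. a (n + j) * t ^ (n + j)) sums f (x + t)"
      using sums_zero_iff_shift[of j "\<lambda>n. a n * t ^ n"] z by simp
    then have "(\<lambda>n. a (n + j) * t ^ (n + j) / t ^ j) sums (f (x + t) / t ^ j)" by (rule sums_divide)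
    then show "(\<lambda>n. a (n + j) * t ^ n) sums (f (x + t) / t ^ j)" using t by (simp add: power_add)
  qed
  then show ?thesis using j z by auto
qed simp

lemma real_analytic_leading_term:
  assumes "real_analytic f"
  shows "(\<exists>r>0. \<forall>y. \<bar>y - x\<bar> < r \<longrightarrow> f y = 0) \<or>
    (\<exists>j b. b \<noteq> 0 \<and> ((\<lambda>t. f (x + t) / t ^ j) \<longlongrightarrow> b) (at 0))"
proof -
  obtain r a where r: "r > 0" and a: "\<And>y. \<bar>y - x\<bar> < r \<Longrightarrow> (\<lambda>n. a n * (y - x) ^ n) sums f y"
    using assms unfolding real_analytic_def by metis
  have "f y = 0" if "\<forall>n. a n = 0" "\<bar>y - x\<bar> < r" for y
  proof -
    have "(\<lambda>n. 0) sums f y" using a[OF that(2)] that(1) by simp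
    then show ?thesis using sums_unique2[OF sums_zero] by metis
  qed
  then show ?thesis using power_series_leading_term[OF r a] r by blast
qed

text \<open>The points near which the function vanishes form an open set. Its complement is open too: at
  any other point the leading term of the expansion excludes zeros in a punctured neighbourhood.\<close>

lemma real_analytic_identity:
  assumes f: "real_analytic f" and r: "r > 0" "\<And>y. \<bar>y - x\<bar> < r \<Longrightarrow> f y = 0"
  shows "f y = 0"
proof -
  define Z where "Z = {x. \<exists>r>0. \<forall>y. \<bar>y - x\<bar> < r \<longrightarrow> f y = 0}"
  have "open Z"
    unfolding open_dist
  proof safe
    fix u assume "u \<in> Z"
    then obtain r where r: "r > 0" "\<And>y. \<bar>y - u\<bar> < r \<Longrightarrow> f y = 0" unfolding Z_def by blast
    have "v \<in> Z" if "dist v u < r / 2" for v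
    proof -
      have "f y = 0" if "\<bar>y - v\<bar> < r / 2" for y
        using \<open>dist v u < r / 2\<close> that unfolding dist_real_def by (intro r(2)) linarith
      then show ?thesis unfolding Z_def using r(1) half_gt_zero by blast
    qed
    then show "\<exists>e>0. \<forall>v. dist v u < e \<longrightarrow> v \<in> Z" using r(1) by (intro exI[of _ "r / 2"]) simp
  qed
  moreover have "open (- Z)"
    unfolding open_dist
  proof safe
    fix u assume "u \<notin> Z"
    then obtain j b where b: "b \<noteq> 0" "((\<lambda>t. f (u + t) / t ^ j) \<longlongrightarrow> b) (at 0)"
      using real_analytic_leading_term[OF f, of u] unfolding Z_def by blast
    then have "eventually (\<lambda>t. f (u + t) / t ^ j \<noteq> 0) (at 0)"
      by (rule tendsto_imp_eventually_ne[rotated])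
    then obtain e where e: "e > 0" "\<And>t. t \<noteq> 0 \<Longrightarrow> dist t 0 < e \<Longrightarrow> f (u + t) / t ^ j \<noteq> 0"
      unfolding eventually_at by blast
    have "v \<notin> Z" if v: "dist v u < e" for v
    proof (cases "v = u")
      case False
      then have "f v \<noteq> 0" using e(2)[of "v - u"] v by (auto simp: dist_real_def)
      then show ?thesis unfolding Z_def by fastforce
    qed (use \<open>u \<notin> Z\<close> in simp)
    then show "\<exists>e>0. \<forall>v. dist v u < e \<longrightarrow> v \<in> - Z" using e(1) by auto
  qed
  moreover have "x \<in> Z" unfolding Z_def using r by blast
  ultimately have "Z = UNIV"
    using connectedD[OF connected_UNIV, of Z "- Z"] by blast
  then have "y \<in> Z" by simp
  then show ?thesis unfolding Z_def by auto
qed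

lemma real_analytic_add_affine:
  assumes "real_analytic f"
  shows "real_analytic (\<lambda>y. f y + (c + e * y))"
  unfolding real_analytic_def
proof
  fix x
  obtain r a where r: "r > 0" and a: "\<And>y. \<bar>y - x\<bar> < r \<Longrightarrow> (\<lambda>n. a n * (y - x) ^ n) sums f y"
    using assms unfolding real_analytic_def by metis
  define b where "b n = (if n = 0 then c + e * x else if n = 1 then e else 0)" for n :: nat
  have "(\<lambda>n. (a n + b n) * (y - x) ^ n) sums (f y + (c + e * y))" if "\<bar>y - x\<bar> < r" for y
  proof -
    have "(\<lambda>n. b n * (y - x) ^ n) sums (\<Sum>n\<in>{0, 1}. b n * (y - x) ^ n)"
      by (rule sums_finite) (auto simp: b_def)
    also have "(\<Sum>n\<in>{0, 1}. b n * (y - x) ^ n) = c + e * y" by (simp add: b_def algebra_simps)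
    finally show ?thesis using sums_add[OF a[OF that]] by (simp add: distrib_right)
  qed
  then show "\<exists>r>0. \<exists>a. \<forall>y. \<bar>y - x\<bar> < r \<longrightarrow> (\<lambda>n. a n * (y - x) ^ n) sums (f y + (c + e * y))"
    by (intro exI[of _ r] conjI[OF r] exI[of _ "\<lambda>n. a n + b n"] allI impI)
qed

lemma real_analytic_differentiable:
  assumes "real_analytic f"
  obtains f' where "(f has_real_derivative f') (at x)"
proof -
  obtain r a where r: "r > 0" and a: "\<And>y. \<bar>y - x\<bar> < r \<Longrightarrow> (\<lambda>n. a n * (y - x) ^ n) sums f y"
    using assms unfolding real_analytic_def by metis
  have f0: "f x = a 0" using a[of x] r powser_sums_zero sums_unique2 by (metis abs_zero diff_self)
  have "((\<lambda>t. (f (x + t) - f x) / t) \<longlongrightarrow> a (Suc 0)) (at 0)"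
  proof (rule powser_limit_0_strong[OF r, of "\<lambda>n. a (Suc n)"])
    fix t :: real assume t: "t \<noteq> 0" "norm t < r"
    have "(\<lambda>n. a n * t ^ n) sums f (x + t)" using a[of "x + t"] t by simp
    then have "(\<lambda>n. a (Suc n) * t ^ Suc n) sums (f (x + t) - f x)"
      by (subst sums_Suc_iff) (simp add: f0)
    then have "(\<lambda>n. a (Suc n) * t ^ Suc n / t) sums ((f (x + t) - f x) / t)" by (rule sums_divide)
    then show "(\<lambda>n. a (Suc n) * t ^ n) sums ((f (x + t) - f x) / t)" using t by simp
  qed
  then show ?thesis using that by (simp add: DERIV_def)
qed

section \<open>Quasi-additive sequences and second moments\<close>

text \<open>Comparing \<open>b (k * n)\<close> with both \<open>k * b n\<close> and \<open>n * b k\<close> shows that \<open>b n / n\<close> is a Cauchy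
  sequence with the rate \<open>K / n\<close>. This rate is what keeps the error of \<open>b n\<close> itself bounded.\<close>

lemma quasi_additive_limit:
  fixes b :: "nat \<Rightarrow> real"
  assumes b: "\<And>n k. \<bar>b (n + k) - b n - b k\<bar> \<le> K"
  obtains L where "(\<lambda>n. b n / real n) \<longlonglongrightarrow> L" "\<And>n. \<bar>b n - real n * L\<bar> \<le> K"
proof -
  have K: "K \<ge> 0" using b[of 0 0] by linarith
  have mult: "\<bar>b (k * n) - real k * b n\<bar> \<le> real k * K" if "k > 0" for k n
    using that
  proof (induction k)
    case (Suc k)
    show ?case
    proof (cases "k = 0")
      case False
      have "\<bar>b (n + k * n) - b n - b (k * n)\<bar> \<le> K" by (rule b)
      then have "\<bar>b (n + k * n) - (b n + real k * b n)\<bar> \<le> K + real k * K" using Suc False by simp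
      then show ?thesis by (simp add: algebra_simps)
    qed (use K in simp)
  qed simp
  have quot: "\<bar>b (k * n) / (real k * real n) - b n / real n\<bar> \<le> K / real n" if "k > 0" "n > 0" for k n
  proof -
    have eq: "b (k * n) / (real k * real n) - b n / real n = (b (k * n) - real k * b n) / (real k * real n)"
      using that by (simp add: field_simps)
    have "\<bar>b (k * n) - real k * b n\<bar> / (real k * real n) \<le> (real k * K) / (real k * real n)"
      using mult[OF that(1), of n] by (intro divide_right_mono) auto
    then show ?thesis unfolding eq abs_divide using that by simp
  qed
  have cross: "\<bar>b n / real n - b k / real k\<bar> \<le> K / real n + K / real k" if "k > 0" "n > 0" for k n
    using quot[OF that] quot[OF that(2,1)] by (simp add: mult.commute)
  have "Cauchy (\<lambda>n. b n / real n)"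
  proof (rule metric_CauchyI)
    fix e :: real assume e: "0 < e"
    obtain N :: nat where N: "2 * K / e < real N" using reals_Archimedean2 by blast
    have small: "K / real n < e / 2" if "n \<ge> Suc N" for n
    proof -
      have "2 * K / e < real n" using N that by (simp add: less_le_trans)
      then show ?thesis using e that by (simp add: field_simps)
    qed
    have "dist (b i / real i) (b n / real n) < e" if "i \<ge> Suc N" "n \<ge> Suc N" for i n
    proof -
      have "\<bar>b i / real i - b n / real n\<bar> \<le> K / real i + K / real n" using that by (intro cross) auto
      then show ?thesis using small[OF that(1)] small[OF that(2)] unfolding dist_real_def by linarith
    qed
    then show "\<exists>M. \<forall>i\<ge>M. \<forall>n\<ge>M. dist (b i / real i) (b n / real n) < e" by blast
  qed
  then obtain L where L: "(\<lambda>n. b n / real n) \<longlonglongrightarrow> L"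
    using convergent_eq_Cauchy[of "\<lambda>n. b n / real n"] by blast
  have "\<bar>b n - real n * L\<bar> \<le> K" for n
  proof (cases "n = 0")
    case False
    have "\<bar>b n / real n - L\<bar> \<le> K / real n + 0"
    proof (rule tendsto_le[OF sequentially_bot])
      show "(\<lambda>k. K / real n + K / real k) \<longlonglongrightarrow> K / real n + 0"
        by (intro tendsto_intros lim_const_over_n)
      show "(\<lambda>k. \<bar>b n / real n - b k / real k\<bar>) \<longlonglongrightarrow> \<bar>b n / real n - L\<bar>"
        by (intro tendsto_intros L)
      show "\<forall>\<^sub>F k in sequentially. \<bar>b n / real n - b k / real k\<bar> \<le> K / real n + K / real k"
        using eventually_gt_at_top[of 0] by eventually_elim (use False in \<open>simp add: cross\<close>)
    qed
    then have "real n * \<bar>b n / real n - L\<bar> \<le> K" using False by (simp add: field_simps)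
    then have "\<bar>real n * (b n / real n - L)\<bar> \<le> K" by (simp only: abs_mult abs_of_nat)
    then show ?thesis using False by (simp add: right_diff_distrib)
  qed (use b[of 0 0] in simp)
  with L show ?thesis using that by blast
qed

lemma le_0_if_multiples_bounded:
  fixes a :: real
  assumes "\<And>n::nat. real n * a \<le> K"
  shows "a \<le> 0"
proof (rule ccontr)
  assume a: "\<not> a \<le> 0"
  obtain n :: nat where "K / a < real n" using reals_Archimedean2 by blast
  then show False using a assms[of n] by (simp add: field_simps)
qed

text \<open>The inequality of Paley and Zygmund: at least half of the first moment is carried by the points
  where \<open>Y \<ge> \<theta>\<close>, and by the Cauchy-Schwarz inequality it cannot be concentrated on few of them
  without making the second moment large.\<close>

lemma second_moment_lower_bound:
  fixes p Y :: "'a \<Rightarrow> real"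
  assumes "finite A" and p: "\<And>a. a \<in> A \<Longrightarrow> 0 \<le> p a" and Y: "\<And>a. a \<in> A \<Longrightarrow> 0 \<le> Y a"
    and "(\<Sum>a\<in>A. p a) \<le> 1" and "0 \<le> \<theta>"
    and first: "2 * \<theta> \<le> (\<Sum>a\<in>A. p a * Y a)"
    and second: "(\<Sum>a\<in>A. p a * (Y a)\<^sup>2) \<le> B" and "0 < B"
  shows "\<theta>\<^sup>2 / B \<le> (\<Sum>a\<in>{a\<in>A. \<theta> \<le> Y a}. p a)"
proof -
  define T where "T = {a\<in>A. \<theta> \<le> Y a}"
  have T: "T \<subseteq> A" "finite T" using assms(1) by (auto simp: T_def)
  have "(\<Sum>a\<in>A - T. p a * Y a) \<le> (\<Sum>a\<in>A - T. p a * \<theta>)"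
    using p by (intro sum_mono mult_left_mono) (auto simp: T_def)
  also have "\<dots> = \<theta> * (\<Sum>a\<in>A - T. p a)" by (simp add: sum_distrib_left mult.commute)
  also have "\<dots> \<le> \<theta> * 1"
    using p assms(1,4,5) by (intro mult_left_mono order.trans[OF sum_mono2 assms(4)]) auto
  finally have "\<theta> \<le> (\<Sum>a\<in>T. p a * Y a)"
    using first sum.subset_diff[OF T(1) assms(1), of "\<lambda>a. p a * Y a"] by linarith
  then have "\<theta>\<^sup>2 \<le> (\<Sum>a\<in>T. p a * Y a)\<^sup>2" using assms(5) by (intro power_mono)
  also have "\<dots> = (\<Sum>a\<in>T. sqrt (p a) * (sqrt (p a) * Y a))\<^sup>2"
    using p T(1) by (intro arg_cong[of _ _ "\<lambda>x. x\<^sup>2"] sum.cong)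
      (auto simp: mult.assoc[symmetric] subset_iff)
  also have "\<dots> \<le> (\<Sum>a\<in>T. (sqrt (p a))\<^sup>2) * (\<Sum>a\<in>T. (sqrt (p a) * Y a)\<^sup>2)"
    by (rule Cauchy_Schwarz_ineq_sum)
  also have "\<dots> = (\<Sum>a\<in>T. p a) * (\<Sum>a\<in>T. p a * (Y a)\<^sup>2)"
    using p T(1) by (intro arg_cong2[of _ _ _ _ "(*)"] sum.cong) (auto simp: power_mult_distrib subset_iff)
  also have "\<dots> \<le> (\<Sum>a\<in>T. p a) * B"
  proof (rule mult_left_mono)
    show "(\<Sum>a\<in>T. p a * (Y a)\<^sup>2) \<le> B"
      using p T assms(1) by (intro order.trans[OF sum_mono2 second]) auto
    show "0 \<le> (\<Sum>a\<in>T. p a)" using p T(1) by (intro sum_nonneg) auto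
  qed
  finally show ?thesis using assms(8) by (simp add: T_def field_simps)
qed

section \<open>Cubes and words\<close>

lemma adic_cube_index_unique:
  assumes "l \<ge> 2" "x \<in> adic_cube l n k" "x \<in> adic_cube l n k'"
  shows "k = k'"
proof
  fix i
  have *: "k1 i \<le> k2 i" if "x \<in> adic_cube l n k1" "x \<in> adic_cube l n k2" for k1 k2
  proof -
    have "real (k1 i) / real l ^ n < (real (k2 i) + 1) / real l ^ n"
      using that unfolding adic_cube_def by (auto intro: le_less_trans)
    then have "real (k1 i) < real (k2 i) + 1"
      using assms(1) by (simp add: divide_less_cancel)
    then show ?thesis by linarith
  qed
  show "k i = k' i" using *[OF assms(2,3)] *[OF assms(3,2)] by simp
qed

lemma adic_cube_close_index:
  assumes "l \<ge> 2" "x \<in> adic_cube l n k" "y \<in> adic_cube l n k'" "dist x y \<le> 1 / real l ^ n"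
  shows "k' i \<in> {k i - 1, k i, k i + 1}"
proof -
  have L: "real l ^ n > 0" using assms(1) by simp
  have "\<bar>x $ i - y $ i\<bar> \<le> 1 / real l ^ n"
    using component_le_norm_cart[of "x - y" i] assms(4) by (simp add: dist_norm)
  moreover have "real (k i) / real l ^ n \<le> x $ i" "x $ i < (real (k i) + 1) / real l ^ n"
    "real (k' i) / real l ^ n \<le> y $ i" "y $ i < (real (k' i) + 1) / real l ^ n"
    using assms(2,3) by (auto simp: adic_cube_def)
  ultimately have "real (k' i) / real l ^ n < (real (k i) + 2) / real l ^ n"
    "real (k i) / real l ^ n < (real (k' i) + 2) / real l ^ n"
    by (auto simp: add_divide_distrib)
  then have "real (k' i) < real (k i) + 2" "real (k i) < real (k' i) + 2"
    using L by (auto simp: divide_less_cancel)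
  then have "k' i < k i + 2" "k i < k' i + 2" by linarith+
  then show ?thesis by auto
qed

lemma adic_cube_dist_le:
  fixes x y :: "real^'n"
  assumes "l \<ge> 2" "x \<in> adic_cube l n k" "y \<in> adic_cube l n k"
  shows "dist x y \<le> real CARD('n) / real l ^ n"
proof -
  have "\<bar>x $ i - y $ i\<bar> \<le> 1 / real l ^ n" for i
    using assms(2,3) unfolding adic_cube_def
    by (smt (verit) add_divide_distrib mem_Collect_eq)
  then have "(\<Sum>i\<in>UNIV. \<bar>(x - y) $ i\<bar>) \<le> (\<Sum>i\<in>(UNIV::'n set). 1 / real l ^ n)"
    by (intro sum_mono) simp
  then show ?thesis
    using norm_le_l1_cart[of "x - y"] by (simp add: dist_norm)
qed

lemma adic_cube_borel [measurable]: "adic_cube l n k \<in> sets borel"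
proof -
  have "adic_cube l n k = (\<Inter>i\<in>UNIV. {x. real (k i) / real l ^ n \<le> x $ i} \<inter>
      {x. x $ i < (real (k i) + 1) / real l ^ n})"
    by (auto simp: adic_cube_def)
  moreover have "closed {x::real^'a. real (k i) / real l ^ n \<le> x $ i}"
    "open {x::real^'a. x $ i < (real (k i) + 1) / real l ^ n}" for i
    by (auto intro!: closed_Collect_le open_Collect_less continuous_intros)
  ultimately show ?thesis by auto
qed

text \<open>The constant \<open>C\<close> is a parameter because it enters all later estimates.\<close>

locale quasi_bernoulli_cubes = prob_space m
  for m :: "(real^'n) measure" +
  fixes l :: nat and I :: "nat list \<Rightarrow> (real^'n) set" and C :: real
  assumes l2: "l \<ge> 2"
    and coding: "cube_coding l I"
    and sets_m: "sets m = sets borel"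
    and unit_cube_1: "emeasure m unit_cube = 1"
    and C1: "C \<ge> 1"
    and lower: "\<And>u v. u \<in> lists {..<l ^ CARD('n)} \<Longrightarrow> v \<in> lists {..<l ^ CARD('n)} \<Longrightarrow>
      measure m (I u) * measure m (I v) \<le> C * measure m (I (u @ v))"
    and upper: "\<And>u v. u \<in> lists {..<l ^ CARD('n)} \<Longrightarrow> v \<in> lists {..<l ^ CARD('n)} \<Longrightarrow>
      measure m (I (u @ v)) \<le> C * (measure m (I u) * measure m (I v))"
begin

definition words :: "nat \<Rightarrow> nat list set" where
  "words n = {w \<in> lists {..<l ^ CARD('n)}. length w = n}"

abbreviation p :: "nat list \<Rightarrow> real" where "p w \<equiv> measure m (I w)"

definition pos :: "nat \<Rightarrow> nat list set" where
  "pos n = {w \<in> words n. p w > 0}"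

lemma space_m: "space m = UNIV"
  using sets_eq_imp_space_eq[OF sets_m] by simp

lemma lpow_pos [simp]: "real l ^ n > 0" using l2 by simp

lemma l_pos [simp]: "real l > 0" "0 < l" "1 < real l" "l \<noteq> 0" using l2 by auto

lemma finite_words [simp]: "finite (words n)"
proof -
  have "words n = {w. set w \<subseteq> {..<l ^ CARD('n)} \<and> length w = n}" by (auto simp: words_def)
  then show ?thesis by (simp add: finite_lists_length_eq)
qed

lemma finite_pos [simp]: "finite (pos n)" by (simp add: pos_def)

lemma pos_words: "w \<in> pos n \<Longrightarrow> w \<in> words n" by (simp add: pos_def)

lemma words_lists: "w \<in> words n \<Longrightarrow> w \<in> lists {..<l ^ CARD('n)}" by (simp add: words_def)

lemma words_length: "w \<in> words n \<Longrightarrow> length w = n" by (simp add: words_def)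

lemma words_append: "u \<in> words n \<Longrightarrow> v \<in> words k \<Longrightarrow> u @ v \<in> words (n + k)"
  by (auto simp: words_def)

lemma words_take: "w \<in> words n \<Longrightarrow> k \<le> n \<Longrightarrow> take k w \<in> words k"
  by (auto simp: words_def dest: in_set_takeD)

lemma words_drop: "w \<in> words n \<Longrightarrow> drop k w \<in> words (n - k)"
  by (auto simp: words_def dest: in_set_dropD)

lemma coding_bij: "bij_betw I (words n) (adic_cubes l n)"
  using coding unfolding cube_coding_def words_def by blast

lemma cube_obtain:
  assumes "w \<in> words n"
  obtains k where "I w = adic_cube l n k" "\<And>i. k i < l ^ n"
  using bij_betw_apply[OF coding_bij assms] unfolding adic_cubes_def by blast

lemma cube_adic: "w \<in> words n \<Longrightarrow> \<exists>k. I w = adic_cube l n k"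
  using bij_betw_apply[OF coding_bij] unfolding adic_cubes_def by blast

lemma cube_borel: "w \<in> words n \<Longrightarrow> I w \<in> sets borel"
  by (metis cube_adic adic_cube_borel)

lemma cube_events: "w \<in> words n \<Longrightarrow> I w \<in> events"
  by (simp add: sets_m cube_borel)

lemma cube_subset_unit: "w \<in> words n \<Longrightarrow> I w \<subseteq> unit_cube"
proof
  fix x assume w: "w \<in> words n" and x: "x \<in> I w"
  from cube_obtain[OF w] obtain k where k: "I w = adic_cube l n k" "\<And>i. k i < l ^ n" by blast
  have "0 \<le> x $ i \<and> x $ i < 1" for i
  proof -
    have 1: "real (k i) / real l ^ n \<le> x $ i" "x $ i < (real (k i) + 1) / real l ^ n"
      using x k(1) by (auto simp: adic_cube_def)
    have "real (k i) + 1 \<le> real l ^ n" using k(2)[of i]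
      by (metis Suc_leI of_nat_Suc of_nat_le_iff of_nat_power add.commute)
    then have "(real (k i) + 1) / real l ^ n \<le> 1" by (simp add: divide_le_eq_1)
    moreover have "0 \<le> real (k i) / real l ^ n" by simp
    ultimately show ?thesis using 1 by linarith
  qed
  then show "x \<in> unit_cube" by (simp add: unit_cube_def)
qed

lemma cube_ex:
  assumes "x \<in> unit_cube"
  shows "\<exists>w\<in>words n. x \<in> I w"
proof -
  define k where "k i = nat \<lfloor>x $ i * real l ^ n\<rfloor>" for i
  have x: "0 \<le> x $ i" "x $ i < 1" for i using assms by (auto simp: unit_cube_def)
  have kr: "real (k i) = of_int \<lfloor>x $ i * real l ^ n\<rfloor>" for i
    using x(1)[of i] by (simp add: k_def)
  have "x \<in> adic_cube l n k"
    unfolding adic_cube_def kr by (auto simp: divide_le_eq less_divide_eq)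
  moreover have "k i < l ^ n" for i
  proof -
    have "real (k i) \<le> x $ i * real l ^ n" unfolding kr by linarith
    also have "\<dots> < 1 * real l ^ n" using x(2)[of i] lpow_pos[of n] by (intro mult_strict_right_mono)
    finally show ?thesis by (metis mult_1 of_nat_less_iff of_nat_power)
  qed
  ultimately have "adic_cube l n k \<in> adic_cubes l n" unfolding adic_cubes_def by blast
  then obtain w where "w \<in> words n" "I w = adic_cube l n k"
    using coding_bij[of n] by (metis (no_types, lifting) bij_betw_def imageE)
  then show ?thesis using \<open>x \<in> adic_cube l n k\<close> by blast
qed

lemma cube_unique:
  assumes "v \<in> words n" "w \<in> words n" "x \<in> I v" "x \<in> I w"
  shows "v = w"
proof -
  obtain k k' where "I v = adic_cube l n k" "I w = adic_cube l n k'"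
    using cube_adic assms(1,2) by metis
  then have "I v = I w" using adic_cube_index_unique[OF l2] assms(3,4) by metis
  then show ?thesis using coding_bij[of n] assms(1,2) by (auto simp: bij_betw_def inj_on_def)
qed

lemma cube_append_subset:
  assumes "u \<in> words n" "v \<in> words k"
  shows "I (u @ v) \<subseteq> I u"
  using assms(2)
proof (induction v arbitrary: k rule: rev_induct)
  case (snoc e v)
  have v: "v \<in> words (length v)" "e < l ^ CARD('n)" using snoc.prems by (auto simp: words_def)
  have "u @ v \<in> lists {..<l ^ CARD('n)}"
    using words_append[OF assms(1) v(1)] by (simp add: words_def)
  then have "I ((u @ v) @ [e]) \<subseteq> I (u @ v)"
    using coding v(2) unfolding cube_coding_def by blast
  then show ?case using snoc.IH[OF v(1)] by simp
qed simp

lemma cube_take_subset: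
  assumes "w \<in> words n" "k \<le> n"
  shows "I w \<subseteq> I (take k w)"
  using cube_append_subset[OF words_take[OF assms] words_drop[OF assms(1), of k]] by simp

lemma cube_comparable:
  assumes "u \<in> words n" "v \<in> words k" "n \<le> k" "x \<in> I u" "x \<in> I v"
  shows "u = take n v"
  by (rule cube_unique[OF assms(1) words_take[OF assms(2,3)] assms(4)])
    (rule subsetD[OF cube_take_subset[OF assms(2,3)] assms(5)])

lemma cube_dist:
  assumes "w \<in> words n" "x \<in> closure (I w)" "y \<in> closure (I w)"
  shows "dist x y \<le> real CARD('n) / real l ^ n"
proof -
  obtain k where k: "I w = adic_cube l n k" using cube_adic[OF assms(1)] ..
  have 1: "I w \<subseteq> cball y (real CARD('n) / real l ^ n)" if "y \<in> I w" for y
    using adic_cube_dist_le[OF l2, of y n k] that unfolding k by (simp add: subset_iff)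
  have 2: "dist z y \<le> real CARD('n) / real l ^ n" if "z \<in> I w" "y \<in> closure (I w)" for y z
    using subsetD[OF closure_minimal[OF 1[OF that(1)] closed_cball] that(2)] by simp
  have "I w \<subseteq> cball x (real CARD('n) / real l ^ n)"
    using 2[OF _ assms(2)] by (auto simp: dist_commute)
  then show ?thesis
    using subsetD[OF closure_minimal[OF _ closed_cball] assms(3)] by simp
qed

lemma cube_bounded: "w \<in> words n \<Longrightarrow> bounded (closure (I w))"
  unfolding bounded_def by (metis cube_dist)

lemma cube_diameter: "w \<in> words n \<Longrightarrow> diameter (closure (I w)) \<le> real CARD('n) / real l ^ n"
  by (intro diameter_le) (auto simp: dist_norm[symmetric] intro: cube_dist)

definition neighbours :: "nat list \<Rightarrow> nat list set" where
  "neighbours w = {v \<in> words (length w). \<exists>x\<in>I w. \<exists>y\<in>I v. dist x y \<le> 1 / real l ^ length w}"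

lemma neighbours_sym:
  "v \<in> words n \<Longrightarrow> w \<in> words n \<Longrightarrow> v \<in> neighbours w \<longleftrightarrow> w \<in> neighbours v"
proof -
  have "(\<exists>x\<in>A. \<exists>y\<in>B. dist x y \<le> e) \<longleftrightarrow> (\<exists>x\<in>B. \<exists>y\<in>A. dist x y \<le> e)" for A B :: "(real^'n) set" and e
    by (subst dist_commute) blast
  moreover assume "v \<in> words n" "w \<in> words n"
  ultimately show "v \<in> neighbours w \<longleftrightarrow> w \<in> neighbours v"
    unfolding neighbours_def by (simp add: words_length)
qed

lemma finite_neighbours [simp]: "finite (neighbours w)"
  by (rule finite_subset[OF _ finite_words[of "length w"]]) (auto simp: neighbours_def)

lemma neighbours_words: "w \<in> words n \<Longrightarrow> v \<in> neighbours w \<Longrightarrow> v \<in> words n"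
  by (auto simp: neighbours_def words_length)

text \<open>The position of a cube on the grid changes by at most one in each coordinate.\<close>

lemma card_neighbours:
  assumes w: "w \<in> words n"
  shows "card (neighbours w) \<le> 3 ^ CARD('n)"
proof -
  obtain k where k: "I w = adic_cube l n k" using cube_adic[OF w] ..
  define idx where "idx v = (SOME k. I v = adic_cube l n k)" for v
  have idx: "I v = adic_cube l n (idx v)" if "v \<in> words n" for v
    unfolding idx_def using someI_ex[OF cube_adic[OF that]] .
  have inj: "inj_on idx (neighbours w)"
  proof (rule inj_onI)
    fix u v assume "u \<in> neighbours w" "v \<in> neighbours w" "idx u = idx v"
    then have "u \<in> words n" "v \<in> words n" "I u = I v"
      using neighbours_words[OF w] idx by metis+
    then show "u = v" using coding_bij[of n] by (auto simp: bij_betw_def inj_on_def)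
  qed
  have sub: "idx ` neighbours w \<subseteq> (\<Pi>\<^sub>E i\<in>UNIV. {k i - 1, k i, k i + 1})"
  proof
    fix f assume "f \<in> idx ` neighbours w"
    then obtain v where v: "v \<in> neighbours w" "f = idx v" by blast
    obtain x y where xy: "x \<in> I w" "y \<in> I v" "dist x y \<le> 1 / real l ^ n"
      using v(1) words_length[OF w] by (auto simp: neighbours_def)
    have "f i \<in> {k i - 1, k i, k i + 1}" for i
      unfolding v(2)
      by (rule adic_cube_close_index[OF l2 xy(1)[unfolded k]
            xy(2)[unfolded idx[OF neighbours_words[OF w v(1)]]] xy(3)])
    then show "f \<in> (\<Pi>\<^sub>E i\<in>UNIV. {k i - 1, k i, k i + 1})" by (simp add: PiE_UNIV_domain)
  qed
  have "card (neighbours w) = card (idx ` neighbours w)" using card_image[OF inj] by simp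
  also have "\<dots> \<le> card (\<Pi>\<^sub>E i\<in>(UNIV::'n set). {k i - 1, k i, k i + 1})"
    by (intro card_mono sub finite_PiE) auto
  also have "\<dots> = (\<Prod>i\<in>(UNIV::'n set). card {k i - 1, k i, k i + 1})" by (simp add: card_PiE)
  also have "\<dots> \<le> (\<Prod>i\<in>(UNIV::'n set). 3)"
  proof (rule prod_mono)
    fix i :: 'n
    have "card {k i - 1, k i, k i + 1} \<le> 3"
      by (rule order.trans[OF card_insert_le_m1]) (auto simp: card_insert_if)
    then show "0 \<le> card {k i - 1, k i, k i + 1} \<and> card {k i - 1, k i, k i + 1} \<le> 3" by simp
  qed
  finally show ?thesis by simp
qed

text \<open>All cubes that meet the set are neighbours of any one of them.\<close>

lemma card_cubes_meeting:
  assumes "\<And>x y. x \<in> U \<Longrightarrow> y \<in> U \<Longrightarrow> dist x y \<le> 1 / real l ^ n"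
  shows "card {w \<in> words n. I w \<inter> U \<noteq> {}} \<le> 3 ^ CARD('n)"
proof (cases "\<exists>w\<in>words n. I w \<inter> U \<noteq> {}")
  case True
  then obtain w x where w: "w \<in> words n" "x \<in> I w" "x \<in> U" by blast
  have "{w \<in> words n. I w \<inter> U \<noteq> {}} \<subseteq> neighbours w"
    using w assms by (auto simp: neighbours_def words_length)
  then show ?thesis using card_mono[OF finite_neighbours] card_neighbours[OF w(1)] order.trans by blast
next
  case False
  then have "{w \<in> words n. I w \<inter> U \<noteq> {}} = {}" by blast
  then show ?thesis by (metis card.empty zero_le)
qed

lemma cubes_disjoint: "Q \<subseteq> words n \<Longrightarrow> disjoint_family_on I Q"
  unfolding disjoint_family_on_def using cube_unique by blast

lemma prob_cubes: "Q \<subseteq> words n \<Longrightarrow> prob (\<Union>w\<in>Q. I w) = (\<Sum>w\<in>Q. p w)"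
  by (rule finite_measure_finite_Union)
    (auto intro: finite_subset[OF _ finite_words] cubes_disjoint cube_events)

lemma prob_unit_cube: "prob unit_cube = 1"
  using unit_cube_1 by (simp add: measure_def)

lemma unit_cube_eq: "unit_cube = (\<Union>w\<in>words n. I w)"
  using cube_ex cube_subset_unit by blast

lemma sum_words: "(\<Sum>w\<in>words n. p w) = 1"
  using prob_cubes[of "words n" n] prob_unit_cube unit_cube_eq by simp

lemma sum_p_pos: "(\<Sum>w\<in>pos n. p w) = 1"
proof -
  have "(\<Sum>w\<in>words n. p w) = (\<Sum>w\<in>pos n. p w)"
    by (rule sum.mono_neutral_right) (auto simp: pos_def less_le)
  then show ?thesis using sum_words by simp
qed

lemma prob_pos_cubes: "prob (\<Union>w\<in>pos n. I w) = 1"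
  by (subst prob_cubes[of "pos n" n]) (auto simp: pos_words sum_p_pos)

lemma pos_append_iff:
  assumes "u \<in> words n" "v \<in> words k"
  shows "u @ v \<in> pos (n + k) \<longleftrightarrow> u \<in> pos n \<and> v \<in> pos k"
proof -
  have l: "p u * p v \<le> C * p (u @ v)" and u: "p (u @ v) \<le> C * (p u * p v)"
    using lower upper assms words_lists by blast+
  have "p (u @ v) > 0 \<longleftrightarrow> p u > 0 \<and> p v > 0"
  proof
    assume "p (u @ v) > 0"
    then have "0 < C * (p u * p v)" using u by linarith
    then have "p u \<noteq> 0" "p v \<noteq> 0" by auto
    then show "p u > 0 \<and> p v > 0" by (simp add: less_le)
  next
    assume "p u > 0 \<and> p v > 0"
    then have "0 < C * p (u @ v)" using l by (meson less_le_trans mult_pos_pos)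
    then show "p (u @ v) > 0" using C1 by (simp add: zero_less_mult_iff)
  qed
  then show ?thesis using assms words_append by (auto simp: pos_def)
qed

lemma pos_append_image: "pos (n + k) = (\<lambda>(u, v). u @ v) ` (pos n \<times> pos k)"
proof (intro equalityI subsetI)
  fix w assume w: "w \<in> pos (n + k)"
  then have "take n w \<in> words n" "drop n w \<in> words k"
    using words_take[of w "n+k" n] words_drop[of w "n+k" n] by (auto simp: pos_words)
  then have "(take n w, drop n w) \<in> pos n \<times> pos k" using w pos_append_iff by force
  then show "w \<in> (\<lambda>(u, v). u @ v) ` (pos n \<times> pos k)"
    by (intro image_eqI[of _ _ "(take n w, drop n w)"]) auto
qed (auto simp: pos_append_iff pos_words)

lemma pos_append_inj: "inj_on (\<lambda>(u, v). u @ v) (pos n \<times> pos k)"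
  by (auto simp: inj_on_def pos_def words_def)

lemma sum_pos_append: "(\<Sum>w\<in>pos (n + k). f w) = (\<Sum>u\<in>pos n. \<Sum>v\<in>pos k. f (u @ v))"
  unfolding pos_append_image sum.reindex[OF pos_append_inj]
  by (simp add: sum.cartesian_product case_prod_unfold)

lemma pos_nonempty: "pos n \<noteq> {}"
  using sum_p_pos[of n] by force

end

section \<open>The spectrum\<close>

lemma powr_quasi:
  fixes a b C q :: real
  assumes "0 < a" "0 < b" "1 \<le> C" "a \<le> C * b" "b \<le> C * a"
  shows "a powr q \<le> C powr \<bar>q\<bar> * b powr q"
proof (cases "q \<ge> 0")
  case True
  then have "a powr q \<le> (C * b) powr q" using assms by (intro powr_mono2) auto
  then show ?thesis using True assms by (simp add: powr_mult)
next
  case False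
  have "a powr q \<le> (b / C) powr q" using assms False by (intro powr_mono2') (auto simp: divide_le_eq mult.commute)
  also have "(b / C) powr q = b powr q * inverse (C powr q)"
    using powr_divide[of b C q] assms by (simp only: divide_inverse)
  also have "inverse (C powr q) = C powr \<bar>q\<bar>" using False by (simp add: powr_minus)
  finally show ?thesis by (simp only: mult.commute)
qed

context quasi_bernoulli_cubes
begin

abbreviation \<tau> :: "real \<Rightarrow> real" where "\<tau> \<equiv> Lq_spectrum l m"

definition S :: "nat \<Rightarrow> real \<Rightarrow> real" where
  "S n q = (\<Sum>w\<in>pos n. p w powr q)"

lemma S_cubes: "(\<Sum>J\<in>{J \<in> adic_cubes l n. measure m J > 0}. measure m J powr q) = S n q"
proof -
  have "{J \<in> adic_cubes l n. measure m J > 0} = I ` pos n"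
    unfolding bij_betw_imp_surj_on[OF coding_bij, symmetric] pos_def by blast
  moreover have "inj_on I (pos n)"
    by (rule inj_on_subset[OF bij_betw_imp_inj_on[OF coding_bij]]) (auto simp: pos_def)
  ultimately show ?thesis unfolding S_def by (simp only: sum.reindex comp_def)
qed

lemma pos_p: "w \<in> pos n \<Longrightarrow> p w > 0" by (simp add: pos_def)

lemma S_pos: "S n q > 0"
  unfolding S_def using pos_nonempty by (intro sum_pos) (auto dest: pos_p)

lemma S_nonzero [simp]: "S n q \<noteq> 0" "0 < S n q"
  using S_pos[of n q] by auto

lemma C_pos [simp]: "0 < C" "C \<noteq> 0" using C1 by auto

lemma quasi:
  assumes "u \<in> words n" "v \<in> words k"
  shows "p u * p v \<le> C * p (u @ v)" "p (u @ v) \<le> C * (p u * p v)"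
  using lower upper assms words_lists by blast+

lemma S_quasi: "\<bar>ln (S (n + k) q) - ln (S n q) - ln (S k q)\<bar> \<le> \<bar>q\<bar> * ln C"
proof -
  have *: "S n q * S k q = (\<Sum>u\<in>pos n. \<Sum>v\<in>pos k. (p u * p v) powr q)"
    unfolding S_def sum_product by (intro sum.cong) (simp_all add: powr_mult)
  have **: "S (n + k) q = (\<Sum>u\<in>pos n. \<Sum>v\<in>pos k. p (u @ v) powr q)"
    unfolding S_def by (rule sum_pos_append)
  have pp: "0 < p u * p v" "0 < p (u @ v)" if "u \<in> pos n" "v \<in> pos k" for u v
    using that pos_append_iff[of u n v k] by (auto intro!: mult_pos_pos pos_p pos_words)
  have "S (n + k) q \<le> C powr \<bar>q\<bar> * (S n q * S k q)"
    unfolding * ** sum_distrib_left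
    by (intro sum_mono powr_quasi[OF pp(2,1) C1 quasi(2,1)] pos_words)
  then have 1: "ln (S (n + k) q) \<le> \<bar>q\<bar> * ln C + (ln (S n q) + ln (S k q))"
    by (subst (asm) ln_le_cancel_iff[symmetric]) (simp_all add: ln_mult ln_powr)
  have "S n q * S k q \<le> C powr \<bar>q\<bar> * S (n + k) q"
    unfolding * ** sum_distrib_left
    by (intro sum_mono powr_quasi[OF pp(1,2) C1 quasi(1,2)] pos_words)
  then have 2: "ln (S n q) + ln (S k q) \<le> \<bar>q\<bar> * ln C + ln (S (n + k) q)"
    by (subst (asm) ln_le_cancel_iff[symmetric]) (simp_all add: ln_mult ln_powr)
  show ?thesis using 1 2 by linarith
qed

text \<open>By quasi-multiplicativity the logarithms of the sums form a quasi-additive sequence, so the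
  upper limit in the definition of the spectrum is a limit, with a bounded error before division by
  \<open>n\<close>.\<close>

lemma spectrum_error: "\<bar>ln (S n q) - real n * (\<tau> q * ln (real l))\<bar> \<le> \<bar>q\<bar> * ln C"
proof -
  obtain L where L: "(\<lambda>n. ln (S n q) / real n) \<longlonglongrightarrow> L" "\<And>n. \<bar>ln (S n q) - real n * L\<bar> \<le> \<bar>q\<bar> * ln C"
    using quasi_additive_limit[of "\<lambda>n. ln (S n q)", OF S_quasi] by blast
  have lnl: "ln (real l) > 0" using l_pos(3) by simp
  have "(\<lambda>n. ln (S n q) / real n / ln (real l)) \<longlonglongrightarrow> L / ln (real l)"
    using lnl by (intro tendsto_intros L) simp
  moreover have "(\<lambda>n. ln (S n q) / real n / ln (real l)) =
      (\<lambda>n. 1 / (real n * ln (real l)) * ln (S n q))" by (simp add: field_simps)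
  ultimately have "(\<lambda>n. ereal (1 / (real n * ln (real l)) * ln (S n q))) \<longlonglongrightarrow> ereal (L / ln (real l))"
    by simp
  from lim_imp_Limsup[OF sequentially_bot this] have "\<tau> q = L / ln (real l)"
    unfolding Lq_spectrum_def S_cubes by (simp only: real_of_ereal.simps)
  then show ?thesis using L(2)[of n] lnl by simp
qed

lemma S_upper: "S n q \<le> C powr \<bar>q\<bar> * l powr (real n * \<tau> q)"
  and S_lower: "l powr (real n * \<tau> q) \<le> C powr \<bar>q\<bar> * S n q"
proof -
  have l: "ln (l powr (real n * \<tau> q)) = real n * (\<tau> q * ln (real l))"
    unfolding ln_powr by (rule mult.assoc)
  have pos: "0 < l powr (real n * \<tau> q)" "0 < C powr \<bar>q\<bar>" by simp_all
  have "ln (S n q) \<le> ln (C powr \<bar>q\<bar>) + ln (l powr (real n * \<tau> q))"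
    using spectrum_error[of n q] unfolding l ln_powr[of C] by linarith
  also have "\<dots> = ln (C powr \<bar>q\<bar> * l powr (real n * \<tau> q))"
    using pos by (intro ln_mult_pos[symmetric])
  finally show "S n q \<le> C powr \<bar>q\<bar> * l powr (real n * \<tau> q)"
    using pos S_pos by (subst (asm) ln_le_cancel_iff) (simp_all only: mult_pos_pos)
  have "ln (l powr (real n * \<tau> q)) \<le> ln (C powr \<bar>q\<bar>) + ln (S n q)"
    using spectrum_error[of n q] unfolding l ln_powr[of C] by linarith
  also have "\<dots> = ln (C powr \<bar>q\<bar> * S n q)"
    using pos S_pos by (intro ln_mult_pos[symmetric])
  finally show "l powr (real n * \<tau> q) \<le> C powr \<bar>q\<bar> * S n q"
    using pos S_pos by (subst (asm) ln_le_cancel_iff) (simp_all only: mult_pos_pos)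
qed

text \<open>The factor \<open>C powr \<bar>q\<bar>\<close> is \<open>1\<close> for \<open>q = 0\<close>.\<close>

lemma card_pos: "real (card (pos n)) = l powr (real n * \<tau> 0)"
proof -
  have "p w powr 0 = 1" if "w \<in> pos n" for w using pos_p[OF that] by simp
  then have "S n 0 = (\<Sum>w\<in>pos n. 1)" unfolding S_def by (intro sum.cong refl)
  then show ?thesis using S_upper[of n 0] S_lower[of n 0] C1 by simp
qed

lemma spectrum_1: "\<tau> 1 = 0"
proof -
  have "p w powr 1 = p w" if "w \<in> pos n" for w n using pos_p[OF that] by simp
  then have S1: "S n 1 = 1" for n
    unfolding S_def sum_p_pos[of n, symmetric] by (intro sum.cong refl)
  have lnl: "ln (real l) > 0" using l_pos(3) by simp
  have "\<tau> 1 * ln (real l) \<le> 0" "- (\<tau> 1 * ln (real l)) \<le> 0"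
    using spectrum_error[of _ 1] unfolding S1
    by (intro le_0_if_multiples_bounded[of _ "ln C"], simp add: abs_le_iff)+
  then show ?thesis using lnl by (simp add: mult_le_0_iff zero_le_mult_iff)
qed

lemma spectrum_nonpos:
  assumes "1 \<le> q" shows "\<tau> q \<le> 0"
proof -
  have le_1: "S n q \<le> 1" for n
  proof -
    have "S n q \<le> (\<Sum>w\<in>pos n. p w)"
      unfolding S_def
    proof (rule sum_mono)
      fix w assume "w \<in> pos n"
      then have "0 < p w" by (rule pos_p)
      then show "p w powr q \<le> p w"
        using powr_mono'[of 1 q "p w"] assms prob_le_1[of "I w"] by simp
    qed
    then show ?thesis by (simp add: sum_p_pos)
  qed
  have "real n * (\<tau> q * ln (real l)) \<le> \<bar>q\<bar> * ln C" for n
  proof -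
    have "ln (S n q) \<le> 0" using le_1[of n] S_pos[of n q] by (subst ln_le_zero_iff)
    then show ?thesis using spectrum_error[of n q] by linarith
  qed
  then have "\<tau> q * ln (real l) \<le> 0" by (rule le_0_if_multiples_bounded)
  then show ?thesis using l_pos(3) by (simp add: mult_le_0_iff)
qed

text \<open>The Cauchy-Schwarz inequality, for each \<open>n\<close>; the bounded errors disappear as \<open>n\<close> grows.\<close>

lemma spectrum_midpoint_convex: "2 * \<tau> ((q + q') / 2) \<le> \<tau> q + \<tau> q'"
proof -
  let ?r = "(q + q') / 2"
  define K where "K = 2 * (\<bar>?r\<bar> * ln C) + \<bar>q\<bar> * ln C + \<bar>q'\<bar> * ln C"
  have "real n * ((2 * \<tau> ?r - \<tau> q - \<tau> q') * ln (real l)) \<le> K" for n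
  proof -
    have "(S n ?r)\<^sup>2 = (\<Sum>w\<in>pos n. p w powr (q / 2) * p w powr (q' / 2))\<^sup>2"
      unfolding S_def by (simp add: powr_add[symmetric] add_divide_distrib)
    also have "\<dots> \<le> (\<Sum>w\<in>pos n. (p w powr (q / 2))\<^sup>2) * (\<Sum>w\<in>pos n. (p w powr (q' / 2))\<^sup>2)"
      by (rule Cauchy_Schwarz_ineq_sum)
    also have "\<dots> = S n q * S n q'"
      unfolding S_def by (simp add: power2_eq_square powr_add[symmetric])
    finally have "ln ((S n ?r)\<^sup>2) \<le> ln (S n q * S n q')"
      using S_pos[of n] by (subst ln_le_cancel_iff) auto
    then have "2 * ln (S n ?r) \<le> ln (S n q) + ln (S n q')"
      using S_pos[of n] by (simp add: ln_mult ln_realpow)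
    then have "2 * (real n * (\<tau> ?r * ln (real l))) - real n * (\<tau> q * ln (real l)) - real n * (\<tau> q' * ln (real l)) \<le> K"
      using spectrum_error[of n ?r] spectrum_error[of n q] spectrum_error[of n q']
      unfolding K_def by linarith
    then show ?thesis by (simp add: algebra_simps)
  qed
  then have "(2 * \<tau> ?r - \<tau> q - \<tau> q') * ln (real l) \<le> 0" by (rule le_0_if_multiples_bounded)
  then show ?thesis using l_pos(3) by (simp add: mult_le_0_iff)
qed

end

section \<open>Fluctuations of the density ratio\<close>

lemma le_1_if_powers_bounded:
  fixes x a K :: real
  assumes "0 < a" "\<And>k::nat. a * x ^ k \<le> K"
  shows "x \<le> 1"
proof (rule ccontr)
  assume "\<not> x \<le> 1"
  then obtain k where "K / a < x ^ k" using real_arch_pow[of x "K / a"] by auto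
  then show False using assms(2)[of k] assms(1) by (simp add: field_simps)
qed

locale quasi_bernoulli_dim = quasi_bernoulli_cubes m l I C
  for m :: "(real^'n) measure" and l I C +
  fixes d :: real
  assumes deriv: "(Lq_spectrum l m has_real_derivative - d) (at 1)"
begin

text \<open>Up to bounded errors, \<open>n * \<psi> t\<close> is the logarithm in base \<open>l\<close> of the moment of order \<open>t\<close> of
  the density ratio at generation \<open>n\<close>.\<close>

definition \<psi> :: "real \<Rightarrow> real" where "\<psi> t = \<tau> (1 + t) + d * t"

lemma psi_small: "((\<lambda>t. \<psi> t / t) \<longlongrightarrow> 0) (at 0)"
proof -
  have "((\<lambda>h. (\<tau> (1 + h) - \<tau> 1) / h + d) \<longlongrightarrow> - d + d) (at 0)"
    using deriv unfolding DERIV_def by (intro tendsto_intros)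
  moreover have "\<forall>\<^sub>F h in at 0. (\<tau> (1 + h) - \<tau> 1) / h + d = \<psi> h / h"
    using eventually_neq_at_within[of 0 0 UNIV]
    by eventually_elim (simp add: \<psi>_def spectrum_1 add_divide_distrib)
  ultimately show ?thesis using Lim_transform_eventually by fastforce
qed

lemma psi_0: "\<psi> 0 = 0" by (simp add: \<psi>_def spectrum_1)

lemma psi_half: "2 * \<psi> (u / 2) \<le> \<psi> u"
proof -
  have "(1 + u + 1) / 2 = 1 + u / 2" by simp
  then have "2 * \<tau> (1 + u / 2) \<le> \<tau> (1 + u) + \<tau> 1"
    using spectrum_midpoint_convex[of "1 + u" 1] by metis
  then show ?thesis unfolding \<psi>_def spectrum_1 by simp
qed

lemma psi_halves: "2 ^ k * \<psi> (u / 2 ^ k) \<le> \<psi> u"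
proof (induction k)
  case (Suc k)
  have "2 ^ Suc k * \<psi> (u / 2 ^ Suc k) = 2 ^ k * (2 * \<psi> (u / 2 ^ k / 2))" by (simp add: mult.commute)
  also have "\<dots> \<le> 2 ^ k * \<psi> (u / 2 ^ k)" by (intro mult_left_mono psi_half) simp
  finally show ?case using Suc by linarith
qed simp

lemma halves_at_0:
  assumes "u \<noteq> (0::real)" shows "filterlim (\<lambda>k. u / 2 ^ k) (at 0) sequentially"
proof -
  have "(\<lambda>k. u * (1 / 2) ^ k) \<longlonglongrightarrow> u * 0" by (intro tendsto_intros LIMSEQ_power_zero) simp
  then have "(\<lambda>k. u / 2 ^ k) \<longlonglongrightarrow> 0" by (simp add: power_one_over)
  then show ?thesis using assms by (simp add: filterlim_at)
qed

text \<open>A midpoint convex function that is \<open>o(t)\<close> at \<open>0\<close> lies above its tangent \<open>0\<close>.\<close>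

lemma psi_nonneg: "0 \<le> \<psi> u"
proof (cases "u = 0")
  case False
  have "(\<lambda>k. u * (\<psi> (u / 2 ^ k) / (u / 2 ^ k))) \<longlonglongrightarrow> u * 0"
    by (intro tendsto_intros filterlim_compose[OF psi_small halves_at_0[OF False]])
  then have "(\<lambda>k. 2 ^ k * \<psi> (u / 2 ^ k)) \<longlonglongrightarrow> 0"
    using False by (simp add: mult.commute)
  then show ?thesis by (rule LIMSEQ_le_const2) (blast intro: psi_halves)
qed (simp add: psi_0)

lemma psi_zero_halves: "\<psi> u = 0 \<Longrightarrow> \<psi> (u / 2 ^ k) = 0"
  using psi_halves[of k u] psi_nonneg[of "u / 2 ^ k"] by (simp add: mult_le_0_iff power_le_zero_eq)

lemma d_nonneg: "0 \<le> d"
proof (rule tendsto_upperbound)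
  show "((\<lambda>t. \<psi> t / t) \<longlongrightarrow> 0) (at_right 0)"
    using psi_small by (rule tendsto_mono[rotated]) (simp add: at_le)
  show "\<forall>\<^sub>F t in at_right 0. \<psi> t / t \<le> d"
    using eventually_at_right_less[of "0::real"]
  proof eventually_elim
    case (elim t)
    then have "\<psi> t \<le> d * t" using spectrum_nonpos[of "1 + t"] by (simp add: \<psi>_def)
    then show ?case using elim by (simp add: divide_le_eq)
  qed
qed simp

text \<open>The ratio of the measure of a cube to the \<open>d\<close>-th power of its side.\<close>

definition R :: "nat list \<Rightarrow> real" where "R w = p w * l powr (real (length w) * d)"

lemma R_pos: "w \<in> pos n \<Longrightarrow> 0 < R w"
  using pos_p[of w n] by (simp add: R_def)

lemma R_quasi:
  assumes "u \<in> words n" "v \<in> words k"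
  shows "R u * R v \<le> C * R (u @ v)" "R (u @ v) \<le> C * (R u * R v)"
proof -
  have e: "l powr (real (length (u @ v)) * d) = l powr (real (length u) * d) * l powr (real (length v) * d)"
    by (simp add: distrib_right powr_add)
  have "R u * R v = (p u * p v) * l powr (real (length (u @ v)) * d)"
    unfolding R_def e by (simp add: mult_ac)
  also have "\<dots> \<le> (C * p (u @ v)) * l powr (real (length (u @ v)) * d)"
    by (intro mult_right_mono quasi[OF assms]) simp
  finally show "R u * R v \<le> C * R (u @ v)" by (simp only: R_def mult.assoc)
  have "R (u @ v) \<le> (C * (p u * p v)) * l powr (real (length (u @ v)) * d)"
    unfolding R_def by (intro mult_right_mono quasi[OF assms]) simp
  also have "\<dots> = C * (R u * R v)"
    unfolding R_def e by (simp add: mult_ac)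
  finally show "R (u @ v) \<le> C * (R u * R v)" .
qed

lemma moment_eq: "(\<Sum>w\<in>pos n. p w * R w powr t) = l powr (real n * (d * t)) * S n (1 + t)"
  unfolding S_def sum_distrib_left
proof (rule sum.cong[OF refl])
  fix w assume w: "w \<in> pos n"
  have "p w > 0" "length w = n" using pos_p[OF w] words_length[OF pos_words[OF w]] by auto
  then show "p w * R w powr t = l powr (real n * (d * t)) * p w powr (1 + t)"
    by (simp add: R_def powr_mult powr_powr powr_add mult_ac)
qed

lemma moment_upper: "(\<Sum>w\<in>pos n. p w * R w powr t) \<le> C powr \<bar>1 + t\<bar> * l powr (real n * \<psi> t)"
  and moment_lower: "l powr (real n * \<psi> t) \<le> C powr \<bar>1 + t\<bar> * (\<Sum>w\<in>pos n. p w * R w powr t)"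
proof -
  have e: "l powr (real n * \<psi> t) = l powr (real n * (d * t)) * l powr (real n * \<tau> (1 + t))"
    by (simp add: \<psi>_def distrib_left powr_add)
  have "l powr (real n * (d * t)) * S n (1 + t)
      \<le> l powr (real n * (d * t)) * (C powr \<bar>1 + t\<bar> * l powr (real n * \<tau> (1 + t)))"
    by (intro mult_left_mono S_upper) simp
  then show "(\<Sum>w\<in>pos n. p w * R w powr t) \<le> C powr \<bar>1 + t\<bar> * l powr (real n * \<psi> t)"
    unfolding moment_eq e by (simp only: mult_ac)
  have "l powr (real n * (d * t)) * l powr (real n * \<tau> (1 + t))
      \<le> l powr (real n * (d * t)) * (C powr \<bar>1 + t\<bar> * S n (1 + t))"
    by (intro mult_left_mono S_lower) simp
  then show "l powr (real n * \<psi> t) \<le> C powr \<bar>1 + t\<bar> * (\<Sum>w\<in>pos n. p w * R w powr t)"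
    unfolding moment_eq e by (simp only: mult_ac)
qed

text \<open>When the spectrum is affine all exponential moments of both signs are bounded by
  \<open>C powr (1 + \<bar>t\<bar>)\<close>; letting \<open>t\<close> tend to \<open>\<plusminus>\<infinity>\<close> bounds the ratio itself.\<close>

lemma ratio_bounded:
  assumes "\<And>t. \<psi> t = 0" and w: "w \<in> pos n"
  shows "R w \<le> C" "1 \<le> C * R w"
proof -
  have p: "p w > 0" and R: "R w > 0" using pos_p[OF w] R_pos[OF w] .
  have *: "p w * R w powr t \<le> C * C powr \<bar>t\<bar>" for t
  proof -
    have "p w * R w powr t \<le> (\<Sum>w\<in>pos n. p w * R w powr t)"
      by (rule member_le_sum[OF w]) auto
    also have "\<dots> \<le> C powr \<bar>1 + t\<bar>" using moment_upper[of t n] assms(1) by simp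
    also have "\<dots> \<le> C powr (1 + \<bar>t\<bar>)" using C1 by (intro powr_mono) auto
    finally show ?thesis using C1 by (simp add: powr_add)
  qed
  have "p w * (R w / C) ^ k \<le> C" for k
  proof -
    have "p w * R w ^ k \<le> C * C ^ k" using *[of "real k"] R by (simp add: powr_realpow)
    then show ?thesis by (simp add: power_divide divide_le_eq)
  qed
  then have "R w / C \<le> 1" by (rule le_1_if_powers_bounded[OF p])
  then show "R w \<le> C" by (simp add: divide_le_eq)
  have "p w * (1 / (C * R w)) ^ k \<le> C" for k
  proof -
    have "p w * R w powr - real k \<le> C * C ^ k" using *[of "- real k"] by (simp add: powr_realpow)
    then have "p w / R w ^ k \<le> C * C ^ k" using R by (simp add: powr_minus_divide powr_realpow)
    then show ?thesis using R by (simp add: power_one_over power_mult_distrib field_simps)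
  qed
  then have "1 / (C * R w) \<le> 1" by (rule le_1_if_powers_bounded[OF p])
  then show "1 \<le> C * R w" using R by (simp add: divide_le_eq)
qed

text \<open>For \<open>t\<close> proportional to \<open>n powr (- 1 / j)\<close> both \<open>n * \<psi> t\<close> and \<open>n * \<psi> (2 * t)\<close> converge to
  positive limits. The second moment method for \<open>R w powr t\<close> gives \<open>R w powr t \<ge> exp 1\<close> with a
  probability bounded below, and as \<open>t\<close> tends to \<open>0\<close> this forces \<open>R w powr \<sigma>\<close> beyond any
  constant.\<close>

lemma fluctuation:
  assumes \<sigma>: "\<sigma> = 1 \<or> \<sigma> = - 1"
    and lead: "((\<lambda>t. \<psi> t / t ^ j) \<longlongrightarrow> b) (at 0)" "b \<noteq> 0"
  obtains \<epsilon> where "\<epsilon> > 0"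
    "\<And>K. \<forall>\<^sub>F n in sequentially. \<epsilon> \<le> (\<Sum>w\<in>{w\<in>pos n. K \<le> R w powr \<sigma>}. p w)"
proof -
  have \<sigma>0: "\<sigma> \<noteq> 0" "\<bar>\<sigma>\<bar> = 1" using \<sigma> by auto
  have j: "j > 0"
  proof (rule ccontr)
    assume "\<not> j > 0"
    then have "(\<psi> \<longlongrightarrow> b) (at 0)" using lead(1) by simp
    moreover have "((\<lambda>t. \<psi> t / t * t) \<longlongrightarrow> 0 * 0) (at 0)" by (intro tendsto_intros psi_small)
    moreover have "\<forall>\<^sub>F t in at 0. \<psi> t / t * t = \<psi> t"
      using eventually_neq_at_within[of 0 0 UNIV] by eventually_elim simp
    ultimately have "(\<psi> \<longlongrightarrow> b) (at 0)" "(\<psi> \<longlongrightarrow> 0) (at 0)"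
      using Lim_transform_eventually by fastforce+
    then show False using lead(2) tendsto_unique[OF at_neq_bot] by blast
  qed
  have lim\<sigma>: "(\<lambda>n. \<psi> (\<sigma> * x n) / (\<sigma> * x n) ^ j) \<longlonglongrightarrow> b"
    if "x \<longlonglongrightarrow> 0" "\<forall>\<^sub>F n in sequentially. x n \<noteq> 0" for x :: "nat \<Rightarrow> real"
  proof (rule filterlim_compose[OF lead(1)])
    have "(\<lambda>n. \<sigma> * x n) \<longlonglongrightarrow> \<sigma> * 0" by (intro tendsto_intros that)
    moreover have "\<forall>\<^sub>F n in sequentially. \<sigma> * x n \<noteq> 0"
      using that(2) by eventually_elim (use \<sigma>0 in simp)
    ultimately show "filterlim (\<lambda>n. \<sigma> * x n) (at 0) sequentially" by (simp add: filterlim_at)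
  qed
  \<comment> \<open>Nonnegativity of \<open>\<psi>\<close> on both sides of \<open>0\<close> fixes the sign of the leading term.\<close>
  define c where "c = b * \<sigma> ^ j"
  have "c > 0"
  proof -
    have "(\<lambda>n. \<psi> (\<sigma> * inverse (real (Suc n))) / (\<sigma> * inverse (real (Suc n))) ^ j * \<sigma> ^ j) \<longlonglongrightarrow> b * \<sigma> ^ j"
      by (intro tendsto_mult lim\<sigma> LIMSEQ_inverse_real_of_nat tendsto_const) simp
    moreover have "0 \<le> \<psi> (\<sigma> * inverse (real (Suc n))) / (\<sigma> * inverse (real (Suc n))) ^ j * \<sigma> ^ j" for n
      using \<sigma>0 psi_nonneg by (simp add: power_mult_distrib zero_le_divide_iff)
    ultimately have "0 \<le> c" unfolding c_def by (intro LIMSEQ_le_const) auto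
    moreover have "c \<noteq> 0" using lead(2) \<sigma>0 by (simp add: c_def)
    ultimately show ?thesis by (simp add: less_le)
  qed
  \<comment> \<open>Moments are known up to the factor \<open>C\<^sup>2\<close> only. The limit \<open>a\<close> of \<open>n * \<psi> t\<close> is taken so large
    that the moment of order \<open>t\<close> is at least \<open>2 * exp 1\<close> in spite of this.\<close>
  define a where "a = 2 * log l (2 * exp 1 * C\<^sup>2)"
  have a: "l powr (a / 2) = 2 * exp 1 * C\<^sup>2" using l_pos(3) by (simp add: a_def)
  have "1 < 2 * exp 1 * C\<^sup>2"
  proof -
    have "1 < exp (1::real)" "1 \<le> C\<^sup>2" using C1 by (simp_all add: one_le_power)
    then have "1 * 1 < (2 * exp 1) * C\<^sup>2" by (intro mult_less_le_imp_less) linarith+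
    then show ?thesis by simp
  qed
  then have a0: "a > 0" using l_pos(3) by (simp add: a_def)
  define x where "x n = root j (a / c / real n)" for n
  have x_pos: "x n > 0" if "n > 0" for n using a0 \<open>c > 0\<close> j that by (simp add: x_def)
  have x_pow: "x n ^ j = a / c / real n" if "n > 0" for n
    unfolding x_def using a0 \<open>c > 0\<close> j by (intro real_root_pow_pos2) auto
  have x_0: "x \<longlonglongrightarrow> 0"
  proof -
    have "(\<lambda>n. root j (a / c / real n)) \<longlonglongrightarrow> root j 0" by (intro tendsto_intros lim_const_over_n)
    then show ?thesis by (simp add: x_def[abs_def])
  qed
  have scaled: "(\<lambda>n. real n * \<psi> (\<sigma> * (r * x n))) \<longlonglongrightarrow> r ^ j * a" if "r > 0" for r :: real
  proof -
    have "(\<lambda>n. r * x n) \<longlonglongrightarrow> r * 0" by (intro tendsto_intros x_0)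
    moreover have "\<forall>\<^sub>F n in sequentially. r * x n \<noteq> 0"
      using eventually_gt_at_top[of 0]
    proof eventually_elim
      case (elim n)
      then show ?case using x_pos[OF elim] that by simp
    qed
    ultimately have "(\<lambda>n. \<psi> (\<sigma> * (r * x n)) / (\<sigma> * (r * x n)) ^ j * (\<sigma> ^ j * r ^ j * (a / c)))
        \<longlonglongrightarrow> b * (\<sigma> ^ j * r ^ j * (a / c))"
      by (intro tendsto_mult[OF lim\<sigma> tendsto_const]) simp_all
    moreover have "b * (\<sigma> ^ j * r ^ j * (a / c)) = r ^ j * a"
    proof -
      have "b * (\<sigma> ^ j * r ^ j * (a / c)) = c * (a / c) * r ^ j" by (simp add: c_def mult_ac)
      then show ?thesis using \<open>c > 0\<close> by simp
    qed
    moreover have "\<forall>\<^sub>F n in sequentially. \<psi> (\<sigma> * (r * x n)) / (\<sigma> * (r * x n)) ^ j * (\<sigma> ^ j * r ^ j * (a / c))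
        = real n * \<psi> (\<sigma> * (r * x n))"
      using eventually_gt_at_top[of 0]
    proof eventually_elim
      case (elim n)
      have "(\<sigma> * (r * x n)) ^ j * real n = \<sigma> ^ j * r ^ j * (a / c)"
        using elim by (simp add: power_mult_distrib x_pow)
      moreover have "(\<sigma> * (r * x n)) ^ j \<noteq> 0" using \<sigma>0 that x_pos[OF elim] by simp
      moreover have "P / X * E = N * P" if "X * N = E" "X \<noteq> 0" for P X E N :: real
        using that by auto
      ultimately show ?case by blast
    qed
    ultimately show ?thesis using Lim_transform_eventually by fastforce
  qed
  define B where "B = C\<^sup>2 * l powr (2 ^ j * a + 1)"
  have B: "B > 0" unfolding B_def using C1 l_pos by simp
  define \<epsilon> where "\<epsilon> = (exp 1)\<^sup>2 / B"
  have "\<forall>\<^sub>F n in sequentially. \<epsilon> \<le> (\<Sum>w\<in>{w\<in>pos n. K \<le> R w powr \<sigma>}. p w)" for K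
  proof -
    \<comment> \<open>The logarithm of the threshold has to be positive.\<close>
    define K' where "K' = max 2 K"
    have K': "K' \<ge> 2" "K \<le> K'" "ln K' > 0" by (auto simp: K'_def)
    have ev1: "\<forall>\<^sub>F n in sequentially. a / 2 < real n * \<psi> (\<sigma> * (1 * x n))"
      by (rule order_tendstoD(1)[OF scaled]) (use a0 in simp_all)
    have ev2: "\<forall>\<^sub>F n in sequentially. real n * \<psi> (\<sigma> * (2 * x n)) < 2 ^ j * a + 1"
      by (rule order_tendstoD(2)[OF scaled]) simp_all
    have ev3: "\<forall>\<^sub>F n in sequentially. x n < min (1 / 2) (1 / ln K')"
      by (rule order_tendstoD(2)[OF x_0]) (use K' in simp)
    show ?thesis using ev1 ev2 ev3 eventually_gt_at_top[of 0]
    proof eventually_elim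
      case (elim n)
      let ?t = "\<sigma> * x n"
      have x: "0 < x n" "x n \<le> 1 / 2" "x n * ln K' \<le> 1"
        using x_pos[OF elim(4)] elim(3) K'(3) by (auto simp: field_simps)
      have t: "\<bar>1 + ?t\<bar> \<le> 2" "\<bar>1 + 2 * ?t\<bar> \<le> 2" using \<sigma> x by auto
      have C2: "C powr r \<le> C\<^sup>2" if "r \<le> 2" for r
        using powr_mono[OF that C1] C1 by (simp add: powr_realpow)
      have "2 * exp 1 * C\<^sup>2 \<le> l powr (real n * \<psi> ?t)"
        unfolding a[symmetric] using elim(1) l_pos(3) by (intro powr_mono) auto
      also have "\<dots> \<le> C powr \<bar>1 + ?t\<bar> * (\<Sum>w\<in>pos n. p w * R w powr ?t)" by (rule moment_lower)
      also have "\<dots> \<le> C\<^sup>2 * (\<Sum>w\<in>pos n. p w * R w powr ?t)"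
        by (intro mult_right_mono C2 t sum_nonneg) simp
      finally have first: "2 * exp 1 \<le> (\<Sum>w\<in>pos n. p w * R w powr ?t)" by (simp add: mult.commute)
      have "(\<Sum>w\<in>pos n. p w * (R w powr ?t)\<^sup>2) = (\<Sum>w\<in>pos n. p w * R w powr (2 * ?t))"
        by (simp add: power2_eq_square powr_add[symmetric])
      also have "\<dots> \<le> C powr \<bar>1 + 2 * ?t\<bar> * l powr (real n * \<psi> (2 * ?t))" by (rule moment_upper)
      also have "\<dots> \<le> B"
        unfolding B_def using elim(2) l_pos(3) by (intro mult_mono C2 t powr_mono) (auto simp: mult_ac)
      finally have second: "(\<Sum>w\<in>pos n. p w * (R w powr ?t)\<^sup>2) \<le> B" .
      have "\<epsilon> \<le> (\<Sum>w\<in>{w\<in>pos n. exp 1 \<le> R w powr ?t}. p w)"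
        unfolding \<epsilon>_def
        by (rule second_moment_lower_bound[OF finite_pos _ _ _ _ first second B]) (auto simp: sum_p_pos)
      also have "\<dots> \<le> (\<Sum>w\<in>{w\<in>pos n. K \<le> R w powr \<sigma>}. p w)"
      proof (rule sum_mono2)
        show "{w\<in>pos n. exp 1 \<le> R w powr ?t} \<subseteq> {w\<in>pos n. K \<le> R w powr \<sigma>}"
        proof safe
          fix w assume w: "w \<in> pos n" "exp 1 \<le> R w powr ?t"
          have "R w > 0" using R_pos[OF w(1)] .
          then have "1 \<le> ln (R w powr ?t)" using w(2) by (subst ln_ge_iff) auto
          then have "1 \<le> x n * ln (R w powr \<sigma>)" by (simp add: ln_powr mult_ac)
          then have "x n * ln K' \<le> x n * ln (R w powr \<sigma>)" using x(3) by linarith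
          then have "ln K' \<le> ln (R w powr \<sigma>)" using x(1) by simp
          then have "K' \<le> R w powr \<sigma>"
            by (subst (asm) ln_le_cancel_iff) (use K'(1) \<open>R w > 0\<close> in auto)
          then show "K \<le> R w powr \<sigma>" using K'(2) by linarith
        qed
      qed auto
      finally show ?case .
    qed
  qed
  moreover have "\<epsilon> > 0" unfolding \<epsilon>_def using B by simp
  ultimately show ?thesis using that by blast
qed

text \<open>Chernoff's bound with a small fixed order \<open>t\<close>: in the exponent \<open>\<psi> t = o(t)\<close> loses against
  \<open>t * (d - s)\<close>.\<close>

lemma heavy_cubes_rare:
  assumes "s < d"
  obtains K \<rho> where "0 < \<rho>" "\<rho> < 1"
    "\<And>n. (\<Sum>w\<in>{w\<in>pos n. l powr (- (real n * s)) \<le> p w}. p w) \<le> K * \<rho> ^ n"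
proof -
  have "\<forall>\<^sub>F t in at_right 0. \<psi> t / t < (d - s) / 2"
    by (rule order_tendstoD(2)[OF tendsto_mono[OF _ psi_small]]) (use assms in \<open>simp_all add: at_le\<close>)
  moreover have "\<forall>\<^sub>F t in at_right 0. t < (1::real)"
    by (rule eventually_at_right_less[THEN eventually_mono, of 0, THEN eventually_rev_mp])
      (auto intro!: eventually_at_rightI[of 0 1])
  moreover have "\<forall>\<^sub>F t in at_right 0. (0::real) < t" by (rule eventually_at_right_less)
  ultimately have "\<forall>\<^sub>F t in at_right 0. \<psi> t / t < (d - s) / 2 \<and> t < 1 \<and> 0 < t"
    by eventually_elim simp
  then obtain t where "\<psi> t / t < (d - s) / 2" and t: "t < 1" "0 < t"
    using eventually_happens'[OF trivial_limit_at_right_real] by blast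
  then have psi: "\<psi> t < t * (d - s) / 2" by (simp add: field_simps)
  define \<rho> where "\<rho> = l powr (- (t * (d - s) / 2))"
  have "(\<Sum>w\<in>{w\<in>pos n. l powr (- (real n * s)) \<le> p w}. p w) \<le> C\<^sup>2 * \<rho> ^ n" for n
  proof -
    let ?T = "{w\<in>pos n. l powr (- (real n * s)) \<le> p w}"
    have "(\<Sum>w\<in>?T. p w) \<le> (\<Sum>w\<in>?T. l powr (- (real n * (t * (d - s)))) * (p w * R w powr t))"
    proof (rule sum_mono)
      fix w assume "w \<in> ?T"
      then have w: "w \<in> pos n" "l powr (- (real n * s)) \<le> p w" by auto
      have len: "length w = n" using words_length[OF pos_words[OF w(1)]] .
      have "l powr (real n * (d - s)) = l powr (- (real n * s)) * l powr (real n * d)"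
        by (simp add: powr_add[symmetric] algebra_simps)
      also have "\<dots> \<le> R w" unfolding R_def len by (intro mult_right_mono w) simp
      finally have "(l powr (real n * (d - s))) powr t \<le> R w powr t" using t by (intro powr_mono2) auto
      then have "l powr (real n * (t * (d - s))) \<le> R w powr t" by (simp add: powr_powr mult_ac)
      then have "1 \<le> l powr (- (real n * (t * (d - s)))) * R w powr t"
        by (simp add: powr_minus_divide le_divide_eq)
      then have "p w * 1 \<le> p w * (l powr (- (real n * (t * (d - s)))) * R w powr t)"
        by (intro mult_left_mono) auto
      then show "p w \<le> l powr (- (real n * (t * (d - s)))) * (p w * R w powr t)" by (simp add: mult_ac)
    qed
    also have "\<dots> \<le> l powr (- (real n * (t * (d - s)))) * (\<Sum>w\<in>pos n. p w * R w powr t)"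
      unfolding sum_distrib_left by (rule sum_mono2) auto
    also have "\<dots> \<le> l powr (- (real n * (t * (d - s)))) * (C powr \<bar>1 + t\<bar> * l powr (real n * \<psi> t))"
      by (intro mult_left_mono moment_upper) simp
    also have "\<dots> = C powr \<bar>1 + t\<bar> * l powr (real n * (\<psi> t - t * (d - s)))"
      by (simp add: powr_add[symmetric] algebra_simps)
    also have "\<dots> \<le> C powr 2 * l powr (real n * (- (t * (d - s) / 2)))"
      using psi t C1 l_pos(3) by (intro mult_mono powr_mono mult_left_mono) auto
    also have "\<dots> = C\<^sup>2 * \<rho> ^ n"
    proof -
      have "\<rho> ^ n = l powr (real n * (- (t * (d - s) / 2)))" by (simp add: \<rho>_def powr_power)
      moreover have "C powr 2 = C\<^sup>2" using C1 by simp
      ultimately show ?thesis by (simp only:)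
    qed
    finally show ?thesis .
  qed
  moreover have "\<rho> < 1" unfolding \<rho>_def using t assms l_pos(3) by (intro powr_less_one) auto
  moreover have "0 < \<rho>" unfolding \<rho>_def by simp
  ultimately show ?thesis using that by blast
qed

end

section \<open>Coverings by minimal cubes\<close>

context quasi_bernoulli_cubes
begin

definition all_words :: "nat list set" where "all_words = (\<Union>n. words n)"

lemma all_words_length: "w \<in> all_words \<Longrightarrow> w \<in> words (length w)"
  by (auto simp: all_words_def words_def)

lemma words_all: "w \<in> words n \<Longrightarrow> w \<in> all_words"
  by (auto simp: all_words_def)

definition minimal :: "nat list set \<Rightarrow> nat list set" where
  "minimal Q = {w \<in> Q. \<forall>k<length w. take k w \<notin> Q}"

lemma minimal_subset: "minimal Q \<subseteq> Q" by (auto simp: minimal_def)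

lemma minimal_prefix:
  assumes "w \<in> Q"
  obtains k where "k \<le> length w" "take k w \<in> minimal Q"
proof
  define k where "k = (LEAST k. take k w \<in> Q)"
  have Q: "take (length w) w \<in> Q" using assms by simp
  show k: "k \<le> length w" unfolding k_def by (rule Least_le[of "\<lambda>k. take k w \<in> Q", OF Q])
  have "take k w \<in> Q" unfolding k_def by (rule LeastI[of "\<lambda>k. take k w \<in> Q", OF Q])
  moreover have "take i (take k w) \<notin> Q" if "i < length (take k w)" for i
  proof -
    have "i < k" using that by simp
    then show ?thesis using not_less_Least[of i "\<lambda>k. take k w \<in> Q"] by (simp add: k_def min_def)
  qed
  ultimately show "take k w \<in> minimal Q" by (simp add: minimal_def)
qed

lemma minimal_disjoint:
  assumes "Q \<subseteq> all_words"
  shows "disjoint_family_on I (minimal Q)"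
proof -
  have *: "u = v" if "u \<in> minimal Q" "v \<in> minimal Q" "x \<in> I u" "x \<in> I v" "length u \<le> length v" for u v x
  proof -
    have w: "u \<in> words (length u)" "v \<in> words (length v)"
      using that assms all_words_length minimal_subset by blast+
    have "u = take (length u) v" by (rule cube_comparable[OF w that(5,3,4)])
    moreover have "\<not> length u < length v"
      using that(1,2) calculation minimal_subset[of Q] by (auto simp: minimal_def)
    ultimately show ?thesis using that(5) by simp
  qed
  show ?thesis
    unfolding disjoint_family_on_def using * nat_le_linear by blast
qed

lemma minimal_cover:
  assumes "Q \<subseteq> all_words"
  shows "(\<Union>w\<in>Q. I w) = (\<Union>w\<in>minimal Q. I w)"
    and "(\<Union>w\<in>Q. closure (I w)) = (\<Union>w\<in>minimal Q. closure (I w))"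
proof -
  have sub: "\<exists>v\<in>minimal Q. I w \<subseteq> I v" if "w \<in> Q" for w
  proof -
    obtain k where k: "k \<le> length w" "take k w \<in> minimal Q" by (rule minimal_prefix[OF \<open>w \<in> Q\<close>])
    have "w \<in> words (length w)" using that assms all_words_length by blast
    from cube_take_subset[OF this k(1)] k(2) show ?thesis by blast
  qed
  show "(\<Union>w\<in>Q. I w) = (\<Union>w\<in>minimal Q. I w)" using sub minimal_subset by fastforce
  have "\<exists>v\<in>minimal Q. closure (I w) \<subseteq> closure (I v)" if "w \<in> Q" for w
    using sub[OF that] closure_mono by blast
  then show "(\<Union>w\<in>Q. closure (I w)) = (\<Union>w\<in>minimal Q. closure (I w))"
    using minimal_subset by fastforce
qed

lemma small_scale:
  assumes "0 < r"
  obtains N where "\<And>n. N \<le> n \<Longrightarrow> real CARD('n) / real l ^ n < r"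
proof -
  obtain N where N: "real CARD('n) / r < real l ^ N" using real_arch_pow[OF l_pos(3)] by blast
  have "real CARD('n) / real l ^ n < r" if "N \<le> n" for n
  proof -
    have "real l ^ N \<le> real l ^ n" using that l_pos(3) by (intro power_increasing) auto
    then have "real CARD('n) / r < real l ^ n" using N by linarith
    then show ?thesis using assms lpow_pos[of n] by (simp add: divide_less_eq mult.commute)
  qed
  then show ?thesis using that by blast
qed

lemma side_powr: "(real CARD('n) / real l ^ n) powr s = real CARD('n) powr s * l powr (- (real n * s))"
proof -
  have "(real l ^ n) powr s = l powr (real n * s)"
    using powr_powr[of "real l" "real n" s] by (simp add: powr_realpow)
  then show ?thesis by (simp add: powr_divide powr_minus_divide)
qed

text \<open>The minimal words of a family are pairwise incomparable, so their cubes are disjoint and the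
  total mass of finitely many of them is at most the mass of \<open>V\<close>.\<close>

lemma hausdorff_pre_cover:
  assumes Q: "Q \<subseteq> all_words" and N: "\<And>w. w \<in> Q \<Longrightarrow> N \<le> length w"
    and heavy: "\<And>w. w \<in> Q \<Longrightarrow> l powr (- (real (length w) * s)) \<le> K * p w"
    and V: "\<And>w. w \<in> Q \<Longrightarrow> I w \<subseteq> V" "V \<in> sets borel"
    and E: "E \<subseteq> (\<Union>w\<in>Q. closure (I w))" and "0 \<le> s" "0 \<le> K"
    and \<eta>: "real CARD('n) / real l ^ N \<le> \<eta>"
  shows "hausdorff_pre s \<eta> E \<le> ennreal (real CARD('n) powr s * K * prob V)"
proof (rule hausdorff_pre_le[of "minimal Q" _ "\<lambda>w. closure (I w)"])
  have words: "w \<in> words (length w)" if "w \<in> minimal Q" for w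
    using that minimal_subset[of Q] Q all_words_length by blast
  show "countable (minimal Q)" by simp
  show "E \<subseteq> (\<Union>w\<in>minimal Q. closure (I w))" using E minimal_cover(2)[OF Q] by simp
  show "bounded (closure (I w))" if "w \<in> minimal Q" for w using cube_bounded[OF words[OF that]] .
  have diam: "diameter (closure (I w)) \<le> real CARD('n) / real l ^ length w" if "w \<in> minimal Q" for w
    using cube_diameter[OF words[OF that]] .
  show "diameter (closure (I w)) \<le> \<eta>" if "w \<in> minimal Q" for w
  proof -
    have "real CARD('n) / real l ^ length w \<le> real CARD('n) / real l ^ N"
      using N[of w] that minimal_subset[of Q] l_pos(3)
      by (intro divide_left_mono power_increasing) auto
    then show ?thesis using diam[OF that] \<eta> by linarith
  qed
  show "0 \<le> \<eta>" by (rule order.trans[OF _ \<eta>]) simp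
  fix F assume F: "finite F" "F \<subseteq> minimal Q"
  have "(\<Sum>w\<in>F. diam_pow s (closure (I w))) \<le> (\<Sum>w\<in>F. ennreal (real CARD('n) powr s * K * p w))"
  proof (rule sum_mono)
    fix w assume "w \<in> F"
    then have w: "w \<in> minimal Q" "w \<in> Q" using F minimal_subset[of Q] by auto
    have "diam_pow s (closure (I w)) \<le> ennreal ((real CARD('n) / real l ^ length w) powr s)"
      by (rule diam_pow_le[OF assms(7) diam[OF w(1)] cube_bounded[OF words[OF w(1)]]]) simp
    also have "\<dots> \<le> ennreal (real CARD('n) powr s * (K * p w))"
      unfolding side_powr by (intro ennreal_leI mult_left_mono heavy w) simp
    finally show "diam_pow s (closure (I w)) \<le> ennreal (real CARD('n) powr s * K * p w)"
      by (simp only: mult.assoc)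
  qed
  also have "\<dots> = ennreal (real CARD('n) powr s * K * (\<Sum>w\<in>F. p w))"
    using assms(8) by (simp add: sum_ennreal sum_distrib_left)
  also have "(\<Sum>w\<in>F. p w) = prob (\<Union>w\<in>F. I w)"
  proof (rule finite_measure_finite_Union[symmetric, OF F(1)])
    show "I ` F \<subseteq> events" using F(2) words cube_events by blast
    show "disjoint_family_on I F" by (rule disjoint_family_on_mono[OF F(2) minimal_disjoint[OF Q]])
  qed
  also have "ennreal (real CARD('n) powr s * K * \<dots>) \<le> ennreal (real CARD('n) powr s * K * prob V)"
  proof (intro ennreal_leI mult_left_mono finite_measure_mono)
    show "(\<Union>w\<in>F. I w) \<subseteq> V" using V(1) F(2) minimal_subset[of Q] by blast
  qed (use assms(8) V(2) sets_m in auto)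
  finally show "(\<Sum>w\<in>F. diam_pow s (closure (I w))) \<le> ennreal (real CARD('n) powr s * K * prob V)" .
qed

section \<open>A zero-one law\<close>

text \<open>The complement of such a set has an open neighbourhood with almost the same measure. Up to a
  null set, this neighbourhood is a disjoint union of cubes, each of which gives the set a fixed
  proportion of its mass.\<close>

lemma full_measure:
  assumes G: "G \<in> sets borel" and \<epsilon>: "0 < \<epsilon>"
    and dense: "\<And>n w. w \<in> words n \<Longrightarrow> \<epsilon> * p w \<le> prob (G \<inter> I w)"
  shows "prob G = 1"
proof -
  have ev: "G \<in> events" "- G \<in> events" using G by (auto simp: sets_m)
  have "\<epsilon> * prob (- G) \<le> \<eta>" if "0 < \<eta>" for \<eta>
  proof -
    have "emeasure m (- G) < emeasure m (- G) + ennreal \<eta>"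
      using that by (simp add: emeasure_eq_measure ennreal_less_iff flip: ennreal_plus)
    moreover have "emeasure m (- G) = (INF U\<in>{U. - G \<subseteq> U \<and> open U}. emeasure m U)"
      by (rule outer_regular[OF sets_m]) (use G in \<open>simp_all add: emeasure_eq_measure\<close>)
    ultimately have "(INF U\<in>{U. - G \<subseteq> U \<and> open U}. emeasure m U) < emeasure m (- G) + ennreal \<eta>" by simp
    then obtain U where U: "- G \<subseteq> U" "open U" "emeasure m U < emeasure m (- G) + ennreal \<eta>"
      unfolding INF_less_iff by blast
    have evU: "U \<in> events" using U(2) by (simp add: sets_m)
    have small: "prob U < prob (- G) + \<eta>"
      using U(3) that by (simp add: emeasure_eq_measure ennreal_less_iff flip: ennreal_plus)
    define Q where "Q = {w \<in> all_words. I w \<subseteq> U}"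
    have Q: "Q \<subseteq> all_words" by (auto simp: Q_def)
    have words: "w \<in> words (length w)" if "w \<in> minimal Q" for w
      using that minimal_subset[of Q] Q all_words_length by blast
    have "U \<inter> unit_cube \<subseteq> (\<Union>w\<in>Q. I w)"
    proof
      fix x assume x: "x \<in> U \<inter> unit_cube"
      then obtain r where r: "0 < r" "ball x r \<subseteq> U" using U(2) by (auto simp: open_contains_ball)
      obtain n where n: "real CARD('n) / real l ^ n < r" using small_scale[OF r(1)] by blast
      obtain w where w: "w \<in> words n" "x \<in> I w" using cube_ex x by blast
      have "I w \<subseteq> ball x r"
      proof
        fix y assume "y \<in> I w"
        then have "dist x y \<le> real CARD('n) / real l ^ n"
          using cube_dist[OF w(1)] w(2) closure_subset by blast
        then show "y \<in> ball x r" using n by simp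
      qed
      then have "w \<in> Q" using r(2) words_all[OF w(1)] by (auto simp: Q_def)
      then show "x \<in> (\<Union>w\<in>Q. I w)" using w(2) by blast
    qed
    moreover have "(\<Union>w\<in>Q. I w) \<subseteq> U" by (auto simp: Q_def)
    ultimately have cover: "U \<inter> unit_cube \<subseteq> (\<Union>w\<in>minimal Q. I w)" "(\<Union>w\<in>minimal Q. I w) \<subseteq> U"
      using minimal_cover(1)[OF Q] by auto
    have disj: "disjoint_family_on I (minimal Q)" by (rule minimal_disjoint[OF Q])
    have cubes: "(\<Union>w\<in>minimal Q. I w) \<in> events"
      by (rule sets.countable_UN') (use words cube_events in auto)
    have "ennreal \<epsilon> * emeasure m (\<Union>w\<in>minimal Q. I w)
        = ennreal \<epsilon> * (\<integral>\<^sup>+w. emeasure m (I w) \<partial>count_space (minimal Q))"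
      by (subst emeasure_UN_countable[OF _ _ disj]) (use words cube_events in auto)
    also have "\<dots> = (\<integral>\<^sup>+w. ennreal \<epsilon> * emeasure m (I w) \<partial>count_space (minimal Q))"
      by (rule nn_integral_cmult[symmetric]) simp
    also have "\<dots> \<le> (\<integral>\<^sup>+w. emeasure m (G \<inter> I w) \<partial>count_space (minimal Q))"
    proof (rule nn_integral_mono)
      fix w assume "w \<in> space (count_space (minimal Q))"
      then have "\<epsilon> * p w \<le> prob (G \<inter> I w)" using dense[OF words] by simp
      then show "ennreal \<epsilon> * emeasure m (I w) \<le> emeasure m (G \<inter> I w)"
        using \<epsilon> by (simp add: emeasure_eq_measure ennreal_mult[symmetric])
    qed
    also have "\<dots> = emeasure m (\<Union>w\<in>minimal Q. G \<inter> I w)"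
    proof (rule emeasure_UN_countable[symmetric])
      show "disjoint_family_on (\<lambda>w. G \<inter> I w) (minimal Q)"
        using disj by (auto simp: disjoint_family_on_def)
      show "G \<inter> I w \<in> events" if "w \<in> minimal Q" for w
        using cube_events[OF words[OF that]] ev by blast
    qed simp
    also have "\<dots> \<le> emeasure m (G \<inter> U)"
      using cover(2) ev evU by (intro emeasure_mono) auto
    finally have "\<epsilon> * prob (\<Union>w\<in>minimal Q. I w) \<le> prob (G \<inter> U)"
      using \<epsilon> by (simp add: emeasure_eq_measure ennreal_mult[symmetric])
    moreover have "prob U \<le> prob (\<Union>w\<in>minimal Q. I w)"
    proof -
      have "AE x in m. x \<in> unit_cube" by (rule AE_prob_1[OF prob_unit_cube])
      then show ?thesis
        by (intro finite_measure_mono_AE[OF _ cubes]) (use cover(1) in \<open>auto elim!: eventually_mono\<close>)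
    qed
    ultimately have "\<epsilon> * prob U \<le> prob (G \<inter> U)"
      using \<epsilon> by (meson less_imp_le mult_left_mono order.trans)
    moreover have "prob U = prob (G \<inter> U) + prob (- G)"
    proof -
      have "U = (G \<inter> U) \<union> - G" using U(1) by blast
      then show ?thesis using finite_measure_Union[of "G \<inter> U" "- G"] ev evU by (metis (no_types, lifting) Compl_disjoint Int_assoc Int_commute inf_bot_right sets.Int)
    qed
    moreover have "\<epsilon> * prob (- G) \<le> \<epsilon> * prob U"
      using \<epsilon> U(1) evU by (intro mult_left_mono finite_measure_mono) auto
    ultimately show ?thesis using small by linarith
  qed
  then have "\<epsilon> * prob (- G) \<le> 0" using field_le_epsilon[of "\<epsilon> * prob (- G)" 0] by simp
  then have "prob (- G) = 0" using \<epsilon> by (simp add: mult_le_0_iff measure_le_0_iff)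
  then show ?thesis using prob_compl[OF ev(1)] by (simp add: space_m Compl_eq_Diff_UNIV)
qed

text \<open>An upper limit of events in diagonal form: the property required at some generation \<open>n \<ge> k\<close> may
  become more restrictive with \<open>k\<close>.\<close>

definition often :: "(nat \<Rightarrow> nat list \<Rightarrow> bool) \<Rightarrow> (real^'n) set" where
  "often \<Phi> = (\<Inter>k. \<Union>n\<in>{k..}. \<Union>w\<in>{w \<in> pos n. \<Phi> k w}. I w)"

lemma often_borel: "often \<Phi> \<in> sets borel"
proof -
  have "(\<Union>w\<in>{w \<in> pos n. \<Phi> k w}. I w) \<in> sets borel" for n k
    by (rule sets.finite_UN) (auto intro: cube_borel pos_words)
  then have "(\<Union>n\<in>{k..}. \<Union>w\<in>{w \<in> pos n. \<Phi> k w}. I w) \<in> sets borel" for k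
    by (intro sets.countable_UN') auto
  then show ?thesis unfolding often_def by (intro sets.countable_INT'') auto
qed

lemma often_obtain:
  assumes "x \<in> often \<Phi>"
  obtains n w where "k \<le> n" "w \<in> pos n" "\<Phi> k w" "x \<in> I w"
proof -
  have "x \<in> (\<Union>n\<in>{k..}. \<Union>w\<in>{w \<in> pos n. \<Phi> k w}. I w)" using assms unfolding often_def by blast
  then show ?thesis using that by blast
qed

text \<open>The events are decreasing in \<open>k\<close>, so their intersection inherits the proportion that each of
  them has in a given cube, and the zero-one law applies.\<close>

lemma often_full:
  assumes mono: "\<And>k w. \<Phi> (Suc k) w \<Longrightarrow> \<Phi> k w" and \<epsilon>: "0 < \<epsilon>"
    and dense: "\<And>n u k. u \<in> pos n \<Longrightarrow>
      \<exists>N\<ge>k. \<exists>T \<subseteq> {w \<in> pos N. \<Phi> k w \<and> I w \<subseteq> I u}. \<epsilon> * p u \<le> (\<Sum>w\<in>T. p w)"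
  shows "prob (often \<Phi>) = 1"
proof (rule full_measure[OF often_borel \<epsilon>])
  fix n u assume u: "u \<in> words n"
  define A where "A k = (\<Union>n\<in>{k..}. \<Union>w\<in>{w \<in> pos n. \<Phi> k w}. I w) \<inter> I u" for k
  have A: "A k \<in> events" for k
    unfolding A_def by (intro sets.Int cube_events[OF u] sets.countable_UN' sets.finite_UN)
      (auto intro: cube_events pos_words)
  have dec: "decseq A"
  proof (rule decseq_SucI)
    fix k
    show "A (Suc k) \<subseteq> A k" unfolding A_def using mono[of k] by fastforce
  qed
  have "\<epsilon> * p u \<le> prob (A k)" for k
  proof (cases "u \<in> pos n")
    case True
    then obtain N T where NT: "k \<le> N" "T \<subseteq> {w \<in> pos N. \<Phi> k w \<and> I w \<subseteq> I u}" "\<epsilon> * p u \<le> (\<Sum>w\<in>T. p w)"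
      using dense by meson
    have "(\<Sum>w\<in>T. p w) = prob (\<Union>w\<in>T. I w)"
      by (rule prob_cubes[symmetric, of T N]) (use NT(2) pos_words in auto)
    also have "\<dots> \<le> prob (A k)"
      by (intro finite_measure_mono A) (use NT(1,2) in \<open>auto simp: A_def\<close>)
    finally show ?thesis using NT(3) by linarith
  next
    case False
    then have "p u = 0" using u by (simp add: pos_def less_le)
    then show ?thesis by simp
  qed
  then have "\<epsilon> * p u \<le> prob (\<Inter>k. A k)"
    by (intro LIMSEQ_le_const[OF finite_Lim_measure_decseq]) (use A dec in auto)
  also have "(\<Inter>k. A k) = often \<Phi> \<inter> I u" by (auto simp: A_def often_def)
  finally show "\<epsilon> * p u \<le> prob (often \<Phi> \<inter> I u)" .
qed

end

section \<open>Singularity with respect to the Hausdorff measure\<close>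

context quasi_bernoulli_cubes
begin

text \<open>Cubes with mass at least \<open>k\<close> times the \<open>s\<close>-th power of the side give coverings with sum
  \<open>O(1 / k)\<close>, since minimal ones are disjoint.\<close>

lemma hausdorff_null_if_heavy:
  assumes "0 \<le> s"
    and heavy: "\<And>x (k::nat) N. x \<in> E \<Longrightarrow>
      \<exists>n\<ge>N. \<exists>w\<in>pos n. x \<in> closure (I w) \<and> real k * l powr (- (real n * s)) \<le> p w"
  shows "hausdorff_measure s E = 0"
proof -
  have "hausdorff_pre s \<eta> E \<le> ennreal e" if eta: "0 < \<eta>" and e: "0 < e" for \<eta> e
  proof -
    define c where "c = real CARD('n) powr s"
    obtain k :: nat where k: "c / e < real k" using reals_Archimedean2 by blast
    have c: "c > 0" by (simp add: c_def)
    then have k0: "real k > 0" using k e by (meson divide_pos_pos less_trans)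
    obtain N where N: "\<And>n. N \<le> n \<Longrightarrow> real CARD('n) / real l ^ n < \<eta>"
      using small_scale[OF eta] by blast
    define Q where "Q = {w \<in> all_words. N \<le> length w \<and> real k * l powr (- (real (length w) * s)) \<le> p w}"
    have "hausdorff_pre s \<eta> E \<le> ennreal (c * (1 / real k) * prob UNIV)"
      unfolding c_def
    proof (rule hausdorff_pre_cover[of Q N s "1 / real k" UNIV])
      show "Q \<subseteq> all_words" by (auto simp: Q_def)
      show "l powr (- (real (length w) * s)) \<le> 1 / real k * p w" if "w \<in> Q" for w
        using that k0 by (simp add: Q_def le_divide_eq mult.commute)
      show "E \<subseteq> (\<Union>w\<in>Q. closure (I w))"
      proof
        fix x assume "x \<in> E"
        then obtain n w where w: "N \<le> n" "w \<in> pos n" "x \<in> closure (I w)"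
          "real k * l powr (- (real n * s)) \<le> p w" using heavy by metis
        have "w \<in> words n" by (rule pos_words[OF w(2)])
        then have "w \<in> Q" using w words_all words_length by (auto simp: Q_def)
        then show "x \<in> (\<Union>w\<in>Q. closure (I w))" using w(3) by blast
      qed
      show "real CARD('n) / real l ^ N \<le> \<eta>" using N[of N] by simp
    qed (auto simp: Q_def assms(1))
    also have "c * (1 / real k) * prob UNIV \<le> c * (1 / real k) * 1"
      using c by (intro mult_left_mono prob_le_1) auto
    also have "\<dots> \<le> e" using k k0 e by (simp add: field_simps)
    finally show ?thesis using ennreal_leI by (meson order.trans)
  qed
  then have "hausdorff_measure s E \<le> ennreal e" if "0 < e" for e
    using that by (intro hausdorff_measure_le)
  then show ?thesis by (metis ennreal_le_epsilon add_0 zero_le le_zero_eq)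
qed

text \<open>This is the substitute for independence: conditioning on a cube changes the law of the
  subsequent letters by at most the factor \<open>C\<close>.\<close>

lemma conditional_mass:
  assumes u: "u \<in> pos n" and T: "T \<subseteq> pos k"
  shows "(@) u ` T \<subseteq> {w \<in> pos (n + k). I w \<subseteq> I u}"
    and "p u * (\<Sum>v\<in>T. p v) \<le> C * (\<Sum>w\<in>(@) u ` T. p w)"
proof -
  have uw: "u \<in> words n" by (rule pos_words[OF u])
  have Tw: "v \<in> words k" if "v \<in> T" for v using T that pos_words by blast
  show "(@) u ` T \<subseteq> {w \<in> pos (n + k). I w \<subseteq> I u}"
    using pos_append_iff[OF uw Tw] cube_append_subset[OF uw Tw] u T by blast
  have "p u * (\<Sum>v\<in>T. p v) = (\<Sum>v\<in>T. p u * p v)" by (rule sum_distrib_left)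
  also have "\<dots> \<le> (\<Sum>v\<in>T. C * p (u @ v))" by (intro sum_mono quasi[OF uw Tw])
  also have "\<dots> = C * (\<Sum>w\<in>(@) u ` T. p w)"
    by (simp add: sum_distrib_left sum.reindex inj_on_def)
  finally show "p u * (\<Sum>v\<in>T. p v) \<le> C * (\<Sum>w\<in>(@) u ` T. p w)" .
qed

definition crowd :: "nat list \<Rightarrow> real" where "crowd w = (\<Sum>v\<in>neighbours w. p v)"

lemma crowd_total: "(\<Sum>w\<in>words n. crowd w) \<le> 3 ^ CARD('n)"
proof -
  have nb: "neighbours w = {v \<in> words n. v \<in> neighbours w}" if "w \<in> words n" for w
    using neighbours_words[OF that] by blast
  have "(\<Sum>w\<in>words n. crowd w) = (\<Sum>w\<in>words n. \<Sum>v | v \<in> words n \<and> v \<in> neighbours w. p v)"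
    unfolding crowd_def using nb by (intro sum.cong) auto
  also have "\<dots> = (\<Sum>v\<in>words n. \<Sum>w | w \<in> words n \<and> v \<in> neighbours w. p v)"
    by (rule sum.swap_restrict) simp_all
  also have "\<dots> = (\<Sum>v\<in>words n. \<Sum>w\<in>neighbours v. p v)"
  proof (rule sum.cong[OF refl])
    fix v assume v: "v \<in> words n"
    have "{w. w \<in> words n \<and> v \<in> neighbours w} = neighbours v"
      using neighbours_sym[OF v] neighbours_words[OF v] by blast
    then show "(\<Sum>w | w \<in> words n \<and> v \<in> neighbours w. p v) = (\<Sum>w\<in>neighbours v. p v)" by simp
  qed
  also have "\<dots> = (\<Sum>v\<in>words n. real (card (neighbours v)) * p v)" by simp
  also have "\<dots> \<le> (\<Sum>v\<in>words n. 3 ^ CARD('n) * p v)"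
  proof (intro sum_mono mult_right_mono)
    fix v assume "v \<in> words n"
    from card_neighbours[OF this] show "real (card (neighbours v)) \<le> 3 ^ CARD('n)"
      by (metis of_nat_le_iff of_nat_numeral of_nat_power)
  qed simp
  also have "\<dots> = 3 ^ CARD('n)" by (simp add: sum_distrib_left[symmetric] sum_words)
  finally show ?thesis .
qed

text \<open>A cube may have much heavier neighbours, and its position in the parent cube is arbitrary, so
  that points near its boundary cannot be avoided by choosing letters. Markov's inequality shows that
  nevertheless most of the mass sits in cubes that are not much lighter than their neighbours.\<close>

lemma crowded_mass:
  assumes "0 < \<kappa>"
  shows "(\<Sum>w\<in>{w \<in> words n. \<kappa> * p w < crowd w}. p w) \<le> 3 ^ CARD('n) / \<kappa>"
proof -
  have nonneg: "0 \<le> crowd w" for w unfolding crowd_def by (intro sum_nonneg) simp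
  have "\<kappa> * (\<Sum>w\<in>{w \<in> words n. \<kappa> * p w < crowd w}. p w) \<le> (\<Sum>w\<in>{w \<in> words n. \<kappa> * p w < crowd w}. crowd w)"
    unfolding sum_distrib_left by (intro sum_mono) auto
  also have "\<dots> \<le> (\<Sum>w\<in>words n. crowd w)" by (intro sum_mono2) (auto simp: nonneg)
  also have "\<dots> \<le> 3 ^ CARD('n)" by (rule crowd_total)
  finally show ?thesis using assms by (simp add: le_divide_eq mult.commute)
qed

lemma ball_mass:
  assumes w: "w \<in> words n" "x \<in> I w"
  shows "prob (cball x (1 / real l ^ n)) \<le> crowd w"
proof -
  have nb: "neighbours w \<subseteq> words n" using neighbours_words[OF w(1)] by blast
  have "AE y in m. y \<in> unit_cube" by (rule AE_prob_1[OF prob_unit_cube])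
  then have "AE y in m. y \<in> cball x (1 / real l ^ n) \<longrightarrow> y \<in> (\<Union>v\<in>neighbours w. I v)"
  proof eventually_elim
    case (elim y)
    show ?case
    proof
      assume y: "y \<in> cball x (1 / real l ^ n)"
      obtain v where v: "v \<in> words n" "y \<in> I v" using cube_ex[OF elim] by blast
      have "dist x y \<le> 1 / real l ^ n" using y by simp
      then have "v \<in> neighbours w"
        unfolding neighbours_def words_length[OF w(1)] using v w(2) by blast
      then show "y \<in> (\<Union>v\<in>neighbours w. I v)" using v(2) by blast
    qed
  qed
  then have "prob (cball x (1 / real l ^ n)) \<le> prob (\<Union>v\<in>neighbours w. I v)"
    by (rule finite_measure_mono_AE) (use nb cube_events in auto)
  also have "\<dots> = crowd w" unfolding crowd_def by (rule prob_cubes[OF nb])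
  finally show ?thesis .
qed

end

context quasi_bernoulli_dim
begin

text \<open>Inside the cube of \<open>u\<close> the ratio is at least \<open>R u / C\<close> times the ratio of the remaining word,
  which exceeds any constant with a probability that does not depend on \<open>u\<close>.\<close>

lemma heavy_often:
  assumes lead: "((\<lambda>t. \<psi> t / t ^ j) \<longlongrightarrow> b) (at 0)" "b \<noteq> 0"
  shows "prob (often (\<lambda>k w. real k \<le> R w)) = 1"
proof -
  obtain \<epsilon> where \<epsilon>: "\<epsilon> > 0"
    "\<And>K. \<forall>\<^sub>F n in sequentially. \<epsilon> \<le> (\<Sum>w\<in>{w\<in>pos n. K \<le> R w powr 1}. p w)"
    using fluctuation[OF _ lead, of 1] by blast
  show ?thesis
  proof (rule often_full)
    show "0 < \<epsilon> / C" using \<epsilon>(1) by simp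
    show "real k \<le> R w" if "real (Suc k) \<le> R w" for k w using that by simp
    fix n u k assume u: "u \<in> pos n"
    have Ru: "0 < R u" by (rule R_pos[OF u])
    have uw: "u \<in> words n" by (rule pos_words[OF u])
    obtain k' where k': "k \<le> k'"
      "\<epsilon> \<le> (\<Sum>w\<in>{w\<in>pos k'. real k * C / R u \<le> R w powr 1}. p w)"
      using \<epsilon>(2)[of "real k * C / R u"] unfolding eventually_sequentially by (meson nat_le_linear order.trans)
    define T where "T = {w\<in>pos k'. real k * C / R u \<le> R w powr 1}"
    have T: "T \<subseteq> pos k'" by (auto simp: T_def)
    have "(@) u ` T \<subseteq> {w \<in> pos (n + k'). real k \<le> R w \<and> I w \<subseteq> I u}"
    proof
      fix w assume w: "w \<in> (@) u ` T"
      then obtain v where v: "v \<in> T" "w = u @ v" by blast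
      then have vT: "v \<in> pos k'" and "real k * C / R u \<le> R v powr 1" by (auto simp: T_def)
      then have "real k * C \<le> R u * R v"
        using R_pos[OF vT] Ru by (simp add: divide_le_eq mult.commute)
      then have "C * real k \<le> C * R w"
        using R_quasi(1)[OF uw pos_words[OF vT]] unfolding v(2) by (metis mult.commute order.trans)
      then have "real k \<le> R w" by simp
      then show "w \<in> {w \<in> pos (n + k'). real k \<le> R w \<and> I w \<subseteq> I u}"
        using conditional_mass(1)[OF u T] w by blast
    qed
    moreover have "\<epsilon> / C * p u \<le> (\<Sum>w\<in>(@) u ` T. p w)"
    proof -
      have "\<epsilon> * p u \<le> (\<Sum>v\<in>T. p v) * p u" using k'(2) unfolding T_def by (intro mult_right_mono) simp_all
      then have "\<epsilon> * p u \<le> C * (\<Sum>w\<in>(@) u ` T. p w)"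
        using conditional_mass(2)[OF u T] by (simp add: mult.commute)
      then show ?thesis by (simp add: divide_le_eq mult.commute)
    qed
    moreover have "k \<le> n + k'" using k'(1) by simp
    ultimately show "\<exists>N\<ge>k. \<exists>T\<subseteq>{w \<in> pos N. real k \<le> R w \<and> I w \<subseteq> I u}. \<epsilon> / C * p u \<le> (\<Sum>w\<in>T. p w)"
      by blast
  qed
qed

text \<open>The constant \<open>\<kappa>\<close> may depend on the cube in which one works: \<open>\<kappa>\<close> is chosen so large that
  the cubes with a neighbourhood \<open>\<kappa>\<close> times heavier than themselves carry at most half of the mass
  guaranteed for the light cubes in it, where light means that the ratio is at most
  \<open>1 / (k * \<kappa>)\<close>.\<close>

lemma light_often:
  assumes lead: "((\<lambda>t. \<psi> t / t ^ j) \<longlongrightarrow> b) (at 0)" "b \<noteq> 0"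
  shows "prob (often (\<lambda>k w. real k * (crowd w * l powr (real (length w) * d)) \<le> 1)) = 1"
proof -
  obtain \<epsilon> where \<epsilon>: "\<epsilon> > 0"
    "\<And>K. \<forall>\<^sub>F n in sequentially. \<epsilon> \<le> (\<Sum>w\<in>{w\<in>pos n. K \<le> R w powr - 1}. p w)"
    using fluctuation[OF _ lead, of "- 1"] by blast
  have crowd_nonneg: "0 \<le> crowd w" for w unfolding crowd_def by (intro sum_nonneg) simp
  let ?\<Phi> = "\<lambda>k w. real k * (crowd w * l powr (real (length w) * d)) \<le> 1"
  show ?thesis
  proof (rule often_full)
    show "0 < \<epsilon> / (2 * C)" using \<epsilon>(1) by simp
    show "?\<Phi> k w" if "?\<Phi> (Suc k) w" for k w
    proof -
      have "real k * (crowd w * l powr (real (length w) * d)) \<le> real (Suc k) * (crowd w * l powr (real (length w) * d))"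
        by (intro mult_right_mono mult_nonneg_nonneg crowd_nonneg) auto
      then show ?thesis using that by linarith
    qed
    fix n u k assume u: "u \<in> pos n"
    have Ru: "0 < R u" by (rule R_pos[OF u])
    have pu: "0 < p u" by (rule pos_p[OF u])
    have uw: "u \<in> words n" by (rule pos_words[OF u])
    define \<kappa> where "\<kappa> = 2 * C * 3 ^ CARD('n) / (\<epsilon> * p u)"
    have \<kappa>: "0 < \<kappa>" unfolding \<kappa>_def using \<epsilon>(1) pu by simp
    define K where "K = real k * \<kappa> * C * R u"
    obtain k' where k': "k \<le> k'" "\<epsilon> \<le> (\<Sum>w\<in>{w\<in>pos k'. K \<le> R w powr - 1}. p w)"
      using \<epsilon>(2)[of K] unfolding eventually_sequentially by (meson nat_le_linear order.trans)
    define T where "T = {w\<in>pos k'. K \<le> R w powr - 1}"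
    have T: "T \<subseteq> pos k'" "finite T" by (auto simp: T_def)
    define B where "B = {w \<in> words (n + k'). \<kappa> * p w < crowd w}"
    have B: "finite B" by (simp add: B_def)
    have "(@) u ` T - B \<subseteq> {w \<in> pos (n + k'). ?\<Phi> k w \<and> I w \<subseteq> I u}"
    proof
      fix w assume w: "w \<in> (@) u ` T - B"
      then obtain v where v: "v \<in> T" "w = u @ v" by blast
      then have vT: "v \<in> pos k'" "K \<le> R v powr - 1" by (auto simp: T_def)
      have Rv: "0 < R v" by (rule R_pos[OF vT(1)])
      have KR: "K * R v \<le> 1" using vT(2) Rv by (simp add: powr_minus_divide le_divide_eq)
      have wpos: "w \<in> pos (n + k')" "I w \<subseteq> I u" using conditional_mass(1)[OF u T(1)] w by blast+
      then have "crowd w \<le> \<kappa> * p w" using w pos_words by (force simp: B_def)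
      then have "crowd w * l powr (real (length w) * d) \<le> \<kappa> * p w * l powr (real (length w) * d)"
        by (intro mult_right_mono) auto
      then have "crowd w * l powr (real (length w) * d) \<le> \<kappa> * R w" by (simp only: R_def mult.assoc)
      also have "\<dots> \<le> \<kappa> * (C * (R u * R v))"
        unfolding v(2) using \<kappa> by (intro mult_left_mono R_quasi(2)[OF uw pos_words[OF vT(1)]]) simp
      finally have "real k * (crowd w * l powr (real (length w) * d)) \<le> real k * (\<kappa> * (C * (R u * R v)))"
        by (intro mult_left_mono) auto
      also have "\<dots> = K * R v" by (simp add: K_def mult_ac)
      finally have "?\<Phi> k w" using KR by linarith
      then show "w \<in> {w \<in> pos (n + k'). ?\<Phi> k w \<and> I w \<subseteq> I u}" using wpos by blast
    qed
    moreover have "\<epsilon> / (2 * C) * p u \<le> (\<Sum>w\<in>(@) u ` T - B. p w)"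
    proof -
      have "\<epsilon> * p u \<le> (\<Sum>v\<in>T. p v) * p u" using k'(2) unfolding T_def by (intro mult_right_mono) simp_all
      then have "\<epsilon> * p u \<le> C * (\<Sum>w\<in>(@) u ` T. p w)"
        using conditional_mass(2)[OF u T(1)] by (simp add: mult.commute)
      then have 1: "\<epsilon> * p u / C \<le> (\<Sum>w\<in>(@) u ` T. p w)" by (simp add: divide_le_eq mult.commute)
      have "(\<Sum>w\<in>(@) u ` T. p w) = (\<Sum>w\<in>(@) u ` T - B. p w) + (\<Sum>w\<in>(@) u ` T \<inter> B. p w)"
        using T(2) by (subst sum.Int_Diff[of _ _ B]) auto
      also have "(\<Sum>w\<in>(@) u ` T \<inter> B. p w) \<le> (\<Sum>w\<in>B. p w)"
        using B by (intro sum_mono2) auto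
      also have "(\<Sum>w\<in>B. p w) \<le> 3 ^ CARD('n) / \<kappa>" unfolding B_def by (rule crowded_mass[OF \<kappa>])
      also have "3 ^ CARD('n) / \<kappa> = \<epsilon> * p u / (2 * C)"
        unfolding \<kappa>_def using \<epsilon>(1) pu by simp
      finally have "\<epsilon> * p u / C - \<epsilon> * p u / (2 * C) \<le> (\<Sum>w\<in>(@) u ` T - B. p w)"
        using 1 by linarith
      moreover have "\<epsilon> * p u / C - \<epsilon> * p u / (2 * C) = \<epsilon> / (2 * C) * p u" by (simp add: field_simps)
      ultimately show ?thesis by simp
    qed
    moreover have "k \<le> n + k'" using k'(1) by simp
    ultimately show "\<exists>N\<ge>k. \<exists>T\<subseteq>{w \<in> pos N. ?\<Phi> k w \<and> I w \<subseteq> I u}. \<epsilon> / (2 * C) * p u \<le> (\<Sum>w\<in>T. p w)"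
      by blast
  qed
qed

lemma heavy_often_null: "hausdorff_measure d (often (\<lambda>k w. real k \<le> R w)) = 0"
proof (rule hausdorff_null_if_heavy[OF d_nonneg])
  fix x k N assume "x \<in> often (\<lambda>k w. real k \<le> R w)"
  then obtain n w where w: "max N k \<le> n" "w \<in> pos n" "real (max N k) \<le> R w" "x \<in> I w"
    by (rule often_obtain)
  have len: "length w = n" by (rule words_length[OF pos_words[OF w(2)]])
  have "real k \<le> p w * l powr (real n * d)" using w(3) unfolding R_def len by simp
  then have "real k * l powr (- (real n * d)) \<le> p w" by (simp add: powr_minus_divide divide_le_eq)
  moreover have "x \<in> closure (I w)" using w(4) closure_subset by blast
  ultimately show "\<exists>n\<ge>N. \<exists>w\<in>pos n. x \<in> closure (I w) \<and> real k * l powr (- (real n * d)) \<le> p w"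
    using w(1,2) by auto
qed

lemma singular:
  assumes lead: "((\<lambda>t. \<psi> t / t ^ j) \<longlongrightarrow> b) (at 0)" "b \<noteq> 0"
  shows "singular_hausdorff d m"
  unfolding singular_hausdorff_def
  using often_borel heavy_often[OF lead] heavy_often_null by (auto simp: emeasure_eq_measure)

end

section \<open>Absolute continuity with respect to the packing measure\<close>

lemma emeasure_UN_le_if_finite_sums_le:
  assumes C: "countable C" and X: "\<And>x. x \<in> C \<Longrightarrow> X x \<in> sets M"
    and B: "\<And>F. finite F \<Longrightarrow> F \<subseteq> C \<Longrightarrow> (\<Sum>x\<in>F. emeasure M (X x)) \<le> B"
  shows "emeasure M (\<Union>x\<in>C. X x) \<le> B"
proof (cases "C = {}")
  case False
  define A where "A n = (\<Union>x\<in>from_nat_into C ` {..n}. X x)" for n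
  have in_C: "from_nat_into C n \<in> C" for n using from_nat_into[OF False] .
  have A: "range A \<subseteq> sets M" unfolding A_def using X in_C by (auto intro!: sets.finite_UN)
  have "incseq A" unfolding A_def incseq_def by fastforce
  have "(\<Union>x\<in>C. X x) = (\<Union>n. A n)"
  proof (intro equalityI subsetI)
    fix y assume "y \<in> (\<Union>x\<in>C. X x)"
    then obtain x where x: "x \<in> C" "y \<in> X x" by blast
    obtain n where "from_nat_into C n = x" using from_nat_into_surj[OF C x(1)] by blast
    then have "y \<in> A n" using x(2) by (auto simp: A_def)
    then show "y \<in> (\<Union>n. A n)" by blast
  next
    fix y assume "y \<in> (\<Union>n. A n)"
    then show "y \<in> (\<Union>x\<in>C. X x)" using in_C by (auto simp: A_def)
  qed
  then have "emeasure M (\<Union>x\<in>C. X x) = (SUP n. emeasure M (A n))"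
    using SUP_emeasure_incseq[OF A \<open>incseq A\<close>] by simp
  also have "\<dots> \<le> B"
  proof (rule SUP_least)
    fix n
    define T where "T = from_nat_into C ` {..n}"
    have T: "finite T" "T \<subseteq> C" unfolding T_def using in_C by auto
    have "emeasure M (A n) \<le> (\<Sum>x\<in>T. emeasure M (X x))"
      unfolding A_def T_def[symmetric]
      by (rule emeasure_subadditive_finite[OF T(1)]) (use X T(2) in blast)
    also have "\<dots> \<le> B" by (rule B[OF T])
    finally show "emeasure M (A n) \<le> B" .
  qed
  finally show ?thesis .
qed simp

text \<open>By the covering lemma of Vitali a disjoint subfamily of the small balls is a packing, while the
  balls enlarged five times cover the set; only the mass of the enlarged balls enters.\<close>

lemma emeasure_le_packing_pre:
  fixes A F :: "'a::euclidean_space set"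
  assumes sets: "sets M = sets borel" and "A \<subseteq> F" and s: "0 \<le> s" and e: "0 < e"
    and fin: "packing_pre s F < \<infinity>"
    and light: "\<And>x \<eta>. x \<in> A \<Longrightarrow> 0 < \<eta> \<Longrightarrow> \<exists>r>0. r \<le> \<eta> \<and> emeasure M (cball x (5 * r)) \<le> ennreal ((5 * r) powr s)"
  obtains V where "A \<subseteq> V" "V \<in> sets borel"
    "emeasure M V \<le> ennreal ((5 / 2) powr s) * (packing_pre s F + ennreal e)"
proof -
  have "packing_pre s F < packing_pre s F + ennreal e"
    using fin e by (cases "packing_pre s F") (auto simp: ennreal_less_iff simp flip: ennreal_plus)
  then obtain \<eta> where \<eta>: "0 < \<eta>"
    "(SUP \<B>\<in>packings \<eta> F. \<Sum>\<^sub>\<infinity>B\<in>\<B>. ennreal (diameter B powr s)) < packing_pre s F + ennreal e"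
    unfolding packing_pre_def[of s F] INF_less_iff by auto
  obtain r where r: "\<And>x. x \<in> A \<Longrightarrow> 0 < r x" "\<And>x. x \<in> A \<Longrightarrow> r x \<le> \<eta> / 2"
    "\<And>x. x \<in> A \<Longrightarrow> emeasure M (cball x (5 * r x)) \<le> ennreal ((5 * r x) powr s)"
    using light[of _ "\<eta> / 2"] \<eta>(1) half_gt_zero by metis
  have "A \<subseteq> (\<Union>x\<in>A. cball x (r x))"
  proof
    fix x assume "x \<in> A"
    then have "x \<in> cball x (r x)" using r(1)[of x] by simp
    then show "x \<in> (\<Union>x\<in>A. cball x (r x))" using \<open>x \<in> A\<close> by blast
  qed
  then obtain P where P: "countable P" "P \<subseteq> A"
    "pairwise (\<lambda>x y. disjnt (cball x (r x)) (cball y (r y))) P" "A \<subseteq> (\<Union>x\<in>P. cball x (5 * r x))"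
    by (rule Vitali_covering_lemma_cballs[where a = "\<lambda>x. x" and r = r and B = "\<eta> / 2"]) (use r in auto)
  let ?b = "\<lambda>x. cball x (r x)"
  have inj: "inj_on ?b P"
  proof (rule inj_onI, rule ccontr)
    fix x y assume xy: "x \<in> P" "y \<in> P" "?b x = ?b y" "x \<noteq> y"
    have "disjnt (?b x) (?b y)" by (rule pairwiseD[OF P(3) xy(1,2,4)])
    then have "?b x = {}" using xy(3) by (simp add: disjnt_def)
    then show False using r(1)[of x] xy(1) P(2) by auto
  qed
  have pack: "?b ` P \<in> packings \<eta> F"
    unfolding packings_def
  proof (intro CollectI conjI ballI)
    show "countable (?b ` P)" using P(1) by simp
    show "disjoint (?b ` P)"
      using P(3) by (auto simp: pairwise_def)
    fix B assume "B \<in> ?b ` P"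
    then obtain x where x: "x \<in> P" "B = ?b x" by blast
    then have "x \<in> A" using P(2) by blast
    then show "\<exists>x\<in>F. \<exists>r. B = cball x r" "0 < diameter B" "diameter B \<le> \<eta>"
      using x assms(2) r[of x] by auto
  qed
  define V where "V = (\<Union>x\<in>P. cball x (5 * r x))"
  have "emeasure M V \<le> ennreal ((5 / 2) powr s) * (packing_pre s F + ennreal e)"
    unfolding V_def
  proof (rule emeasure_UN_le_if_finite_sums_le[OF P(1)])
    show "cball x (5 * r x) \<in> sets M" for x by (simp add: sets)
    fix G assume G: "finite G" "G \<subseteq> P"
    have "(\<Sum>x\<in>G. emeasure M (cball x (5 * r x))) \<le> (\<Sum>x\<in>G. ennreal ((5 / 2) powr s) * ennreal (diameter (?b x) powr s))"
    proof (rule sum_mono)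
      fix x assume "x \<in> G"
      then have x: "x \<in> A" using G P by blast
      have "emeasure M (cball x (5 * r x)) \<le> ennreal ((5 * r x) powr s)" by (rule r(3)[OF x])
      also have "(5 * r x) powr s = (5 / 2 * (2 * r x)) powr s" by simp
      also have "\<dots> = (5 / 2) powr s * (2 * r x) powr s" by (rule powr_mult)
      also have "2 * r x = diameter (?b x)" using r(1)[OF x] by simp
      finally show "emeasure M (cball x (5 * r x)) \<le> ennreal ((5 / 2) powr s) * ennreal (diameter (?b x) powr s)"
        by (simp only: ennreal_mult'' powr_ge_zero)
    qed
    also have "\<dots> = ennreal ((5 / 2) powr s) * (\<Sum>B\<in>?b ` G. ennreal (diameter B powr s))"
      using inj_on_subset[OF inj G(2)] by (simp only: sum_distrib_left sum.reindex comp_def)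
    also have "\<dots> \<le> ennreal ((5 / 2) powr s) * (packing_pre s F + ennreal e)"
    proof (rule mult_left_mono)
      have "(\<Sum>B\<in>?b ` G. ennreal (diameter B powr s)) \<le> (\<Sum>\<^sub>\<infinity>B\<in>?b ` P. ennreal (diameter B powr s))"
        by (subst nonneg_infsum_complete) (use G in \<open>auto intro!: SUP_upper\<close>)
      also have "\<dots> \<le> (SUP \<B>\<in>packings \<eta> F. \<Sum>\<^sub>\<infinity>B\<in>\<B>. ennreal (diameter B powr s))"
        by (rule SUP_upper[OF pack])
      also have "\<dots> \<le> packing_pre s F + ennreal e" using \<eta>(2) by (rule less_imp_le)
      finally show "(\<Sum>B\<in>?b ` G. ennreal (diameter B powr s)) \<le> packing_pre s F + ennreal e" .
    qed simp
    finally show "(\<Sum>x\<in>G. emeasure M (cball x (5 * r x))) \<le> ennreal ((5 / 2) powr s) * (packing_pre s F + ennreal e)" .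
  qed
  moreover have "V \<in> sets borel" unfolding V_def using P(1) by (intro sets.countable_UN') auto
  ultimately show ?thesis using that P(4) by (simp add: V_def)
qed

lemma abs_continuous_if_light:
  fixes M :: "(real^'n) measure"
  assumes sets: "sets M = sets borel" and G: "G \<in> sets borel" "AE x in M. x \<in> G" and s: "0 \<le> s"
    and light: "\<And>x \<eta>. x \<in> G \<Longrightarrow> 0 < \<eta> \<Longrightarrow> \<exists>r>0. r \<le> \<eta> \<and> emeasure M (cball x (5 * r)) \<le> ennreal ((5 * r) powr s)"
  shows "abs_continuous_packing s M"
  unfolding abs_continuous_packing_def
proof (intro ballI impI)
  fix E :: "(real^'n) set" assume E: "E \<in> sets borel" "packing_measure s E = 0"
  have "emeasure M E \<le> ennreal e" if "0 < e" for e
  proof -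
    define c where "c = (5 / 2 :: real) powr s"
    have c: "0 < c" by (simp add: c_def)
    define e' where "e' = e / (2 * c)"
    have e': "0 < e'" using that c by (simp add: e'_def)
    have "packing_measure s E < ennreal e'" using E(2) e' by simp
    then obtain F where F: "E \<subseteq> (\<Union>i. F i)" "(\<Sum>i. packing_pre s (F i)) < ennreal e'"
      unfolding packing_measure_def INF_less_iff by blast
    have fin: "packing_pre s (F i) < \<infinity>" for i
    proof -
      have "packing_pre s (F i) \<le> (\<Sum>i. packing_pre s (F i))"
        using sum_le_suminf[of "\<lambda>i. packing_pre s (F i)" "{i}"] by simp
      also have "\<dots> < ennreal e'" by (rule F(2))
      finally show ?thesis using ennreal_less_top less_trans infinity_ennreal_def by metis
    qed
    have "\<exists>V. F i \<inter> G \<subseteq> V \<and> V \<in> sets borel \<and>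
        emeasure M V \<le> ennreal c * (packing_pre s (F i) + ennreal (e' * (1/2) ^ Suc i))" for i
    proof -
      have "0 < e' * (1/2) ^ Suc i" using e' by simp
      from emeasure_le_packing_pre[OF sets _ s this fin[of i], of "F i \<inter> G"] light
      show ?thesis unfolding c_def by (metis IntD2 Int_lower1)
    qed
    then obtain V where V: "\<And>i. F i \<inter> G \<subseteq> V i" "\<And>i. V i \<in> sets borel"
      "\<And>i. emeasure M (V i) \<le> ennreal c * (packing_pre s (F i) + ennreal (e' * (1/2) ^ Suc i))"
      by metis
    have "emeasure M E \<le> emeasure M (\<Union>i. V i)"
    proof (rule emeasure_mono_AE)
      show "AE x in M. x \<in> E \<longrightarrow> x \<in> (\<Union>i. V i)"
        using G(2)
      proof eventually_elim
        case (elim x)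
        show ?case
        proof
          assume "x \<in> E"
          then obtain i where "x \<in> F i" using F(1) by blast
          then have "x \<in> V i" using V(1)[of i] elim by blast
          then show "x \<in> (\<Union>i. V i)" by blast
        qed
      qed
      show "(\<Union>i. V i) \<in> sets M" using V(2) by (simp add: sets)
    qed
    also have "\<dots> \<le> (\<Sum>i. emeasure M (V i))"
      by (rule emeasure_subadditive_countably) (use V(2) sets in auto)
    also have "\<dots> \<le> (\<Sum>i. ennreal c * (packing_pre s (F i) + ennreal (e' * (1/2) ^ Suc i)))"
      by (intro suminf_le V(3)) auto
    also have "\<dots> = ennreal c * ((\<Sum>i. packing_pre s (F i)) + (\<Sum>i. ennreal (e' * (1/2) ^ Suc i)))"
      by (simp add: suminf_add[symmetric])
    also have "\<dots> \<le> ennreal c * (ennreal e' + ennreal e')"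
      using F(2) e' by (intro mult_left_mono add_mono) (simp_all only: suminf_geometric_ennreal less_imp_le order.refl zero_le)
    also have "\<dots> = ennreal e"
      using c e' by (simp add: e'_def ennreal_mult[symmetric] flip: ennreal_plus)
    finally show ?thesis .
  qed
  then show "emeasure M E = 0" by (metis ennreal_le_epsilon add_0 zero_le le_zero_eq)
qed

context quasi_bernoulli_dim
begin

lemma abs_continuous:
  assumes lead: "((\<lambda>t. \<psi> t / t ^ j) \<longlongrightarrow> b) (at 0)" "b \<noteq> 0"
  shows "abs_continuous_packing d m"
proof (rule abs_continuous_if_light[OF sets_m often_borel _ d_nonneg])
  let ?\<Phi> = "\<lambda>k w. real k * (crowd w * l powr (real (length w) * d)) \<le> 1"
  show "AE x in m. x \<in> often ?\<Phi>" by (rule AE_prob_1[OF light_often[OF lead]])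
  fix x and \<eta> :: real assume x: "x \<in> often ?\<Phi>" and \<eta>: "0 < \<eta>"
  obtain N where N: "\<And>n. N \<le> n \<Longrightarrow> real CARD('n) / real l ^ n < \<eta>" using small_scale[OF \<eta>] by blast
  obtain n w where w: "Suc N \<le> n" "w \<in> pos n" "?\<Phi> (Suc N) w" "x \<in> I w" by (rule often_obtain[OF x])
  have ww: "w \<in> words n" "length w = n" using pos_words[OF w(2)] words_length by auto
  \<comment> \<open>After enlargement by the factor \<open>5\<close> of the covering lemma the radius is the side of the cube.\<close>
  define r where "r = 1 / (5 * real l ^ n)"
  have r: "0 < r" "5 * r = 1 / real l ^ n" by (simp_all add: r_def)
  have "1 \<le> real CARD('n)" by (simp add: Suc_leI)
  then have "1 / real l ^ n \<le> real CARD('n) / real l ^ n" by (intro divide_right_mono) auto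
  then have "r \<le> \<eta>" using N[of n] w(1) r by simp
  moreover have "emeasure m (cball x (5 * r)) \<le> ennreal ((5 * r) powr d)"
  proof -
    have "0 \<le> crowd w" unfolding crowd_def by (intro sum_nonneg) simp
    then have "1 * (crowd w * l powr (real n * d)) \<le> real (Suc N) * (crowd w * l powr (real n * d))"
      by (intro mult_right_mono) auto
    then have "crowd w * l powr (real n * d) \<le> 1" using w(3) ww(2) by simp
    then have "crowd w \<le> l powr (- (real n * d))" by (simp add: powr_minus_divide le_divide_eq)
    also have "\<dots> = (5 * r) powr d"
    proof -
      have "(real l ^ n) powr d = l powr (real n * d)"
        using powr_powr[of "real l" "real n" d] by (simp add: powr_realpow)
      then show ?thesis unfolding r(2) by (simp add: powr_divide powr_minus_divide)
    qed
    finally show ?thesis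
      using ball_mass[OF ww(1) w(4)] unfolding r(2) by (simp add: emeasure_eq_measure)
  qed
  ultimately show "\<exists>r>0. r \<le> \<eta> \<and> emeasure m (cball x (5 * r)) \<le> ennreal ((5 * r) powr d)"
    using r(1) by blast
qed

end

section \<open>Lower bounds for Hausdorff measures\<close>

context quasi_bernoulli_cubes
begin

text \<open>A covering set is compared with cubes of the generation whose side length just exceeds its
  diameter. Sets of diameter \<open>0\<close> may be compared with arbitrarily small cubes, which accounts for
  the error term.\<close>

lemma scale_selection:
  assumes U: "bounded U" "U \<noteq> {}" and N: "diameter U < 1 / real l ^ N" and s: "0 \<le> s" and e: "0 < e"
  obtains n where "N \<le> n" "diameter U < 1 / real l ^ n"
    "ennreal (l powr (- (real n * s))) \<le> ennreal (l powr s) * diam_pow s U + ennreal e"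
proof (cases "diameter U = 0")
  case True
  show ?thesis
  proof (cases "s = 0")
    case True
    then show ?thesis using that[of N] N U(2) by (simp add: diam_pow_def)
  next
    case False
    then have "1 < l powr s" using s l_pos(3) by (intro gr_one_powr) auto
    then obtain k where k: "1 / e < (l powr s) ^ k" using real_arch_pow by blast
    let ?n = "max N k"
    have "(l powr s) ^ k \<le> (l powr s) ^ ?n" using \<open>1 < l powr s\<close> by (intro power_increasing) auto
    then have "1 / e < (l powr s) ^ ?n" using k by linarith
    then have "1 / (l powr s) ^ ?n \<le> e" using e by (simp add: field_simps)
    moreover have "l powr (- (real ?n * s)) = 1 / (l powr s) ^ ?n"
      by (simp add: powr_minus_divide powr_power)
    ultimately have "ennreal (l powr (- (real ?n * s))) \<le> 0 + ennreal e"
      by (simp add: ennreal_leI)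
    also have "\<dots> \<le> ennreal (l powr s) * diam_pow s U + ennreal e" by (intro add_mono) auto
    finally show ?thesis using that[of ?n] True by simp
  qed
next
  case False
  then have dpos: "0 < diameter U" using diameter_ge_0[OF U(1)] by simp
  obtain k0 where "1 / diameter U < real l ^ k0" using real_arch_pow[OF l_pos(3)] by blast
  then have ex: "\<not> diameter U < 1 / real l ^ k0" using dpos lpow_pos[of k0] by (simp add: field_simps)
  define k where "k = (LEAST k. \<not> diameter U < 1 / real l ^ k)"
  have k: "\<not> diameter U < 1 / real l ^ k" unfolding k_def by (rule LeastI[of _ k0]) (rule ex)
  have below: "diameter U < 1 / real l ^ j" if "j < k" for j
    using not_less_Least[of j "\<lambda>k. \<not> diameter U < 1 / real l ^ k"] that by (simp add: k_def)
  have "N < k"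
  proof (rule ccontr)
    assume "\<not> N < k"
    then have "real l ^ k \<le> real l ^ N" using l_pos(3) by (intro power_increasing) auto
    then have "1 / real l ^ N \<le> 1 / real l ^ k" by (intro divide_left_mono) auto
    then show False using N k by linarith
  qed
  then obtain n where n: "k = Suc n" "N \<le> n" by (cases k) auto
  have "l powr (- (real n * s)) = l powr s * l powr (- (real (Suc n) * s))"
    by (simp add: powr_add[symmetric] algebra_simps)
  also have "l powr (- (real (Suc n) * s)) = (1 / real l ^ Suc n) powr s"
  proof -
    have "(real l ^ Suc n) powr s = l powr (real (Suc n) * s)"
      using powr_powr[of "real l" "real (Suc n)" s] by (simp only: powr_realpow l_pos)
    then show ?thesis by (simp add: powr_divide powr_minus_divide)
  qed
  also have "(1 / real l ^ Suc n) powr s \<le> diameter U powr s"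
    using k s unfolding n(1) by (intro powr_mono2) auto
  finally have "l powr (- (real n * s)) \<le> l powr s * diameter U powr s" by (simp add: mult_left_mono)
  then have "ennreal (l powr (- (real n * s))) \<le> ennreal (l powr s) * ennreal (diameter U powr s)"
    by (simp add: ennreal_leI flip: ennreal_mult)
  also have "ennreal (diameter U powr s) = diam_pow s U" using U(2) dpos by (simp add: diam_pow_def)
  also have "ennreal (l powr s) * diam_pow s U \<le> ennreal (l powr s) * diam_pow s U + ennreal e" by simp
  finally show ?thesis using that[of n] n(2) below[of n] n(1) by simp
qed

text \<open>The mass distribution principle: a covering set meets at most \<open>3 ^ D\<close> cubes of the generation
  selected for it, all of which are light.\<close>

lemma mass_distribution:
  assumes F: "F \<subseteq> unit_cube" and s: "0 \<le> s" and K: "0 < K"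
    and light: "\<And>n w. N \<le> n \<Longrightarrow> w \<in> words n \<Longrightarrow> I w \<inter> F \<noteq> {} \<Longrightarrow> p w \<le> K * l powr (- (real n * s))"
  shows "emeasure m F \<le> ennreal (3 ^ CARD('n) * K * l powr s) * hausdorff_measure s F"
proof (cases "hausdorff_measure s F = \<infinity>")
  case True
  then show ?thesis using K by (simp add: ennreal_mult_top)
next
  case False
  define c where "c = 3 ^ CARD('n) * K"
  have c: "0 < c" using K by (simp add: c_def)
  obtain h where h: "hausdorff_measure s F = ennreal h" "0 \<le> h"
    using False by (cases "hausdorff_measure s F") auto
  have "emeasure m F \<le> ennreal (c * (l powr s * (h + e) + e))" if e: "0 < e" for e
  proof -
    have \<eta>: "0 < 1 / real l ^ Suc N" "1 / real l ^ Suc N < 1 / real l ^ N"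
      using l2 by (auto intro!: divide_strict_left_mono simp del: power_Suc intro: power_strict_increasing)
    have "hausdorff_measure s F < ennreal (h + e)" using h e by (simp add: ennreal_less_iff)
    then obtain U where U: "F \<subseteq> (\<Union>i. U i)" "\<And>i. bounded (U i)" "\<And>i. diameter (U i) \<le> 1 / real l ^ Suc N"
      "(\<Sum>i::nat. diam_pow s (U i)) < ennreal (h + e)" using hausdorff_covering[OF \<eta>(1)] by metis
    have "\<exists>V\<in>events. U i \<inter> F \<subseteq> V \<and>
        emeasure m V \<le> ennreal c * (ennreal (l powr s) * diam_pow s (U i) + ennreal (e * (1/2) ^ Suc i))" for i
    proof (cases "U i = {}")
      case False
      have "0 < e * (1/2) ^ Suc i" "diameter (U i) < 1 / real l ^ N" using e U(3)[of i] \<eta>(2) by auto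
      then obtain n where n: "N \<le> n" "diameter (U i) < 1 / real l ^ n"
        "ennreal (l powr (- (real n * s))) \<le> ennreal (l powr s) * diam_pow s (U i) + ennreal (e * (1/2) ^ Suc i)"
        using scale_selection[OF U(2) False _ s] by metis
      define T where "T = {w \<in> words n. I w \<inter> (U i \<inter> F) \<noteq> {}}"
      have T: "T \<subseteq> words n" "finite T" by (auto simp: T_def)
      have "dist x y \<le> 1 / real l ^ n" if "x \<in> U i \<inter> F" "y \<in> U i \<inter> F" for x y
        using diameter_bounded_bound[OF U(2)[of i], of x y] that n(2) by auto
      then have cT: "card T \<le> 3 ^ CARD('n)" unfolding T_def by (rule card_cubes_meeting)
      have "prob (\<Union>w\<in>T. I w) = (\<Sum>w\<in>T. p w)" by (rule prob_cubes[OF T(1)])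
      also have "\<dots> \<le> (\<Sum>w\<in>T. K * l powr (- (real n * s)))"
        by (intro sum_mono light[OF n(1)]) (auto simp: T_def)
      also have "\<dots> = real (card T) * (K * l powr (- (real n * s)))" by simp
      also have "\<dots> \<le> 3 ^ CARD('n) * (K * l powr (- (real n * s)))"
      proof (rule mult_right_mono)
        show "real (card T) \<le> 3 ^ CARD('n)"
          using cT by (metis of_nat_le_iff of_nat_numeral of_nat_power)
      qed (use K in simp)
      also have "\<dots> = c * l powr (- (real n * s))" by (simp add: c_def)
      finally have "emeasure m (\<Union>w\<in>T. I w) \<le> ennreal c * ennreal (l powr (- (real n * s)))"
        using c by (simp add: emeasure_eq_measure ennreal_leI flip: ennreal_mult)
      also have "\<dots> \<le> ennreal c * (ennreal (l powr s) * diam_pow s (U i) + ennreal (e * (1/2) ^ Suc i))"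
        by (intro mult_left_mono n(3)) simp
      finally have "emeasure m (\<Union>w\<in>T. I w)
        \<le> ennreal c * (ennreal (l powr s) * diam_pow s (U i) + ennreal (e * (1/2) ^ Suc i))" .
      moreover have "(\<Union>w\<in>T. I w) \<in> events"
        by (rule sets.finite_UN[OF T(2)]) (use T(1) cube_events in blast)
      moreover have "U i \<inter> F \<subseteq> (\<Union>w\<in>T. I w)"
      proof
        fix x assume x: "x \<in> U i \<inter> F"
        then obtain w where "w \<in> words n" "x \<in> I w" using F cube_ex by blast
        then show "x \<in> (\<Union>w\<in>T. I w)" using x by (auto simp: T_def)
      qed
      ultimately show ?thesis by blast
    qed (auto intro!: bexI[of _ "{}"])
    then obtain V where V: "\<And>i. V i \<in> events" "\<And>i. U i \<inter> F \<subseteq> V i"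
      "\<And>i. emeasure m (V i) \<le> ennreal c * (ennreal (l powr s) * diam_pow s (U i) + ennreal (e * (1/2) ^ Suc i))"
      by metis
    have "emeasure m F \<le> emeasure m (\<Union>i. V i)"
      by (rule emeasure_mono) (use U(1) V(1,2) in blast)+
    also have "\<dots> \<le> (\<Sum>i. emeasure m (V i))"
      by (rule emeasure_subadditive_countably) (use V(1) in auto)
    also have "\<dots> \<le> (\<Sum>i. ennreal c * (ennreal (l powr s) * diam_pow s (U i) + ennreal (e * (1/2) ^ Suc i)))"
      by (intro suminf_le V(3)) auto
    also have "\<dots> = ennreal c * (ennreal (l powr s) * (\<Sum>i. diam_pow s (U i)) + (\<Sum>i. ennreal (e * (1/2) ^ Suc i)))"
      by (simp add: suminf_add[symmetric])
    also have "(\<Sum>i. ennreal (e * (1/2) ^ Suc i)) = ennreal e"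
      using e by (intro suminf_geometric_ennreal) simp
    also have "ennreal c * (ennreal (l powr s) * (\<Sum>i. diam_pow s (U i)) + ennreal e)
        \<le> ennreal c * (ennreal (l powr s) * ennreal (h + e) + ennreal e)"
      using U(4) by (intro mult_left_mono add_right_mono) auto
    also have "\<dots> = ennreal (c * (l powr s * (h + e) + e))"
      using c h(2) e by (simp add: ennreal_mult ennreal_plus)
    finally show ?thesis .
  qed
  then have *: "prob F \<le> c * (l powr s * (h + e) + e)" if "0 < e" for e
    using that c h(2) by (simp add: emeasure_eq_measure)
  have "prob F \<le> c * l powr s * h"
  proof (rule field_le_epsilon)
    fix e :: real assume e: "0 < e"
    define e' where "e' = e / (c * (l powr s + 1))"
    have pos: "0 < c * (l powr s + 1)" using c by (simp add: add_pos_pos)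
    then have "0 < e'" using e by (simp add: e'_def)
    then have "prob F \<le> c * l powr s * h + c * (l powr s + 1) * e'"
      using *[of e'] by (simp add: algebra_simps)
    moreover have "x * (e / x) = e" if "0 < x" for x using that by simp
    then have "c * (l powr s + 1) * e' = e" using pos unfolding e'_def by blast
    ultimately show "prob F \<le> c * l powr s * h + e" by simp
  qed
  then show ?thesis
    using c h by (simp add: emeasure_eq_measure c_def ennreal_leI flip: ennreal_mult)
qed

end

context quasi_bernoulli_dim
begin

text \<open>The heavy cubes of all late generations have small total mass. What remains of \<open>E\<close> after
  removing them has positive measure and meets light cubes only.\<close>

lemma hausdorff_measure_pos:
  assumes E: "E \<in> sets borel" "0 < prob E" and s: "0 \<le> s" "s < d"
  shows "hausdorff_measure s E \<noteq> 0"
proof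
  assume H0: "hausdorff_measure s E = 0"
  obtain K \<rho> where \<rho>: "0 < \<rho>" "\<rho> < 1"
    "\<And>n. (\<Sum>w\<in>{w\<in>pos n. l powr (- (real n * s)) \<le> p w}. p w) \<le> K * \<rho> ^ n"
    using heavy_cubes_rare[OF s(2)] by blast
  define bad where "bad n = (\<Union>w\<in>{w\<in>pos n. l powr (- (real n * s)) \<le> p w}. I w)" for n
  have bad_ev: "bad n \<in> events" for n
    unfolding bad_def by (rule sets.finite_UN) (auto intro: cube_events pos_words)
  have bad: "prob (bad n) \<le> K * \<rho> ^ n" for n
    unfolding bad_def by (subst prob_cubes[of _ n]) (use \<rho>(3) pos_words in auto)
  have "(\<lambda>N. K * \<rho> ^ N / (1 - \<rho>)) \<longlonglongrightarrow> K * 0 / (1 - \<rho>)"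
    using \<rho> by (intro tendsto_intros LIMSEQ_power_zero) auto
  then have "\<forall>\<^sub>F N in sequentially. K * \<rho> ^ N / (1 - \<rho>) < prob E"
    by (rule order_tendstoD(2)) (use E(2) in simp)
  then obtain N where N: "K * \<rho> ^ N / (1 - \<rho>) < prob E" by (auto simp: eventually_sequentially)
  define B where "B = (\<Union>i. bad (i + N))"
  have B_ev: "B \<in> events" unfolding B_def using bad_ev by blast
  have sums: "(\<lambda>i. K * \<rho> ^ (i + N)) sums (K * \<rho> ^ N / (1 - \<rho>))"
    using sums_mult[OF geometric_sums[of \<rho>], of "K * \<rho> ^ N"] \<rho>(1,2) by (simp add: power_add mult_ac)
  have summ: "summable (\<lambda>i. prob (bad (i + N)))"
    by (rule summable_comparison_test'[OF sums_summable[OF sums]]) (use bad in simp)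
  have "prob B \<le> (\<Sum>i. prob (bad (i + N)))"
    unfolding B_def by (rule finite_measure_subadditive_countably) (use bad_ev summ in auto)
  also have "\<dots> \<le> (\<Sum>i. K * \<rho> ^ (i + N))"
    by (rule suminf_le[OF bad summ sums_summable[OF sums]])
  also have "\<dots> = K * \<rho> ^ N / (1 - \<rho>)" by (rule sums_unique[OF sums, symmetric])
  finally have less: "prob B < prob E" using N by linarith
  define F where "F = E \<inter> unit_cube - B"
  have unit_ev: "unit_cube \<in> events"
    unfolding unit_cube_eq[of 0] by (rule sets.finite_UN) (auto intro: cube_events)
  have "emeasure m F \<le> ennreal (3 ^ CARD('n) * 1 * l powr s) * hausdorff_measure s F"
  proof (rule mass_distribution[OF _ s(1)])
    show "F \<subseteq> unit_cube" by (auto simp: F_def)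
    fix n w assume n: "N \<le> n" and w: "w \<in> words n" "I w \<inter> F \<noteq> {}"
    show "p w \<le> 1 * l powr (- (real n * s))"
    proof (rule ccontr)
      assume "\<not> ?thesis"
      then have heavy: "l powr (- (real n * s)) < p w" by simp
      then have "0 < p w" using powr_ge_zero[of "real l"] by (meson le_less_trans)
      then have "I w \<subseteq> bad n" using heavy w(1) by (auto simp: bad_def pos_def)
      moreover have "bad n = bad ((n - N) + N)" using n by simp
      ultimately have "I w \<subseteq> B" unfolding B_def by blast
      then show False using w(2) by (auto simp: F_def)
    qed
  qed simp
  also have "hausdorff_measure s F = 0"
    using hausdorff_measure_mono[of F E s] H0 by (auto simp: F_def)
  finally have "prob F = 0" by (simp add: emeasure_eq_measure)
  moreover have "prob E \<le> prob (F \<union> B)"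
  proof (rule finite_measure_mono_AE)
    show "AE x in m. x \<in> E \<longrightarrow> x \<in> F \<union> B"
      using AE_prob_1[OF prob_unit_cube] by eventually_elim (auto simp: F_def)
    show "F \<union> B \<in> events" unfolding F_def using E(1) unit_ev B_ev by (simp add: sets_m)
  qed
  moreover have "prob (F \<union> B) \<le> prob F + prob B"
    by (rule measure_Un_le) (use E(1) unit_ev B_ev in \<open>auto simp: F_def sets_m\<close>)
  ultimately show False using less by linarith
qed

lemma dim_ge: "E \<in> sets borel \<Longrightarrow> 0 < emeasure m E \<Longrightarrow> d \<le> hausdorff_dim E"
  using hausdorff_measure_pos by (intro hausdorff_dim_ge) (auto simp: emeasure_eq_measure)

lemma measure_dim_eq:
  assumes E: "E \<in> sets borel" "emeasure m E = 1" "hausdorff_dim E \<le> d"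
  shows "measure_dim m = d"
proof -
  have dE: "hausdorff_dim E = d" using dim_ge[OF E(1)] E(2,3) by simp
  have "lower_dim m = d"
    unfolding lower_dim_def by (rule cInf_eq_minimum) (use E(1,2) dE dim_ge in auto)
  moreover have "upper_dim m = d"
    unfolding upper_dim_def by (rule cInf_eq_minimum) (use E(1,2) dE dim_ge in auto)
  ultimately show ?thesis unfolding measure_dim_def by (intro the_equality) auto
qed

end

section \<open>The support\<close>

context quasi_bernoulli_cubes
begin

abbreviation supp :: "(real^'n) set" where "supp \<equiv> closed_support m"

lemma supp_closed: "closed supp"
proof -
  have "- supp = \<Union>{U. open U \<and> \<not> 0 < emeasure m U}" by (auto simp: closed_support_def)
  then show ?thesis unfolding closed_def by (simp add: open_Union)
qed

lemma supp_full: "AE x in m. x \<in> supp"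
proof -
  define \<U> where "\<U> = {U. open U \<and> emeasure m U = 0}"
  have "\<And>U. U \<in> \<U> \<Longrightarrow> open U" by (simp add: \<U>_def)
  then obtain \<V> where V: "\<V> \<subseteq> \<U>" "countable \<V>" "\<Union> \<V> = \<Union> \<U>" by (rule Lindelof)
  have "(\<Union>U\<in>\<V>. U) \<in> null_sets m"
    by (rule null_sets_UN'[OF V(2)]) (use V(1) in \<open>auto simp: \<U>_def null_sets_def sets_m\<close>)
  then have "AE x in m. x \<notin> \<Union> \<U>" using V(3) AE_not_in by fastforce
  moreover have "x \<in> supp" if "x \<notin> \<Union> \<U>" for x
    using that by (auto simp: \<U>_def closed_support_def zero_less_iff_neq_zero)
  ultimately show ?thesis by (auto elim: eventually_mono)
qed

lemma supp_borel: "supp \<in> sets borel" and supp_measure: "emeasure m supp = 1"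
proof -
  show "supp \<in> sets borel" using supp_closed by (rule borel_closed)
  then have "AE x in m. (x \<in> UNIV) = (x \<in> supp)" "supp \<in> sets m"
    using supp_full by (simp_all add: sets_m)
  then have "emeasure m UNIV = emeasure m supp"
    by (intro emeasure_eq_AE) (simp_all add: sets_m)
  then show "emeasure m supp = 1" using emeasure_space_1 by (simp add: space_m)
qed

lemma supp_cover:
  assumes "x \<in> supp" shows "\<exists>w\<in>pos n. x \<in> closure (I w)"
proof (rule ccontr)
  assume no: "\<not> ?thesis"
  define V where "V = - (\<Union>w\<in>pos n. closure (I w))"
  have "open V" unfolding V_def by (intro open_Compl closed_UN) auto
  moreover have "x \<in> V" using no by (auto simp: V_def)
  ultimately have "0 < emeasure m V" using assms by (auto simp: closed_support_def)
  moreover have "AE y in m. y \<in> (\<Union>w\<in>pos n. I w)" by (rule AE_prob_1[OF prob_pos_cubes])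
  then have "AE y in m. y \<notin> V"
    by eventually_elim (use closure_subset in \<open>auto simp: V_def\<close>)
  from emeasure_eq_0_AE[OF this] have "emeasure m V = 0" by (simp add: space_m)
  ultimately show False by simp
qed

lemma supp_compact: "compact supp"
proof -
  have "supp \<subseteq> (\<Union>w\<in>pos 0. closure (I w))" using supp_cover by blast
  moreover have "bounded (\<Union>w\<in>pos 0. closure (I w))"
    by (intro bounded_UN) (auto intro: cube_bounded pos_words)
  ultimately show ?thesis using supp_closed bounded_subset compact_eq_bounded_closed by blast
qed

lemma pos_meets_supp:
  assumes "w \<in> pos n" shows "I w \<inter> supp \<noteq> {}"
proof
  assume "I w \<inter> supp = {}"
  then have "AE x in m. x \<notin> I w" using supp_full by (auto elim: eventually_mono)
  from emeasure_eq_0_AE[OF this] have "emeasure m (I w) = 0" by (simp add: space_m)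
  then show False using pos_p[OF assms] by (simp add: emeasure_eq_measure)
qed

text \<open>Words of positive measure are closed under concatenation and under passing to factors, and
  there are exactly \<open>l powr (n * \<tau> 0)\<close> of length \<open>n\<close>. A covering set of the size of a cube of
  generation \<open>n\<close> meets at most \<open>3 ^ D\<close> such cubes and hence captures only the proportion
  \<open>3 ^ D * l powr (- n * \<tau> 0)\<close> of the positive words of a large length. For a finite covering these
  proportions must add up to at least \<open>1\<close>, and compactness of the support reduces the general
  case to finite coverings by open sets.\<close>

lemma hausdorff_measure_supp_pos:
  assumes s: "0 \<le> s" "s \<le> \<tau> 0"
  shows "hausdorff_measure s supp \<noteq> 0"
proof
  assume H0: "hausdorff_measure s supp = 0"
  define M where "M = (3::real) ^ CARD('n)"
  have M: "0 < M" by (simp add: M_def)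
  define e where "e = 1 / (4 * M)"
  define b where "b = 1 / (4 * M * l powr s)"
  have e: "0 < e" and b: "0 < b" using M by (simp_all add: e_def b_def)
  have "hausdorff_measure s supp < ennreal b" using H0 b by simp
  moreover have "0 < 1 / real l" by simp
  ultimately obtain U where U: "supp \<subseteq> (\<Union>i. U i)" "\<And>i. bounded (U i)" "\<And>i. diameter (U i) \<le> 1 / real l"
      "(\<Sum>i::nat. diam_pow s (U i)) < ennreal b" using hausdorff_covering by metis
  define good where "good i n V \<longleftrightarrow> open V \<and> U i \<subseteq> V \<and> (U i = {} \<longrightarrow> V = {}) \<and>
      (\<forall>x\<in>V. \<forall>y\<in>V. dist x y \<le> 1 / real l ^ n) \<and>
      (U i \<noteq> {} \<longrightarrow> ennreal (l powr (- (real n * s))) \<le> ennreal (l powr s) * diam_pow s (U i) + ennreal (e * (1/2) ^ Suc i))"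
    for i n V
  have "\<exists>n V. good i n V" for i
  proof (cases "U i = {}")
    case False
    have "1 / real l < 1 / real l ^ 0" using l2 by simp
    with U(3)[of i] have "diameter (U i) < 1 / real l ^ 0" by (rule le_less_trans)
    moreover have "0 < e * (1/2) ^ Suc i" using e by simp
    ultimately obtain n where n: "diameter (U i) < 1 / real l ^ n"
      "ennreal (l powr (- (real n * s))) \<le> ennreal (l powr s) * diam_pow s (U i) + ennreal (e * (1/2) ^ Suc i)"
      using scale_selection[OF U(2) False _ s(1)] by metis
    define r where "r = (1 / real l ^ n - diameter (U i)) / 2"
    have r: "0 < r" using n(1) by (simp add: r_def)
    define V where "V = (\<Union>x\<in>U i. ball x r)"
    have "dist x y \<le> 1 / real l ^ n" if xy: "x \<in> V" "y \<in> V" for x y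
    proof -
      obtain x' y' where x': "x' \<in> U i" "dist x' x < r" and y': "y' \<in> U i" "dist y' y < r"
        using xy by (auto simp: V_def)
      have "dist x' y' \<le> diameter (U i)" by (rule diameter_bounded_bound[OF U(2) x'(1) y'(1)])
      moreover have "dist x y \<le> dist x' x + dist x' y' + dist y' y"
        using dist_triangle[of x y x'] dist_triangle[of x' y y'] by (simp add: dist_commute)
      ultimately have "dist x y \<le> diameter (U i) + 2 * r" using x'(2) y'(2) by linarith
      moreover have "2 * (t / 2) = t" for t :: real by simp
      then have "2 * r = 1 / real l ^ n - diameter (U i)" unfolding r_def .
      ultimately show ?thesis by linarith
    qed
    moreover have "open V" by (auto simp: V_def)
    moreover have "U i \<subseteq> V" using r by (auto simp: V_def intro: bexI[rotated])
    ultimately have "good i n V" using n(2) False unfolding good_def by blast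
    then show ?thesis by blast
  next
    case True
    then have "good i 0 {}" by (simp add: good_def)
    then show ?thesis by blast
  qed
  then obtain n V where "\<And>i. good i (n i) (V i)" by metis
  then have V: "\<And>i. open (V i)" "\<And>i. U i \<subseteq> V i" "\<And>i. U i = {} \<Longrightarrow> V i = {}"
    "\<And>i x y. x \<in> V i \<Longrightarrow> y \<in> V i \<Longrightarrow> dist x y \<le> 1 / real l ^ n i"
    "\<And>i. U i \<noteq> {} \<Longrightarrow> ennreal (l powr (- (real (n i) * s))) \<le> ennreal (l powr s) * diam_pow s (U i) + ennreal (e * (1/2) ^ Suc i)"
    unfolding good_def by blast+
  have "supp \<subseteq> (\<Union>i\<in>UNIV. V i)" using U(1) V(2) by blast
  then obtain J where J: "finite J" "supp \<subseteq> (\<Union>i\<in>J. V i)"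
    by (rule compactE_image[OF supp_compact V(1)])
  define J' where "J' = {i \<in> J. U i \<noteq> {}}"
  have J': "finite J'" using J(1) by (simp add: J'_def)
  have J'_cover: "supp \<subseteq> (\<Union>i\<in>J'. V i)"
  proof
    fix x assume "x \<in> supp"
    then obtain i where i: "i \<in> J" "x \<in> V i" using J(2) by blast
    then have "i \<in> J'" using V(3)[of i] by (auto simp: J'_def)
    then show "x \<in> (\<Union>i\<in>J'. V i)" using i(2) by blast
  qed
  \<comment> \<open>Any common upper bound of the generations would do.\<close>
  define N where "N = (\<Sum>i\<in>J'. n i)"
  have nN: "n i \<le> N" if "i \<in> J'" for i
    unfolding N_def using member_le_sum[OF that, of n] J' by simp
  define T where "T i = {v \<in> words (n i). I v \<inter> V i \<noteq> {}}" for i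
  define A where "A i = {w \<in> pos N. take (n i) w \<in> T i}" for i
  have card_T: "real (card (T i)) \<le> M" for i
  proof -
    have "card (T i) \<le> 3 ^ CARD('n)" unfolding T_def by (rule card_cubes_meeting[OF V(4)])
    then show ?thesis unfolding M_def by (metis of_nat_le_iff of_nat_numeral of_nat_power)
  qed
  have card_A: "real (card (A i)) \<le> M * l powr (real (N - n i) * \<tau> 0)" if i: "i \<in> J'" for i
  proof -
    let ?f = "\<lambda>w. (take (n i) w, drop (n i) w)"
    have "inj_on ?f (A i)" by (rule inj_onI) (metis append_take_drop_id prod.inject)
    moreover have "?f ` A i \<subseteq> T i \<times> pos (N - n i)"
    proof
      fix z assume "z \<in> ?f ` A i"
      then obtain w where w: "w \<in> A i" "z = ?f w" by blast
      have wN: "w \<in> pos N" "w \<in> words N" using w(1) pos_words by (auto simp: A_def)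
      have "take (n i) w @ drop (n i) w \<in> pos (n i + (N - n i))" using wN(1) nN[OF i] by simp
      then have "drop (n i) w \<in> pos (N - n i)"
        using pos_append_iff[OF words_take[OF wN(2) nN[OF i]] words_drop[OF wN(2)]] by blast
      then show "z \<in> T i \<times> pos (N - n i)" using w by (auto simp: A_def)
    qed
    moreover have "finite (T i)" by (simp add: T_def)
    ultimately have "card (A i) \<le> card (T i \<times> pos (N - n i))"
      by (intro card_inj_on_le[of ?f]) auto
    then have "real (card (A i)) \<le> real (card (T i)) * real (card (pos (N - n i)))"
      by (metis card_cartesian_product of_nat_le_iff of_nat_mult)
    also have "\<dots> \<le> M * real (card (pos (N - n i)))" by (intro mult_right_mono card_T) simp
    finally show ?thesis by (simp only: card_pos)
  qed
  have "pos N \<subseteq> (\<Union>i\<in>J'. A i)"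
  proof
    fix w assume w: "w \<in> pos N"
    then obtain x where x: "x \<in> I w" "x \<in> supp" using pos_meets_supp by blast
    then obtain i where i: "i \<in> J'" "x \<in> V i" using J'_cover by blast
    have ww: "w \<in> words N" by (rule pos_words[OF w])
    have "x \<in> I (take (n i) w)" using cube_take_subset[OF ww nN[OF i(1)]] x(1) by blast
    then have "w \<in> A i" using w i words_take[OF ww nN[OF i(1)]] by (auto simp: A_def T_def)
    then show "w \<in> (\<Union>i\<in>J'. A i)" using i(1) by blast
  qed
  then have "card (pos N) \<le> card (\<Union>i\<in>J'. A i)" by (intro card_mono) (use J' in \<open>auto simp: A_def\<close>)
  also have "\<dots> \<le> (\<Sum>i\<in>J'. card (A i))" by (rule card_UN_le[OF J'])
  finally have "real (card (pos N)) \<le> (\<Sum>i\<in>J'. real (card (A i)))"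
    by (metis of_nat_le_iff of_nat_sum)
  also have "\<dots> \<le> (\<Sum>i\<in>J'. l powr (real N * \<tau> 0) * (M * l powr (- (real (n i) * s))))"
  proof (rule sum_mono)
    fix i assume i: "i \<in> J'"
    have "real (card (A i)) \<le> M * l powr (real (N - n i) * \<tau> 0)" by (rule card_A[OF i])
    also have "l powr (real (N - n i) * \<tau> 0) = l powr (real N * \<tau> 0) * l powr (- (real (n i) * \<tau> 0))"
      using nN[OF i] by (simp add: powr_add[symmetric] of_nat_diff algebra_simps)
    also have "M * (l powr (real N * \<tau> 0) * l powr (- (real (n i) * \<tau> 0)))
        \<le> M * (l powr (real N * \<tau> 0) * l powr (- (real (n i) * s)))"
      using s(2) l_pos(3) M by (intro mult_left_mono powr_mono) (auto intro: mult_left_mono)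
    finally show "real (card (A i)) \<le> l powr (real N * \<tau> 0) * (M * l powr (- (real (n i) * s)))"
      by (simp only: mult_ac)
  qed
  also have "\<dots> = l powr (real N * \<tau> 0) * (M * (\<Sum>i\<in>J'. l powr (- (real (n i) * s))))"
    by (simp add: sum_distrib_left)
  finally have "l powr (real N * \<tau> 0) * 1 \<le> l powr (real N * \<tau> 0) * (M * (\<Sum>i\<in>J'. l powr (- (real (n i) * s))))"
    by (simp only: card_pos mult_1_right)
  then have big: "1 \<le> M * (\<Sum>i\<in>J'. l powr (- (real (n i) * s)))"
    by (subst (asm) mult_le_cancel_left_pos) simp_all
  have "ennreal (\<Sum>i\<in>J'. l powr (- (real (n i) * s))) = (\<Sum>i\<in>J'. ennreal (l powr (- (real (n i) * s))))"
    by (rule sum_ennreal[symmetric]) simp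
  also have "\<dots> \<le> (\<Sum>i\<in>J'. ennreal (l powr s) * diam_pow s (U i) + ennreal (e * (1/2) ^ Suc i))"
    by (intro sum_mono V(5)) (simp add: J'_def)
  also have "\<dots> \<le> (\<Sum>i. ennreal (l powr s) * diam_pow s (U i) + ennreal (e * (1/2) ^ Suc i))"
    by (rule sum_le_suminf) (use J' in auto)
  also have "\<dots> = ennreal (l powr s) * (\<Sum>i. diam_pow s (U i)) + (\<Sum>i. ennreal (e * (1/2) ^ Suc i))"
    by (simp add: suminf_add[symmetric])
  also have "(\<Sum>i. ennreal (e * (1/2) ^ Suc i)) = ennreal e"
    using e by (intro suminf_geometric_ennreal) simp
  also have "ennreal (l powr s) * (\<Sum>i. diam_pow s (U i)) + ennreal e \<le> ennreal (l powr s) * ennreal b + ennreal e"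
    using U(4) by (intro add_right_mono mult_left_mono) auto
  also have "\<dots> = ennreal (l powr s * b + e)" using b e by (simp add: ennreal_mult ennreal_plus)
  finally have "(\<Sum>i\<in>J'. l powr (- (real (n i) * s))) \<le> l powr s * b + e"
    using b e by (subst (asm) ennreal_le_iff) auto
  also have "\<dots> = 1 / (2 * M)" using M by (simp add: b_def e_def)
  finally have "M * (\<Sum>i\<in>J'. l powr (- (real (n i) * s))) \<le> M * (1 / (2 * M))"
    using M by (intro mult_left_mono) auto
  also have "\<dots> = 1 / 2" using M by simp
  finally show False using big by simp
qed

end

section \<open>The case of an affine spectrum\<close>

context quasi_bernoulli_dim
begin

text \<open>Points of the support lie in closures of cubes whose mass is at least a constant times the
  \<open>d\<close>-th power of the side, hence eventually exceeds every multiple of the \<open>s\<close>-th power if \<open>s > d\<close>.\<close>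

lemma supp_dim:
  assumes ratio: "\<And>n w. w \<in> pos n \<Longrightarrow> 1 \<le> C * R w"
  shows "hausdorff_dim supp = d"
proof (rule antisym)
  show "hausdorff_dim supp \<le> d"
  proof (rule dense_ge)
    fix s assume s: "d < s"
    have "hausdorff_measure s supp = 0"
    proof (rule hausdorff_null_if_heavy)
      show "0 \<le> s" using s d_nonneg by linarith
      fix x k N assume x: "x \<in> supp"
      have "1 < l powr (s - d)" using s l_pos(3) by (intro gr_one_powr) auto
      then obtain n0 where n0: "real k * C < (l powr (s - d)) ^ n0" using real_arch_pow by blast
      define n where "n = max N n0"
      have "(l powr (s - d)) ^ n0 \<le> (l powr (s - d)) ^ n"
        using \<open>1 < l powr (s - d)\<close> by (intro power_increasing) (auto simp: n_def)
      also have "\<dots> = l powr (real n * (s - d))" by (simp add: powr_power)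
      finally have kC: "real k * C \<le> l powr (real n * (s - d))" using n0 by linarith
      obtain w where w: "w \<in> pos n" "x \<in> closure (I w)" using supp_cover[OF x] by blast
      have len: "length w = n" by (rule words_length[OF pos_words[OF w(1)]])
      have "real k * l powr (- (real n * s)) * C = real k * C * l powr (- (real n * s))" by simp
      also have "\<dots> \<le> l powr (real n * (s - d)) * l powr (- (real n * s))"
        by (rule mult_right_mono[OF kC]) simp
      also have "\<dots> = l powr (- (real n * d))" by (simp add: powr_add[symmetric] algebra_simps)
      also have "\<dots> \<le> C * p w"
        using ratio[OF w(1)] unfolding R_def len by (simp add: powr_minus_divide divide_le_eq mult_ac)
      finally have "real k * l powr (- (real n * s)) \<le> p w" by (simp add: mult.commute[of C])
      then show "\<exists>n\<ge>N. \<exists>w\<in>pos n. x \<in> closure (I w) \<and> real k * l powr (- (real n * s)) \<le> p w"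
        using w by (intro exI[of _ n]) (auto simp: n_def)
    qed
    then show "hausdorff_dim supp \<le> s" using s d_nonneg by (intro hausdorff_dim_le) auto
  qed
  show "d \<le> hausdorff_dim supp"
    by (rule dim_ge[OF supp_borel]) (simp add: supp_measure)
qed

text \<open>The part of the support in an open set is covered by the closures of the cubes of positive
  measure whose closures lie in that set. Closures cannot be avoided: the support may contain points
  of an upper face of such a cube that belong to half-open cubes of measure zero only.\<close>

lemma hausdorff_open_le:
  assumes ratio: "\<And>n w. w \<in> pos n \<Longrightarrow> 1 \<le> C * R w" and "open U"
  shows "hausdorff_measure d (U \<inter> supp) \<le> ennreal (real CARD('n) powr d * C * prob U)"
proof (rule hausdorff_measure_le)
  fix \<eta> :: real assume "0 < \<eta>"
  then obtain N where N: "\<And>n. N \<le> n \<Longrightarrow> real CARD('n) / real l ^ n < \<eta>"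
    using small_scale by blast
  define Q where "Q = {w. \<exists>n\<ge>N. w \<in> pos n \<and> closure (I w) \<subseteq> U}"
  show "hausdorff_pre d \<eta> (U \<inter> supp) \<le> ennreal (real CARD('n) powr d * C * prob U)"
  proof (rule hausdorff_pre_cover)
    show "Q \<subseteq> all_words" by (auto simp: Q_def intro: words_all pos_words)
    show "N \<le> length w" if "w \<in> Q" for w
      using that by (auto simp: Q_def dest: pos_words words_length)
    show "l powr (- (real (length w) * d)) \<le> C * p w" if "w \<in> Q" for w
    proof -
      have "1 \<le> C * R w" using that ratio by (auto simp: Q_def)
      then show ?thesis unfolding R_def by (simp add: powr_minus_divide divide_le_eq mult_ac)
    qed
    show "I w \<subseteq> U" if "w \<in> Q" for w using that closure_subset[of "I w"] by (auto simp: Q_def)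
    show "U \<in> sets borel" using assms(2) by simp
    show "U \<inter> supp \<subseteq> (\<Union>w\<in>Q. closure (I w))"
    proof
      fix x assume x: "x \<in> U \<inter> supp"
      then obtain r where r: "0 < r" "ball x r \<subseteq> U" using assms(2) by (auto simp: open_contains_ball)
      obtain N' where N': "\<And>n. N' \<le> n \<Longrightarrow> real CARD('n) / real l ^ n < r" using small_scale[OF r(1)] by blast
      obtain w where w: "w \<in> pos (max N N')" "x \<in> closure (I w)" using supp_cover x by blast
      have "closure (I w) \<subseteq> ball x r"
      proof
        fix y assume "y \<in> closure (I w)"
        from cube_dist[OF pos_words[OF w(1)] w(2) this] N'[of "max N N'"]
        show "y \<in> ball x r" by simp
      qed
      then have "w \<in> Q" unfolding Q_def using r(2) w(1) by (intro CollectI exI[of _ "max N N'"]) auto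
      then show "x \<in> (\<Union>w\<in>Q. closure (I w))" using w(2) by blast
    qed
    show "real CARD('n) / real l ^ N \<le> \<eta>" using N[of N] by simp
  qed (use d_nonneg C1 in auto)
qed

text \<open>One inequality passes from open sets to Borel sets by outer regularity of \<open>m\<close>; the
  other one is the mass distribution principle.\<close>

lemma strongly_equivalent:
  assumes ratio: "\<And>n w. w \<in> pos n \<Longrightarrow> R w \<le> C" "\<And>n w. w \<in> pos n \<Longrightarrow> 1 \<le> C * R w"
  shows "strongly_equiv_hausdorff d m"
proof -
  define a where "a = real CARD('n) powr d * C"
  define b where "b = 3 ^ CARD('n) * C * l powr d"
  define K where "K = max 1 (max a b)"
  have a: "0 < a" using C1 by (simp add: a_def)
  have K: "1 \<le> K" "a \<le> K" "b \<le> K" by (auto simp: K_def)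
  have "ennreal (1 / K) * hausdorff_measure d (A \<inter> supp) \<le> emeasure m A"
    if A: "A \<in> sets borel" for A
  proof -
    have "emeasure m A = (INF U\<in>{U. A \<subseteq> U \<and> open U}. emeasure m U)"
      by (rule outer_regular[OF sets_m _ A]) (simp add: emeasure_eq_measure)
    also have "ennreal (1 / K) * hausdorff_measure d (A \<inter> supp) \<le> \<dots>"
    proof (rule INF_greatest)
      fix U assume "U \<in> {U. A \<subseteq> U \<and> open U}"
      then have U: "A \<subseteq> U" "open U" by auto
      have "hausdorff_measure d (A \<inter> supp) \<le> hausdorff_measure d (U \<inter> supp)"
        using U(1) by (intro hausdorff_measure_mono) auto
      also have "\<dots> \<le> ennreal (a * prob U)"
        unfolding a_def by (rule hausdorff_open_le[OF ratio(2) U(2)])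
      also have "\<dots> \<le> ennreal (K * prob U)" by (intro ennreal_leI mult_right_mono K) simp
      finally have "ennreal (1 / K) * hausdorff_measure d (A \<inter> supp) \<le> ennreal (1 / K) * ennreal (K * prob U)"
        by (intro mult_left_mono) simp_all
      also have "\<dots> = emeasure m U"
        using K(1) by (simp add: emeasure_eq_measure ennreal_mult[symmetric])
      finally show "ennreal (1 / K) * hausdorff_measure d (A \<inter> supp) \<le> emeasure m U" .
    qed
    finally show ?thesis .
  qed
  moreover have "emeasure m A \<le> ennreal K * hausdorff_measure d (A \<inter> supp)"
    if A: "A \<in> sets borel" for A
  proof -
    define F where "F = A \<inter> supp \<inter> unit_cube"
    have unit_ev: "unit_cube \<in> events"
      unfolding unit_cube_eq[of 0] by (rule sets.finite_UN) (auto intro: cube_events)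
    have supp_ev: "supp \<in> events" using supp_closed by (simp add: sets_m)
    have "emeasure m A \<le> emeasure m F"
    proof (rule emeasure_mono_AE)
      show "AE x in m. x \<in> A \<longrightarrow> x \<in> F"
        using supp_full AE_prob_1[OF prob_unit_cube] by eventually_elim (simp add: F_def)
      show "F \<in> events" unfolding F_def using A unit_ev supp_ev sets_m by blast
    qed
    also have "\<dots> \<le> ennreal (3 ^ CARD('n) * C * l powr d) * hausdorff_measure d F"
    proof (rule mass_distribution[OF _ d_nonneg])
      show "F \<subseteq> unit_cube" by (simp add: F_def)
      show "0 < C" by simp
      show "p w \<le> C * l powr (- (real n * d))" if w: "w \<in> words n" for n w
      proof (cases "w \<in> pos n")
        case True
        have len: "length w = n" by (rule words_length[OF w])
        show ?thesis
          using ratio(1)[OF True] unfolding R_def len by (simp add: powr_minus_divide le_divide_eq)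
      next
        case False
        then have "p w = 0" using w by (simp add: pos_def less_le)
        then show ?thesis using less_imp_le[OF C_pos(1)] by simp
      qed
    qed
    also have "\<dots> \<le> ennreal K * hausdorff_measure d (A \<inter> supp)"
    proof (rule mult_mono)
      show "ennreal (3 ^ CARD('n) * C * l powr d) \<le> ennreal K" using K(3) by (simp add: b_def ennreal_leI)
      show "hausdorff_measure d F \<le> hausdorff_measure d (A \<inter> supp)"
        by (rule hausdorff_measure_mono) (auto simp: F_def)
    qed simp_all
    finally show ?thesis .
  qed
  ultimately show ?thesis unfolding strongly_equiv_hausdorff_def using K(1) by blast
qed

section \<open>The dichotomy\<close>

lemma affine_case:
  assumes "\<And>t. \<psi> t = 0"
  shows "measure_dim m = d" "hausdorff_dim supp = d" "strongly_equiv_hausdorff d m"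
proof -
  have ratio: "R w \<le> C" "1 \<le> C * R w" if "w \<in> pos n" for n w
    using ratio_bounded[OF assms that] by auto
  show dim: "hausdorff_dim supp = d" by (rule supp_dim[OF ratio(2)])
  show "measure_dim m = d" by (rule measure_dim_eq[OF supp_borel supp_measure]) (simp add: dim)
  show "strongly_equiv_hausdorff d m" by (rule strongly_equivalent[OF ratio])
qed

text \<open>The strict inequality means \<open>\<psi> (- 1) > 0\<close>. A zero of \<open>\<psi>\<close> at \<open>- 1\<close> would, by midpoint
  convexity, propagate to the points \<open>- 1 / 2 ^ k\<close>, contradicting the leading term at \<open>0\<close>.\<close>

lemma curved_case:
  assumes lead: "((\<lambda>t. \<psi> t / t ^ j) \<longlongrightarrow> b) (at 0)" "b \<noteq> 0"
  shows "measure_dim m = d" "d < hausdorff_dim supp"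
proof -
  show "measure_dim m = d"
  proof (rule measure_dim_eq[OF often_borel])
    show "emeasure m (often (\<lambda>k w. real k \<le> R w)) = 1"
      using heavy_often[OF lead] by (simp add: emeasure_eq_measure)
    show "hausdorff_dim (often (\<lambda>k w. real k \<le> R w)) \<le> d"
      by (rule hausdorff_dim_le[OF heavy_often_null d_nonneg])
  qed
  have "\<psi> (- 1) \<noteq> 0"
  proof
    assume "\<psi> (- 1) = 0"
    then have z: "\<psi> (- 1 / 2 ^ k) = 0" for k by (rule psi_zero_halves)
    have "(\<lambda>k. \<psi> (- 1 / 2 ^ k) / (- 1 / 2 ^ k) ^ j) \<longlonglongrightarrow> b"
      by (rule filterlim_compose[OF lead(1) halves_at_0]) simp
    then have "(\<lambda>k::nat. 0) \<longlonglongrightarrow> b" unfolding z div_0 .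
    then have "0 = b" by (rule LIMSEQ_unique[OF tendsto_const])
    then show False using lead(2) by simp
  qed
  then have "0 < \<psi> (- 1)" using psi_nonneg[of "- 1"] by simp
  then have "d < \<tau> 0" by (simp add: \<psi>_def)
  also have "\<tau> 0 \<le> hausdorff_dim supp"
    by (rule hausdorff_dim_ge) (simp add: hausdorff_measure_supp_pos)
  finally show "d < hausdorff_dim supp" .
qed

end

theorem corollary4p14:
  fixes l :: nat
    and I :: "nat list \<Rightarrow> (real^'n) set"
    and m :: "(real^'n) measure"
    and \<delta> d :: real
  assumes "l \<ge> 2"
    and "cube_coding l I"
    and "sets m = sets borel"
    and "prob_space m"
    and "emeasure m unit_cube = 1"
    and "quasi_bernoulli l I m"
    and "real_analytic (Lq_spectrum l m)"
    and "\<delta> = hausdorff_dim (closed_support m)"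
    and "d = measure_dim m"
  shows "(d = \<delta> \<and> strongly_equiv_hausdorff \<delta> m) \<or>
         (d < \<delta> \<and> singular_hausdorff d m \<and> abs_continuous_packing d m)"
proof -
  obtain C where C: "C \<ge> 1"
    and qb: "\<And>u v. u \<in> lists {..<l ^ CARD('n)} \<Longrightarrow> v \<in> lists {..<l ^ CARD('n)} \<Longrightarrow>
        1 / C * (measure m (I u) * measure m (I v)) \<le> measure m (I (u @ v)) \<and>
        measure m (I (u @ v)) \<le> C * (measure m (I u) * measure m (I v))"
    using assms(6) unfolding quasi_bernoulli_def by blast
  have lower: "measure m (I u) * measure m (I v) \<le> C * measure m (I (u @ v))"
    if "u \<in> lists {..<l ^ CARD('n)}" "v \<in> lists {..<l ^ CARD('n)}" for u v
    using qb[OF that] C by (simp add: divide_le_eq mult.commute)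
  have upper: "measure m (I (u @ v)) \<le> C * (measure m (I u) * measure m (I v))"
    if "u \<in> lists {..<l ^ CARD('n)}" "v \<in> lists {..<l ^ CARD('n)}" for u v
    using qb[OF that] by simp
  obtain f' where f': "(Lq_spectrum l m has_real_derivative f') (at 1)"
    using real_analytic_differentiable[OF assms(7)] by blast
  define d0 where "d0 = - f'"
  have "quasi_bernoulli_dim m l I C d0"
  proof (intro quasi_bernoulli_dim.intro quasi_bernoulli_cubes.intro
      quasi_bernoulli_cubes_axioms.intro quasi_bernoulli_dim_axioms.intro)
    show "prob_space m" "l \<ge> 2" "cube_coding l I" "sets m = sets borel" "emeasure m unit_cube = 1" "C \<ge> 1"
      by (rule assms C)+
    show "measure m (I u) * measure m (I v) \<le> C * measure m (I (u @ v))"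
      if "u \<in> lists {..<l ^ CARD('n)}" "v \<in> lists {..<l ^ CARD('n)}" for u v
      using that by (rule lower)
    show "measure m (I (u @ v)) \<le> C * (measure m (I u) * measure m (I v))"
      if "u \<in> lists {..<l ^ CARD('n)}" "v \<in> lists {..<l ^ CARD('n)}" for u v
      using that by (rule upper)
    show "(Lq_spectrum l m has_real_derivative - d0) (at 1)" using f' by (simp add: d0_def)
  qed
  then interpret quasi_bernoulli_dim m l I C d0 .
  \<comment> \<open>This is \<open>\<psi>\<close> recentred at \<open>1\<close>.\<close>
  define f where "f y = Lq_spectrum l m y + (- d0 + d0 * y)" for y
  have f: "real_analytic f" unfolding f_def by (rule real_analytic_add_affine[OF assms(7)])
  have f_psi: "f (1 + t) = \<psi> t" for t by (simp add: f_def \<psi>_def algebra_simps)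
  consider (affine) "\<exists>r>0. \<forall>y. \<bar>y - 1\<bar> < r \<longrightarrow> f y = 0"
    | (curved) j b where "b \<noteq> 0" "((\<lambda>t. f (1 + t) / t ^ j) \<longlongrightarrow> b) (at 0)"
    using real_analytic_leading_term[OF f, of 1] by blast
  then show ?thesis
  proof cases
    case affine
    then obtain r where "r > 0" "\<And>y. \<bar>y - 1\<bar> < r \<Longrightarrow> f y = 0" by blast
    then have "f y = 0" for y by (rule real_analytic_identity[OF f])
    then have "\<psi> t = 0" for t using f_psi by metis
    from affine_case[OF this] show ?thesis using assms(8,9) by simp
  next
    case curved
    then have lead: "((\<lambda>t. \<psi> t / t ^ j) \<longlongrightarrow> b) (at 0)" "b \<noteq> 0" by (simp_all add: f_psi)
    show ?thesis
      using curved_case[OF lead] singular[OF lead] abs_continuous[OF lead] assms(8,9) by simp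
  qed
qed

end
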